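(* Let $X$ be a transient Borel right process with potential densities $u(x,y)$ with respect to $m$, and let $\mu$ be its loop measure, as described in the context. Then for any integer $k\geq 2$ and any bounded measurable functions $f_1,\ldots,f_k$ on $S$ with compact support, $$\mu\left(\prod_{j=1}^{k}\int_{0}^{\infty} f_{j}(X_{t_{j}})\,dt_{j}\right)=\sum_{\pi\in\mathcal{P}_{k}^{\odot}}\int u(x_{1},x_{2})\,u(x_{2},x_{3})\cdots u(x_{k-1},x_k)\,u(x_{k},x_{1})\prod_{j=1}^{k}f_{\pi_{j}}(x_{j})\,dm(x_{j}).$$
   Context: Setting. $S$ is a locally compact space with countable base, and $X=(\Omega,\mathcal{F}_t,X_t,\theta_t,P^x)$ is a transient Borel right process with state space $S$ and transition semigroup $(P_t)_{t\ge 0}$. It is in canonical form: $\Omega$ is the set of right continuous paths $\omega:[0,\infty)\to S_\Delta=S\cup\{\Delta\}$, $\Delta\notin S$, such that $\omega(t)=\Delta$ for all $t\ge\zeta(\omega)=\inf\{t>0:\omega(t)=\Delta\}$, and $X_t(\omega)=\omega(t)$. Functions on $S$ are extended by $0$ at $\Delta$. $m$ is a Borel measure on $S$, finite on compact sets. No transition densities are assumed, but $X$ has strictly positive potential densities $u^\alpha(x,y)$, $\alpha\ge 0$, with respect to $m$: $\int_0^\infty e^{-\alpha t}P_t(x,dy)\,dt=u^\alpha(x,y)\,m(dy)$, and these satisfy the resolvent equations $u^\alpha(x,y)=u^\beta(x,y)+(\beta-\alpha)\int u^\alpha(x,z)u^\beta(z,y)\,dm(z)=u^\beta(x,y)+(\beta-\alpha)\int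 u^\beta(x,z)u^\alpha(z,y)\,dm(z)$ for $0\le\alpha\le\beta$. Write $u=u^0$. It is assumed that $u(x,y)$ is excessive in $x$ for each fixed $y$, that $u(x,x)=\infty$ for all $x$ and $u(x,y)<\infty$ for $x\ne y$, and that all points of $S$ are polar. It is also assumed that for every compact $K\subseteq S$, $$\sup_{x}\int_{K}\big(u(x,y)+u(y,x)\big)^{2}\,dm(y)<\infty.$$ The measures $Q^{z,z}$. Fix $z\in S$, put $h_z(x)=u(x,z)$, and on $S_z=S\setminus\{z\}$ let $P^z_t(x,dy)=P_t(x,dy)\,h_z(y)/h_z(x)$. The $\sigma$-finite measures $\eta^z_t(dx)=P_t(z,dx)h_z(x)$, $t>0$, form an entrance law for $(P^z_t)$. $Q^{z,z}$ is the measure on $\Omega$ (carried by paths with $X_0=z$ and $\zeta>0$) under which $(X_t)_{t>0}$ is the right process with one-dimensional distributions $\eta^z_t$ on $S$ and transition semigroup $(P^z_t)$. Thus for $0<t_1<\cdots<t_k$, with $t_0=0$, $x_0=z$, and nonnegative measurable $f_j$ on $S$, $$Q^{z,z}\Big(\prod_{j=1}^k f_j(X_{t_j})\Big)=\int\prod_{j=1}^kP_{t_j-t_{j-1}}(x_{j-1},dx_j)\prod_{j=1}^kf_j(x_j)\;u(x_k,z).$$ The loop measure is $\mu(F)=\int_S Q^{z,z}(F/\zeta)\,dm(z)$ for measurable $F$ on $\Omega$. $\mathcal{P}_k^{\odot}$ denotes the set of permutations of $\{1,\ldots,k\}$ on the circle, i.e. permutations $(\pi_1,\ldots,\pi_k)$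 where two permutations differing by a cyclic shift of positions are identified (for example $(1,2,3)$, $(3,1,2)$ and $(2,3,1)$ count as one element of $\mathcal{P}_3^{\odot}$). *)

theory Defs
  imports "HOL-Probability.Probability" "HOL-Combinatorics.Multiset_Permutations"
begin

(* The state space S is a type 'a; S_Delta is 'a option, with None as the cemetery Delta.
   The topology of S_Delta is the one-point compactification of S, in which Delta is isolated
   if S is compact.  Times range over the reals; only t >= 0 is meaningful. *)

section \<open>Path space\<close>

definition ext0 :: "('a \<Rightarrow> 'b::zero) \<Rightarrow> 'a option \<Rightarrow> 'b" where
  "ext0 f x = (case x of None \<Rightarrow> 0 | Some y \<Rightarrow> f y)"

definition lifetime :: "(real \<Rightarrow> 'a option) \<Rightarrow> ennreal" where
  "lifetime \<omega> = Inf {ennreal t | t. t > 0 \<and> \<omega> t = None}"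

definition paths :: "(real \<Rightarrow> 'a::topological_space option) set" where
  "paths = {\<omega> \<in> extensional {0..}.
     (\<forall>t\<ge>0. limitin (Alexandroff_compactification euclidean) \<omega> (\<omega> t) (at_right t)) \<and>
     (\<forall>t\<ge>0. lifetime \<omega> \<le> ennreal t \<longrightarrow> \<omega> t = None)}"

(* The sigma-algebra generated by the coordinates X_t with t in T.  The generators use Borel sets
   of S only; the event X_t = Delta is the complement of the one with B = S. *)
definition coord_space ::
    "real set \<Rightarrow> (real \<Rightarrow> 'a::topological_space option) measure" where
  "coord_space T = sigma paths {{\<omega> \<in> paths. \<omega> t \<in> Some ` B} | t B. t \<in> T \<and> B \<in> sets borel}"

abbreviation path_space :: "(real \<Rightarrow> 'a::topological_space option) measure" where
  "path_space \<equiv> coord_space {0..}"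

section \<open>Borel right processes\<close>

(* Under M, the coordinate process with time set T is Markov with transition semigroup K,
   relative to its natural filtration. *)
definition markov_under ::
    "real set \<Rightarrow> (real \<Rightarrow> 'a::topological_space \<Rightarrow> 'a measure) \<Rightarrow>
     (real \<Rightarrow> 'a option) measure \<Rightarrow> bool" where
  "markov_under T K M \<longleftrightarrow>
     (\<forall>s\<in>T. \<forall>t\<ge>0. \<forall>A \<in> sets (coord_space (T \<inter> {..s})). \<forall>B \<in> sets borel.
        emeasure M (A \<inter> {\<omega> \<in> paths. \<omega> (s + t) \<in> Some ` B}) =
        (\<integral>\<^sup>+\<omega>\<in>A. ext0 (\<lambda>x. emeasure (K t x) B) (\<omega> s) \<partial>M))"

definition universally_measurable :: "('a::topological_space \<Rightarrow> ennreal) \<Rightarrow> bool" where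
  "universally_measurable f \<longleftrightarrow>
     (\<forall>\<nu> :: 'a measure. finite_measure \<nu> \<and> sets \<nu> = sets borel \<longrightarrow>
        f \<in> borel_measurable (completion \<nu>))"

definition excessive ::
    "(real \<Rightarrow> 'a::topological_space \<Rightarrow> 'a measure) \<Rightarrow> real \<Rightarrow> ('a \<Rightarrow> ennreal) \<Rightarrow> bool" where
  "excessive Pt \<alpha> f \<longleftrightarrow> universally_measurable f \<and>
     (\<forall>x. \<forall>t>0. ennreal (exp (- \<alpha> * t)) * (\<integral>\<^sup>+y. f y \<partial>completion (Pt t x)) \<le> f x) \<and>
     (\<forall>x. ((\<lambda>t. ennreal (exp (- \<alpha> * t)) * (\<integral>\<^sup>+y. f y \<partial>completion (Pt t x))) \<longlongrightarrow> f x) (at_right 0))"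

(* The assumption excessive_right_continuous is the second of the hypotheses droites;
   the strong Markov property follows from it.  The law with initial distribution nu is
   nu >>= Px. *)
locale borel_right_process =
  fixes Pt :: "real \<Rightarrow> 'a::{t2_space,second_countable_topology} \<Rightarrow> 'a measure"
    and Px :: "'a \<Rightarrow> (real \<Rightarrow> 'a option) measure"
  assumes locally_compact: "locally_compact_space (euclidean :: 'a topology)"
    and kernel: "\<And>t. 0 \<le> t \<Longrightarrow> Pt t \<in> borel \<rightarrow>\<^sub>M subprob_algebra borel"
    and kernel_0: "\<And>x. Pt 0 x = return borel x"
    and semigroup: "\<And>s t x. 0 \<le> s \<Longrightarrow> 0 \<le> t \<Longrightarrow> Pt (s + t) x = Pt s x \<bind> Pt t"
    and laws: "Px \<in> borel \<rightarrow>\<^sub>M prob_algebra path_space"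
    and start: "\<And>x. AE \<omega> in Px x. \<omega> 0 = Some x"
    and markov: "\<And>x. markov_under {0..} Pt (Px x)"
    and excessive_right_continuous:
      "\<And>\<alpha> f \<nu>. 0 < \<alpha> \<Longrightarrow> excessive Pt \<alpha> f \<Longrightarrow> prob_space \<nu> \<Longrightarrow> sets \<nu> = sets borel \<Longrightarrow>
         AE \<omega> in \<nu> \<bind> Px. \<forall>t\<ge>0. ((\<lambda>s. ext0 f (\<omega> s)) \<longlongrightarrow> ext0 f (\<omega> t)) (at_right t)"

locale transient_borel_right_process = borel_right_process +
  assumes transient: "\<exists>q \<in> borel_measurable borel. (\<forall>x. 0 < q x) \<and>
    (\<forall>x. (\<integral>\<^sup>+t\<in>{0..}. (\<integral>\<^sup>+y. q y \<partial>Pt t x) \<partial>lborel) < (\<infinity> :: ennreal))"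

locale process_with_potential_densities = transient_borel_right_process Pt Px
  for Pt :: "real \<Rightarrow> 'a::{t2_space,second_countable_topology} \<Rightarrow> 'a measure" and Px +
  fixes m :: "'a measure"
    and u :: "real \<Rightarrow> 'a \<Rightarrow> 'a \<Rightarrow> ennreal"
  assumes sets_m: "sets m = sets borel"
    and m_compact: "\<And>K. compact K \<Longrightarrow> emeasure m K < \<infinity>"
    and u_measurable: "\<And>\<alpha>. 0 \<le> \<alpha> \<Longrightarrow> (\<lambda>(x, y). u \<alpha> x y) \<in> borel_measurable (borel \<Otimes>\<^sub>M borel)"
    and u_pos: "\<And>\<alpha> x y. 0 \<le> \<alpha> \<Longrightarrow> 0 < u \<alpha> x y"
    and u_density: "\<And>\<alpha> x B. 0 \<le> \<alpha> \<Longrightarrow> B \<in> sets borel \<Longrightarrow>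
      (\<integral>\<^sup>+t\<in>{0..}. ennreal (exp (- \<alpha> * t)) * emeasure (Pt t x) B \<partial>lborel) = (\<integral>\<^sup>+y\<in>B. u \<alpha> x y \<partial>m)"
    and resolvent1: "\<And>\<alpha> \<beta> x y. 0 \<le> \<alpha> \<Longrightarrow> \<alpha> \<le> \<beta> \<Longrightarrow>
      u \<alpha> x y = u \<beta> x y + ennreal (\<beta> - \<alpha>) * (\<integral>\<^sup>+z. u \<alpha> x z * u \<beta> z y \<partial>m)"
    and resolvent2: "\<And>\<alpha> \<beta> x y. 0 \<le> \<alpha> \<Longrightarrow> \<alpha> \<le> \<beta> \<Longrightarrow>
      u \<alpha> x y = u \<beta> x y + ennreal (\<beta> - \<alpha>) * (\<integral>\<^sup>+z. u \<beta> x z * u \<alpha> z y \<partial>m)"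
    and u_excessive: "\<And>y. excessive Pt 0 (\<lambda>x. u 0 x y)"
    and u_diagonal: "\<And>x. u 0 x x = \<infinity>"
    and u_off_diagonal: "\<And>x y. x \<noteq> y \<Longrightarrow> u 0 x y < \<infinity>"
    and points_polar: "\<And>x y. AE \<omega> in Px x. \<forall>t>0. \<omega> t \<noteq> Some y"
    and u_square_integrable: "\<And>K. compact K \<Longrightarrow>
      (SUP x. \<integral>\<^sup>+y\<in>K. (u 0 x y + u 0 y x)\<^sup>2 \<partial>m) < \<infinity>"

section \<open>The measures $Q^{z,z}$ and the loop measure\<close>

(* In this section g stands for the 0-potential density u^0. *)

(* The semigroup P^z_t on S - {z}.  On ennreal, g y z / g x z is an ordinary quotient of positive
   reals for x, y distinct from z; the kernel at x = z vanishes and is irrelevant. *)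
definition h_semigroup ::
    "(real \<Rightarrow> 'a \<Rightarrow> 'a measure) \<Rightarrow> ('a \<Rightarrow> 'a \<Rightarrow> ennreal) \<Rightarrow> 'a \<Rightarrow> real \<Rightarrow> 'a \<Rightarrow> 'a measure" where
  "h_semigroup Pt g z t x = density (Pt t x) (\<lambda>y. indicator (- {z}) y * (g y z / g x z))"

definition entrance_law ::
    "(real \<Rightarrow> 'a \<Rightarrow> 'a measure) \<Rightarrow> ('a \<Rightarrow> 'a \<Rightarrow> ennreal) \<Rightarrow> 'a \<Rightarrow> real \<Rightarrow> 'a measure" where
  "entrance_law Pt g z t = density (Pt t z) (\<lambda>x. g x z)"

definition is_Qzz ::
    "(real \<Rightarrow> 'a::topological_space \<Rightarrow> 'a measure) \<Rightarrow> ('a \<Rightarrow> 'a \<Rightarrow> ennreal) \<Rightarrow> 'a \<Rightarrow>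
     (real \<Rightarrow> 'a option) measure \<Rightarrow> bool" where
  "is_Qzz Pt g z Q \<longleftrightarrow>
     sets Q = sets path_space \<and>
     (AE \<omega> in Q. \<omega> 0 = Some z \<and> 0 < lifetime \<omega>) \<and>
     (\<forall>t>0. \<forall>B \<in> sets borel.
        emeasure Q {\<omega> \<in> paths. \<omega> t \<in> Some ` B} = emeasure (entrance_law Pt g z t) B) \<and>
     markov_under {0<..} (h_semigroup Pt g z) Q"

(* inverse \<infinity> = 0, so paths of infinite lifetime carry no mass. *)
definition loop_measure ::
    "'a::topological_space measure \<Rightarrow> ('a \<Rightarrow> (real \<Rightarrow> 'a option) measure) \<Rightarrow>
     (real \<Rightarrow> 'a option) measure" where
  "loop_measure m Q = measure_of paths (sets path_space)
     (\<lambda>A. \<integral>\<^sup>+z. (\<integral>\<^sup>+\<omega>\<in>A. inverse (lifetime \<omega>) \<partial>Q z) \<partial>m)"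

section \<open>Circular permutations and cyclic products\<close>

(* A permutation (pi_1, ..., pi_k) is the list [pi_1, ..., pi_k]. *)
definition circular_perms :: "nat \<Rightarrow> nat list set set" where
  "circular_perms k = permutations_of_set {1..k} //
     {(p, q). p \<in> permutations_of_set {1..k} \<and> q \<in> permutations_of_set {1..k} \<and>
              (\<exists>n. q = rotate n p)}"

(* The measure u(x_1,x_2) ... u(x_{k-1},x_k) u(x_k,x_1) dm(x_1) ... dm(x_k) on S^k.  Integrating
   real functions against it keeps the value \<infinity> of u on the diagonal intact. *)
definition cyclic_measure ::
    "'a measure \<Rightarrow> ('a \<Rightarrow> 'a \<Rightarrow> ennreal) \<Rightarrow> nat \<Rightarrow> (nat \<Rightarrow> 'a) measure" where
  "cyclic_measure m g k = density (\<Pi>\<^sub>M j\<in>{1..k}. m)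
     (\<lambda>x. (\<Prod>j\<in>{1..<k}. g (x j) (x (Suc j))) * g (x k) (x 1))"

end

theory Submission
  imports Defs
begin

text \<open>
The factor \<open>1 / \<zeta>\<close> in the loop measure is removed by writing \<open>1 / \<zeta> = \<integral> exp (- \<alpha> \<zeta>) d\<alpha>\<close>
over \<open>\<alpha> > 0\<close> (\<open>inverse_lifetime\<close>, \<open>nn_integral_loop_measure_tail\<close>). For fixed \<open>\<alpha>\<close>, the Markov
property unfolds \<open>Q z (exp (- \<alpha> \<zeta>) \<Prod>\<^sub>j \<integral> f\<^sub>j(X\<^sub>t) dt)\<close> along the order in which the times
occur. The Doob transform by \<open>h = u(\<cdot>, z)\<close> cancels from step to step, and \<open>exp (- \<alpha> \<zeta>)\<close> turns
every potential into an \<open>\<alpha>\<close>-potential, the last one leading back to \<open>z\<close> because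
\<open>E (exp (- \<alpha> \<zeta>)) = u\<^sup>\<alpha>(x, z) / u(x, z)\<close> for the transformed process started at \<open>x\<close>
(\<open>killing_weight_Q\<close>). The result, \<open>occupation_Q\<close>, is the sum over all permutations \<open>\<pi>\<close> of the
chains
\<open>\<integral> u\<^sup>\<alpha>(z, x\<^sub>1) f\<^bsub>\<pi>1\<^esub>(x\<^sub>1) u\<^sup>\<alpha>(x\<^sub>1, x\<^sub>2) \<dots> f\<^bsub>\<pi>k\<^esub>(x\<^sub>k) u\<^sup>\<alpha>(x\<^sub>k, z)\<close>.

Integrating over \<open>z\<close> joins the two end factors into one edge \<open>v\<^sup>\<alpha>(x\<^sub>k, x\<^sub>1)\<close> of the iterated
potential \<open>v\<^sup>\<alpha> = u\<^sup>\<alpha> u\<^sup>\<alpha>\<close>. By the resolvent equation \<open>v\<^sup>\<alpha>\<close> is \<open>- d u\<^sup>\<alpha> / d\<alpha>\<close>; in integrated form,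
\<open>u\<^sup>\<beta> = \<integral> v\<^sup>\<alpha> d\<alpha>\<close> over \<open>\<alpha> > \<beta>\<close> (\<open>u_eq_tail_v\<close>). Hence a cycle with one marked edge \<open>v\<^sup>\<alpha>\<close> and
\<open>u\<^sup>\<alpha>\<close> on the other edges, summed over the \<open>k\<close> possible marked edges, is minus the \<open>\<alpha>\<close>-derivative
of the cyclic product of the \<open>u\<^sup>\<alpha>\<close>, and integrating over \<open>\<alpha> > 0\<close> yields the cyclic product of
the \<open>u = u\<^sup>0\<close> (\<open>nn_integral_cycle\<close>, by the product rule \<open>prod_tail\<close>). The \<open>k\<close> rotations of one
circular permutation supply exactly these \<open>k\<close> markings (\<open>sum_permutations_circular\<close>,
\<open>rooted_cycle_rotate\<close>). This proves the formula for nonnegative functions,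
\<open>nn_integral_loop_measure_occupations\<close>.

For signed functions both sides have to be finite. Square integrability of \<open>u\<close> over compact sets
bounds the chains of length at least one (\<open>chain_bounded\<close>) and hence the right-hand side
for the absolute values; the case \<open>k = 2\<close> shows that each occupation time is finite almost
everywhere. Both sides being multilinear, the formula extends from nonnegative functions to
differences of such functions.

Much of the work is measurability. The semigroup is jointly measurable in time and space because the
paths are right continuous; the densities \<open>u\<^sup>\<alpha>\<close> have to be replaced by a version that is measurable in
\<open>\<alpha>\<close>; and measurability of \<open>z \<mapsto> Q z\<close>, on which countable additivity of the loop measure rests,
follows from the finite-dimensional distributions after a change of density to
subprobability measures.
\<close>

section \<open>Integrals against mixtures of measures\<close>

text \<open>Both sides are linear in \<open>f\<close> and continuous along increasing sequences, so indicators suffice. Potential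
densities, the Markov property and the loop measure are all specified on sets; each time this
lemma passes to functions.\<close>

lemma nn_integral_mixture:
  assumes R: "sets R = sets M" and \<kappa>: "\<And>p. p \<in> space N \<Longrightarrow> sets (\<kappa> p) = sets M"
    and R_eq: "\<And>A. A \<in> sets M \<Longrightarrow> emeasure R A = (\<integral>\<^sup>+p. w p * emeasure (\<kappa> p) A \<partial>N)"
    and meas: "\<And>g. g \<in> borel_measurable M \<Longrightarrow> (\<lambda>p. w p * (\<integral>\<^sup>+x. g x \<partial>\<kappa> p)) \<in> borel_measurable N"
    and f: "f \<in> borel_measurable M"
  shows "(\<integral>\<^sup>+x. f x \<partial>R) = (\<integral>\<^sup>+p. w p * (\<integral>\<^sup>+x. f x \<partial>\<kappa> p) \<partial>N)"
  using f
proof (induction rule: borel_measurable_induct)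
  case (cong f g)
  have "(\<integral>\<^sup>+x. f x \<partial>R) = (\<integral>\<^sup>+x. g x \<partial>R)"
    using cong sets_eq_imp_space_eq[OF R] by (intro nn_integral_cong) simp
  moreover have "(\<integral>\<^sup>+p. w p * (\<integral>\<^sup>+x. f x \<partial>\<kappa> p) \<partial>N) = (\<integral>\<^sup>+p. w p * (\<integral>\<^sup>+x. g x \<partial>\<kappa> p) \<partial>N)"
    using cong sets_eq_imp_space_eq[OF \<kappa>] by (intro nn_integral_cong arg_cong2[where f = "(*)"] refl) simp
  ultimately show ?case using cong by simp
next
  case (set A)
  have "(\<integral>\<^sup>+p. w p * (\<integral>\<^sup>+x. indicator A x \<partial>\<kappa> p) \<partial>N) = (\<integral>\<^sup>+p. w p * emeasure (\<kappa> p) A \<partial>N)"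
    using set \<kappa> by (intro nn_integral_cong) simp
  then show ?case using set R R_eq by simp
next
  case (mult f c)
  have [measurable]: "f \<in> borel_measurable R" "\<And>p. p \<in> space N \<Longrightarrow> f \<in> borel_measurable (\<kappa> p)"
    using mult measurable_cong_sets[OF R refl] measurable_cong_sets[OF \<kappa> refl] by blast+
  have "(\<integral>\<^sup>+p. w p * (\<integral>\<^sup>+x. c * f x \<partial>\<kappa> p) \<partial>N) = (\<integral>\<^sup>+p. c * (w p * (\<integral>\<^sup>+x. f x \<partial>\<kappa> p)) \<partial>N)"
    by (intro nn_integral_cong) (simp add: nn_integral_cmult mult_ac)
  then show ?case using mult meas by (simp add: nn_integral_cmult)
next
  case (add f g)
  have [measurable]: "f \<in> borel_measurable R" "\<And>p. p \<in> space N \<Longrightarrow> f \<in> borel_measurable (\<kappa> p)"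
    "g \<in> borel_measurable R" "\<And>p. p \<in> space N \<Longrightarrow> g \<in> borel_measurable (\<kappa> p)"
    using add measurable_cong_sets[OF R refl] measurable_cong_sets[OF \<kappa> refl] by blast+
  have "(\<integral>\<^sup>+p. w p * (\<integral>\<^sup>+x. g x + f x \<partial>\<kappa> p) \<partial>N) =
      (\<integral>\<^sup>+p. w p * (\<integral>\<^sup>+x. g x \<partial>\<kappa> p) + w p * (\<integral>\<^sup>+x. f x \<partial>\<kappa> p) \<partial>N)"
    by (intro nn_integral_cong) (simp add: nn_integral_add distrib_left)
  then show ?case using add meas by (simp add: nn_integral_add)
next
  case (seq U)
  have [measurable]: "\<And>n. U n \<in> borel_measurable R" "\<And>p n. p \<in> space N \<Longrightarrow> U n \<in> borel_measurable (\<kappa> p)"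
    using seq measurable_cong_sets[OF R refl] measurable_cong_sets[OF \<kappa> refl] by blast+
  have U_sup: "(SUP n. U n) = (\<lambda>x. SUP n. U n x)" by (auto simp: image_comp)
  have mono: "incseq U" by fact
  have "(\<integral>\<^sup>+x. (SUP n. U n) x \<partial>R) = (SUP n. \<integral>\<^sup>+p. w p * (\<integral>\<^sup>+x. U n x \<partial>\<kappa> p) \<partial>N)"
    unfolding U_sup using mono seq.IH by (subst nn_integral_monotone_convergence_SUP) auto
  also have "\<dots> = (\<integral>\<^sup>+p. (SUP n. w p * (\<integral>\<^sup>+x. U n x \<partial>\<kappa> p)) \<partial>N)"
    using mono seq(1) meas by (intro nn_integral_monotone_convergence_SUP[symmetric])
      (auto simp: incseq_def le_fun_def intro!: nn_integral_mono mult_left_mono)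
  also have "\<dots> = (\<integral>\<^sup>+p. w p * (\<integral>\<^sup>+x. (SUP n. U n) x \<partial>\<kappa> p) \<partial>N)"
    unfolding U_sup using mono
    by (intro nn_integral_cong) (simp add: SUP_mult_left_ennreal nn_integral_monotone_convergence_SUP)
  finally show ?case .
qed

section \<open>Tail integrals\<close>

text \<open>Integrals over times and over killing rates are written as tails: an ordering of the variables then
becomes a nesting of tails.\<close>

definition tail :: "(real \<Rightarrow> ennreal) \<Rightarrow> real \<Rightarrow> ennreal" where
  "tail a t = (\<integral>\<^sup>+s\<in>{t<..}. a s \<partial>lborel)"

lemma measurable_tail:
  assumes a: "(\<lambda>(p, s). a p s) \<in> borel_measurable (N \<Otimes>\<^sub>M borel)" and t[measurable]: "t \<in> borel_measurable N"
  shows "(\<lambda>p. tail (a p) (t p)) \<in> borel_measurable N"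
proof -
  have [measurable]: "(\<lambda>(p, s). a p s) \<in> borel_measurable (N \<Otimes>\<^sub>M lborel)"
    using a by (simp cong: measurable_cong_sets sets_pair_measure_cong)
  have eq: "tail (a p) (t p) = (\<integral>\<^sup>+s. a p s * (if t p < s then 1 else 0) \<partial>lborel)" for p
    unfolding tail_def by (intro nn_integral_cong) (auto simp: indicator_def)
  show ?thesis unfolding eq by measurable
qed

lemma measurable_tail_fixed[measurable]:
  assumes [measurable]: "a \<in> borel_measurable borel"
  shows "tail a \<in> borel_measurable borel"
  by (rule measurable_tail[where a = "\<lambda>_. a" and t = "\<lambda>t. t"]) measurable

lemma tail_cong: "(\<And>s. t < s \<Longrightarrow> a s = b s) \<Longrightarrow> tail a t = tail b t"
  unfolding tail_def by (intro nn_integral_cong) (auto simp: indicator_def)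

lemma tail_mult_left:
  assumes [measurable]: "a \<in> borel_measurable borel"
  shows "tail (\<lambda>s. c * a s) t = c * tail a t"
proof -
  have "tail (\<lambda>s. c * a s) t = (\<integral>\<^sup>+s. c * (a s * indicator {t<..} s) \<partial>lborel)"
    unfolding tail_def by (simp add: mult.assoc)
  also have "\<dots> = c * tail a t"
    unfolding tail_def by (rule nn_integral_cmult) simp
  finally show ?thesis .
qed

lemma tail_sum:
  assumes "\<And>i. i \<in> I \<Longrightarrow> a i \<in> borel_measurable borel"
  shows "tail (\<lambda>s. \<Sum>i\<in>I. a i s) t = (\<Sum>i\<in>I. tail (a i) t)"
  unfolding tail_def sum_distrib_right using assms by (intro nn_integral_sum) auto

text \<open>Split the quadrant \<open>{s, r > t}\<close> along its diagonal, which is a null set.\<close>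

lemma tail_mult_tail:
  assumes [measurable]: "a \<in> borel_measurable borel" "b \<in> borel_measurable borel"
  shows "tail a t * tail b t = tail (\<lambda>s. a s * tail b s) t + tail (\<lambda>s. b s * tail a s) t"
proof -
  define A where "A = (\<lambda>s. a s * indicator {t<..} s)"
  define B where "B = (\<lambda>s. b s * indicator {t<..} s)"
  have [measurable]: "A \<in> borel_measurable borel" "B \<in> borel_measurable borel"
    unfolding A_def B_def by measurable
  have tails: "(\<integral>\<^sup>+r. A r * indicator {s<..} r \<partial>lborel) = tail a s"
    "(\<integral>\<^sup>+r. B r * indicator {s<..} r \<partial>lborel) = tail b s" if "t < s" for s
    unfolding tail_def using that by (auto simp: A_def B_def indicator_def intro!: nn_integral_cong)
  have split: "(\<integral>\<^sup>+r. B r \<partial>lborel) =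
      (\<integral>\<^sup>+r. B r * indicator {s<..} r \<partial>lborel) + (\<integral>\<^sup>+r. B r * indicator {..<s} r \<partial>lborel)" for s
  proof -
    have "AE r in lborel. r \<noteq> s" by (rule AE_lborel_singleton)
    then have "(\<integral>\<^sup>+r. B r \<partial>lborel) =
      (\<integral>\<^sup>+r. B r * indicator {s<..} r + B r * indicator {..<s} r \<partial>lborel)"
      by (intro nn_integral_cong_AE) (auto elim!: eventually_mono simp: indicator_def)
    then show ?thesis by (simp add: nn_integral_add)
  qed
  have "tail a t * tail b t = (\<integral>\<^sup>+s. A s * (\<integral>\<^sup>+r. B r \<partial>lborel) \<partial>lborel)"
    unfolding tail_def A_def B_def by (rule nn_integral_multc[symmetric]) simp
  also have "\<dots> = (\<integral>\<^sup>+s. A s * (\<integral>\<^sup>+r. B r * indicator {s<..} r \<partial>lborel) \<partial>lborel) +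
      (\<integral>\<^sup>+s. A s * (\<integral>\<^sup>+r. B r * indicator {..<s} r \<partial>lborel) \<partial>lborel)"
  proof -
    have [measurable]: "(\<lambda>s. \<integral>\<^sup>+r. B r * indicator {s<..} r \<partial>lborel) \<in> borel_measurable borel"
      "(\<lambda>s. \<integral>\<^sup>+r. B r * indicator {..<s} r \<partial>lborel) \<in> borel_measurable borel"
    proof -
      have "(\<lambda>s. \<integral>\<^sup>+r. B r * (if s < r then 1 else 0) \<partial>lborel) \<in> borel_measurable borel"
        "(\<lambda>s. \<integral>\<^sup>+r. B r * (if r < s then 1 else 0) \<partial>lborel) \<in> borel_measurable borel"
        by measurable
      then show "(\<lambda>s. \<integral>\<^sup>+r. B r * indicator {s<..} r \<partial>lborel) \<in> borel_measurable borel"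
      "(\<lambda>s. \<integral>\<^sup>+r. B r * indicator {..<s} r \<partial>lborel) \<in> borel_measurable borel"
        by (simp_all add: indicator_def greaterThan_def lessThan_def of_bool_def)
    qed
    show ?thesis
      by (subst nn_integral_add[symmetric]) (auto simp flip: distrib_left intro!: nn_integral_cong arg_cong2[where f = "(*)", OF refl split])
  qed
  also have "(\<integral>\<^sup>+s. A s * (\<integral>\<^sup>+r. B r * indicator {s<..} r \<partial>lborel) \<partial>lborel) = tail (\<lambda>s. a s * tail b s) t"
    unfolding tail_def[of "\<lambda>s. a s * tail b s"]
    by (intro nn_integral_cong) (auto simp: A_def tails split: split_indicator)
  also have "(\<integral>\<^sup>+s. A s * (\<integral>\<^sup>+r. B r * indicator {..<s} r \<partial>lborel) \<partial>lborel) =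
      (\<integral>\<^sup>+s. (\<integral>\<^sup>+r. A s * (B r * (if r < s then 1 else 0)) \<partial>lborel) \<partial>lborel)"
    by (subst nn_integral_cmult[symmetric]) (auto intro!: nn_integral_cong simp: indicator_def)
  also have "\<dots> = (\<integral>\<^sup>+r. (\<integral>\<^sup>+s. A s * (B r * (if r < s then 1 else 0)) \<partial>lborel) \<partial>lborel)"
    by (rule lborel_pair.Fubini') measurable
  also have "\<dots> = (\<integral>\<^sup>+r. B r * (\<integral>\<^sup>+s. A s * indicator {r<..} s \<partial>lborel) \<partial>lborel)"
    by (subst nn_integral_cmult[symmetric]) (auto intro!: nn_integral_cong simp: indicator_def mult.commute)
  also have "\<dots> = tail (\<lambda>s. b s * tail a s) t"
    unfolding tail_def[of "\<lambda>s. b s * tail a s"]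
    by (intro nn_integral_cong) (auto simp: B_def tails split: split_indicator)
  finally show ?thesis .
qed

text \<open>Off a null set, exactly one of the variables \<open>s\<^sub>j > t\<close> is the smallest, and the others lie beyond it. The
lemma serves twice: for the times of a path, where \<open>j\<close> is the factor visited first, and for the
killing rates on the edges of a cycle, where it is the product rule in integrated form.\<close>

lemma prod_tail:
  assumes "finite J" "J \<noteq> {}" "\<And>j. j \<in> J \<Longrightarrow> a j \<in> borel_measurable borel"
  shows "(\<Prod>j\<in>J. tail (a j) t) = (\<Sum>j\<in>J. tail (\<lambda>s. a j s * (\<Prod>i\<in>J - {j}. tail (a i) s)) t)"
  using assms
proof (induction J arbitrary: t rule: finite_ne_induct)
  case (singleton x)
  then show ?case by simp
next
  case (insert i J)
  have [measurable]: "a i \<in> borel_measurable borel" using insert.prems by simp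
  have a_J[measurable]: "a j \<in> borel_measurable borel" if "j \<in> J" for j using insert.prems that by simp
  define c where "c j s = a j s * (\<Prod>i\<in>J - {j}. tail (a i) s)" for j s
  have c[measurable]: "c j \<in> borel_measurable borel" if "j \<in> J" for j
    unfolding c_def using that by measurable
  have IH: "(\<Prod>j\<in>J. tail (a j) t) = (\<Sum>j\<in>J. tail (c j) t)" for t
    using insert.IH[of t] a_J unfolding c_def by simp
  have "(\<Prod>j\<in>insert i J. tail (a j) t) = tail (a i) t * (\<Sum>j\<in>J. tail (c j) t)"
    using insert.hyps by (simp add: IH)
  also have "\<dots> = (\<Sum>j\<in>J. tail (\<lambda>s. a i s * tail (c j) s) t) + (\<Sum>j\<in>J. tail (\<lambda>s. c j s * tail (a i) s) t)"
    by (simp add: sum_distrib_left tail_mult_tail sum.distrib)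
  also have "(\<Sum>j\<in>J. tail (\<lambda>s. a i s * tail (c j) s) t) = tail (\<lambda>s. a i s * (\<Prod>j\<in>J. tail (a j) s)) t"
    by (subst tail_sum[symmetric]) (auto simp: IH sum_distrib_left)
  also have "(\<lambda>s. a i s * (\<Prod>j\<in>J. tail (a j) s)) = (\<lambda>s. a i s * (\<Prod>j\<in>insert i J - {i}. tail (a j) s))"
    using insert.hyps by (intro ext arg_cong2[where f = "(*)"] prod.cong) auto
  also have "(\<Sum>j\<in>J. tail (\<lambda>s. c j s * tail (a i) s) t) =
      (\<Sum>j\<in>J. tail (\<lambda>s. a j s * (\<Prod>l\<in>insert i J - {j}. tail (a l) s)) t)"
  proof (intro sum.cong refl tail_cong)
    fix j s assume j: "j \<in> J"
    then have "insert i J - {j} = insert i (J - {j})" using insert.hyps by auto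
    then show "c j s * tail (a i) s = a j s * (\<Prod>l\<in>insert i J - {j}. tail (a l) s)"
      unfolding c_def using insert.hyps by (simp add: mult_ac)
  qed
  finally show ?case using insert.hyps by simp
qed

text \<open>The source of the factor \<open>1 / r\<close>, which is \<open>1 / \<zeta>\<close> for \<open>r = \<zeta>\<close> and \<open>\<beta> = 0\<close>.\<close>

lemma tail_exp:
  assumes "r > 0"
  shows "tail (\<lambda>\<alpha>. ennreal (exp (- \<alpha> * r))) \<beta> = ennreal (exp (- \<beta> * r) / r)"
proof -
  have "tail (\<lambda>\<alpha>. ennreal (exp (- \<alpha> * r))) \<beta> = (\<integral>\<^sup>+\<alpha>. ennreal (exp (- \<alpha> * r)) * indicator {\<beta>..} \<alpha> \<partial>lborel)"
    unfolding tail_def using AE_lborel_singleton[of \<beta>]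
    by (intro nn_integral_cong_AE) (auto elim!: eventually_mono simp: indicator_def)
  also have "\<dots> = ennreal (0 - (- exp (- \<beta> * r) / r))"
  proof (rule nn_integral_FTC_atLeast)
    show "((\<lambda>\<alpha>. - exp (- \<alpha> * r) / r) \<longlongrightarrow> 0) at_top"
    proof -
      have "filterlim (\<lambda>\<alpha>. - \<alpha> * r) at_bot at_top"
        using assms filterlim_tendsto_pos_mult_at_top[OF tendsto_const, of r "\<lambda>x. x" at_top]
        by (simp add: filterlim_uminus_at_bot filterlim_ident mult.commute[of _ r])
      then have "((\<lambda>\<alpha>. exp (- \<alpha> * r)) \<longlongrightarrow> 0) at_top"
        by (rule filterlim_compose[OF exp_at_bot])
      then have "((\<lambda>\<alpha>. - exp (- \<alpha> * r) / r) \<longlongrightarrow> - 0 / r) at_top"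
        using assms by (intro tendsto_intros) auto
      then show ?thesis by simp
    qed
  qed (use assms in \<open>auto intro!: derivative_eq_intros simp: field_simps\<close>)
  finally show ?thesis by simp
qed

lemma tail_shift:
  assumes [measurable]: "a \<in> borel_measurable borel"
  shows "tail a (t + c) = tail (\<lambda>s. a (c + s)) t"
proof -
  have "tail a (t + c) = (\<integral>\<^sup>+s. a (c + 1 * s) * indicator {t + c<..} (c + 1 * s) \<partial>lborel)"
    unfolding tail_def by (subst nn_integral_real_affine[where c = 1 and t = c]) auto
  also have "\<dots> = tail (\<lambda>s. a (c + s)) t"
    unfolding tail_def by (intro nn_integral_cong) (auto simp: indicator_def)
  finally show ?thesis .
qed

text \<open>The pairs \<open>(s, t)\<close> of positive numbers with sum \<open>r\<close> form a segment of length \<open>r\<close>.\<close>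

lemma tail_tail_add:
  assumes [measurable]: "H \<in> borel_measurable borel"
  shows "tail (\<lambda>s. tail (\<lambda>t. H (s + t)) 0) 0 = tail (\<lambda>r. ennreal r * H r) 0"
proof -
  have "tail (\<lambda>s. tail (\<lambda>t. H (s + t)) 0) 0 = tail (\<lambda>s. tail H s) 0"
    using tail_shift[of H 0] by simp
  also have "\<dots> = (\<integral>\<^sup>+s. (\<integral>\<^sup>+r. H r * (if 0 < s \<and> s < r then 1 else 0) \<partial>lborel) \<partial>lborel)"
    unfolding tail_def
    by (subst nn_integral_multc[symmetric]) (auto intro!: nn_integral_cong simp: indicator_def)
  also have "\<dots> = (\<integral>\<^sup>+r. (\<integral>\<^sup>+s. H r * (if 0 < s \<and> s < r then 1 else 0) \<partial>lborel) \<partial>lborel)"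
    by (rule lborel_pair.Fubini') measurable
  also have "\<dots> = (\<integral>\<^sup>+r. H r * emeasure lborel {0<..<r} \<partial>lborel)"
    by (subst nn_integral_indicator[symmetric], simp, subst nn_integral_cmult[symmetric])
      (auto intro!: nn_integral_cong simp: indicator_def)
  also have "\<dots> = tail (\<lambda>r. ennreal r * H r) 0"
    unfolding tail_def
    by (intro nn_integral_cong) (auto simp: indicator_def mult.commute)
  finally show ?thesis .
qed

lemma set_nn_integral_atLeast_tail: "(\<integral>\<^sup>+t\<in>{a..}. f t \<partial>lborel) = tail f a"
  unfolding tail_def using AE_lborel_singleton[of a]
  by (intro nn_integral_cong_AE) (auto elim!: eventually_mono simp: indicator_def)

text \<open>
The least multiple of \<open>2\<^sup>-\<^sup>n\<close> that is strictly greater than \<open>t\<close>. Along these times a right limit is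
attained by a sequence, and for each \<open>n\<close> only countably many times occur, so that measurability at
fixed times yields joint measurability in the limit.\<close>

definition dyadic_above :: "nat \<Rightarrow> real \<Rightarrow> real" where
  "dyadic_above n t = (of_int \<lfloor>2 ^ n * t\<rfloor> + 1) / 2 ^ n"

lemma dyadic_above_greater: "t < dyadic_above n t"
  unfolding dyadic_above_def by (simp add: field_simps) linarith

lemma dyadic_above_le: "dyadic_above n t \<le> t + (1 / 2) ^ n"
  unfolding dyadic_above_def by (simp add: field_simps)

lemma dyadic_above_tendsto: "filterlim (\<lambda>n. dyadic_above n t) (at_right t) sequentially"
proof -
  have "(\<lambda>n. dyadic_above n t) \<longlonglongrightarrow> t"
  proof (rule tendsto_sandwich[of "\<lambda>_. t" _ _ "\<lambda>n. t + (1 / 2) ^ n"])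
    have "(\<lambda>n. t + (1 / 2) ^ n) \<longlonglongrightarrow> t + 0" by (intro tendsto_intros LIMSEQ_power_zero) auto
    then show "(\<lambda>n. t + (1 / 2) ^ n) \<longlonglongrightarrow> t" by simp
  qed (auto intro!: always_eventually dyadic_above_le less_imp_le dyadic_above_greater)
  then show ?thesis
    by (simp add: filterlim_at dyadic_above_greater less_imp_neq[OF dyadic_above_greater, symmetric])
qed

lemma dyadic_above_antimono: "decseq (\<lambda>n. dyadic_above n t)"
proof (rule decseq_SucI)
  fix n
  have "\<lfloor>2 * (2 ^ n * t)\<rfloor> + 1 \<le> 2 * \<lfloor>2 ^ n * t\<rfloor> + 2" by linarith
  then have "real_of_int \<lfloor>2 * (2 ^ n * t)\<rfloor> + 1 \<le> 2 * real_of_int \<lfloor>2 ^ n * t\<rfloor> + 2" by linarith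
  then have "(real_of_int \<lfloor>2 * (2 ^ n * t)\<rfloor> + 1) / (2 * 2 ^ n) \<le> (2 * real_of_int \<lfloor>2 ^ n * t\<rfloor> + 2) / (2 * 2 ^ n)"
    by (intro divide_right_mono) auto
  also have "\<dots> = (real_of_int \<lfloor>2 ^ n * t\<rfloor> + 1) / 2 ^ n" by (simp add: field_simps)
  finally show "dyadic_above (Suc n) t \<le> dyadic_above n t"
    unfolding dyadic_above_def by (simp add: mult.assoc)
qed

lemma measurable_compose_dyadic_above:
  assumes f: "\<And>s. s \<in> T \<Longrightarrow> f s \<in> M \<rightarrow>\<^sub>M N" and T: "\<And>t. dyadic_above n t \<in> T"
  shows "(\<lambda>(t, x). f (dyadic_above n t) x) \<in> borel \<Otimes>\<^sub>M M \<rightarrow>\<^sub>M N"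
proof -
  define d where "d i t = dyadic_above n (of_int i / 2 ^ n)" for i :: int and t :: real
  have eq: "dyadic_above n t = d \<lfloor>2 ^ n * t\<rfloor> t" for t
    unfolding d_def dyadic_above_def by simp
  have "(\<lambda>p. (\<lambda>i p. f (d i (fst p)) (snd p)) \<lfloor>2 ^ n * fst p\<rfloor> p) \<in> borel \<Otimes>\<^sub>M M \<rightarrow>\<^sub>M N"
  proof (rule measurable_compose_countable)
    fix i
    have "f (d i t) \<in> M \<rightarrow>\<^sub>M N" for t unfolding d_def by (intro f T)
    then show "(\<lambda>p. f (d i (fst p)) (snd p)) \<in> borel \<Otimes>\<^sub>M M \<rightarrow>\<^sub>M N"
      unfolding d_def by measurable
  qed measurable
  then show ?thesis by (simp add: eq case_prod_unfold)
qed

section \<open>The path space\<close>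

text \<open>A compact closure of a basic set remains closed in the one-point compactification. This is what makes
limits in \<open>S\<^sub>\<Delta>\<close> detect the open subsets of \<open>S\<close>; covering \<open>S\<close> by such closures also shows that \<open>m\<close> is
\<open>\<sigma>\<close>-finite.\<close>

lemma countable_base_of_compact_closures:
  assumes "locally_compact_space (euclidean :: 'a::{t2_space,second_countable_topology} topology)"
  obtains \<B> :: "'a::{t2_space,second_countable_topology} set set" where "countable \<B>" "\<And>b. b \<in> \<B> \<Longrightarrow> open b" "\<And>b. b \<in> \<B> \<Longrightarrow> compact (closure b)"
    "\<And>U x. open U \<Longrightarrow> x \<in> U \<Longrightarrow> \<exists>b\<in>\<B>. x \<in> b \<and> closure b \<subseteq> U"
proof -
  obtain \<A> :: "'a set set" where \<A>: "countable \<A>" "topological_basis \<A>"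
    using ex_countable_basis by blast
  have Hausdorff: "Hausdorff_space (euclidean :: 'a topology)"
    unfolding Hausdorff_space_def disjnt_def by (simp add: separation_t2)
  have nb: "\<exists>V C. open V \<and> compact C \<and> x \<in> V \<and> V \<subseteq> C \<and> C \<subseteq> U" if "open U" "x \<in> U" for U :: "'a set" and x
  proof -
    have "neighbourhood_base_of (\<lambda>C. compactin euclidean C \<and> closedin euclidean C) (euclidean :: 'a topology)"
      using assms Hausdorff locally_compact_space_neighbourhood_base_closedin by blast
    then have "\<exists>V C. openin euclidean V \<and> (compactin euclidean C \<and> closedin euclidean C) \<and> x \<in> V \<and> V \<subseteq> C \<and> C \<subseteq> U"
      using that unfolding neighbourhood_base_of by (simp only: open_openin)
    then show ?thesis by auto
  qed
  show ?thesis
  proof (rule that[of "{b \<in> \<A>. compact (closure b)}"])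
    fix U :: "'a set" and x assume "open U" "x \<in> U"
    from nb[OF this] obtain V C where V: "open V" "compact C" "x \<in> V" "V \<subseteq> C" "C \<subseteq> U" by auto
    obtain b where b: "b \<in> \<A>" "x \<in> b" "b \<subseteq> V" by (rule topological_basisE[OF \<A>(2) V(1,3)])
    have "closure b \<subseteq> C" using b V by (intro closure_minimal) (auto simp: compact_imp_closed)
    moreover have "compact (closure b)"
      using V(2) \<open>closure b \<subseteq> C\<close> compact_Int_closed[of C "closure b"] by (simp add: Int_absorb1)
    ultimately show "\<exists>b\<in>{b \<in> \<A>. compact (closure b)}. x \<in> b \<and> closure b \<subseteq> U"
      using b V by (intro bexI[of _ b]) auto
  next
    show "countable {b \<in> \<A>. compact (closure b)}" using \<A>(1) by simp
    show "open b" if "b \<in> {b \<in> \<A>. compact (closure b)}" for b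
      using that topological_basis_open[OF \<A>(2)] by blast
    show "compact (closure b)" if "b \<in> {b \<in> \<A>. compact (closure b)}" for b
      using that by blast
  qed
qed

text \<open>The \<open>\<sigma>\<close>-algebra on \<open>S\<^sub>\<Delta>\<close> whose preimages under the coordinates generate the path space.\<close>

definition cemetery_borel :: "'a::topological_space option measure" where
  "cemetery_borel = sigma UNIV {Some ` B | B. B \<in> sets borel}"

lemma space_cemetery_borel[simp]: "space cemetery_borel = UNIV"
  unfolding cemetery_borel_def by (simp add: space_measure_of_conv)

lemma Some_image_in_cemetery_borel[measurable]: "B \<in> sets borel \<Longrightarrow> Some ` B \<in> sets cemetery_borel"
  unfolding cemetery_borel_def by auto

lemma None_in_cemetery_borel[measurable]: "{None} \<in> sets cemetery_borel"
proof -
  have "{None :: 'a option} = space cemetery_borel - Some ` UNIV" by (auto simp: image_iff)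
  also have "\<dots> \<in> sets cemetery_borel" by (intro sets.compl_sets Some_image_in_cemetery_borel) auto
  finally show ?thesis .
qed

lemma measurable_the[measurable]: "the \<in> cemetery_borel \<rightarrow>\<^sub>M borel"
proof (rule measurableI)
  fix B :: "'a set" assume [measurable]: "B \<in> sets borel"
  have "the -` B \<inter> space cemetery_borel = Some ` B \<union> (if the None \<in> B then {None} else {})"
    by (auto simp: image_iff split: if_splits) (metis option.collapse)+
  also have "\<dots> \<in> sets cemetery_borel"
    by (intro sets.Un Some_image_in_cemetery_borel) auto
  finally show "the -` B \<inter> space cemetery_borel \<in> sets cemetery_borel" .
qed simp

lemma pred_None[measurable]: "Measurable.pred cemetery_borel (\<lambda>x. x = None)"
  using None_in_cemetery_borel by (simp add: pred_def)

lemma ext0_eq: "ext0 f x = (if x = None then 0 else f (the x))"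
  by (auto simp: ext0_def split: option.split)

lemma measurable_ext0:
  assumes [measurable]: "(\<lambda>(p, x). f p x) \<in> N \<Otimes>\<^sub>M borel \<rightarrow>\<^sub>M borel" "X \<in> N \<rightarrow>\<^sub>M cemetery_borel"
  shows "(\<lambda>p. ext0 (f p) (X p)) \<in> borel_measurable N"
  unfolding ext0_eq by measurable

lemma measurable_ext0_fixed[measurable]:
  assumes [measurable]: "f \<in> borel_measurable borel"
  shows "ext0 f \<in> borel_measurable cemetery_borel"
  using measurable_ext0[of "\<lambda>_. f" cemetery_borel "\<lambda>x. x"] by measurable

lemma space_coord_space[simp]: "space (coord_space T) = paths"
  unfolding coord_space_def by (rule space_measure_of) auto

lemma sets_coord_space: "sets (coord_space T) =
    sigma_sets paths {{\<omega> \<in> paths. \<omega> t \<in> Some ` B} | t B. t \<in> T \<and> B \<in> sets borel}"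
  unfolding coord_space_def by (rule sets_measure_of) auto

lemma sets_coord_space_mono: "T \<subseteq> T' \<Longrightarrow> sets (coord_space T) \<subseteq> sets (coord_space T')"
  unfolding sets_coord_space by (rule sigma_sets_mono') auto

lemma measurable_coord_space_mono: "T \<subseteq> T' \<Longrightarrow> f \<in> coord_space T \<rightarrow>\<^sub>M N \<Longrightarrow> f \<in> coord_space T' \<rightarrow>\<^sub>M N"
  using sets_coord_space_mono[of T T'] by (auto simp: measurable_def)

lemma measurable_coordinate: "t \<in> T \<Longrightarrow> (\<lambda>\<omega>. \<omega> t) \<in> coord_space T \<rightarrow>\<^sub>M cemetery_borel"
  unfolding cemetery_borel_def
  by (rule measurable_measure_of) (auto simp: sets_coord_space vimage_def Int_def conj_commute intro!: sigma_sets.Basic)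

lemma measurable_ext0_coordinate:
  "f \<in> borel_measurable borel \<Longrightarrow> t \<in> T \<Longrightarrow> (\<lambda>\<omega>. ext0 f (\<omega> t)) \<in> borel_measurable (coord_space T)"
  using measurable_compose[OF measurable_coordinate measurable_ext0_fixed] .

lemma paths_None_mono:
  assumes "\<omega> \<in> paths" "0 < s" "s \<le> t" "\<omega> s = None"
  shows "\<omega> t = None"
proof -
  have "lifetime \<omega> \<le> ennreal s" unfolding lifetime_def using assms by (intro Inf_lower) auto
  also have "\<dots> \<le> ennreal t" using assms by (intro ennreal_leI)
  finally show ?thesis using assms unfolding paths_def by auto
qed

lemma lifetime_le_iff:
  assumes "\<omega> \<in> paths" "0 < t"
  shows "lifetime \<omega> \<le> ennreal t \<longleftrightarrow> \<omega> t = None"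
proof
  assume "\<omega> t = None"
  then show "lifetime \<omega> \<le> ennreal t" unfolding lifetime_def using assms by (intro Inf_lower) auto
qed (use assms in \<open>auto simp: paths_def\<close>)

text \<open>The measures \<open>Q z\<close> may be infinite and their distributions are only given at positive times. The events
that the path is alive at time \<open>1 / (i + 1)\<close> exhaust them.\<close>

lemma alive_early:
  assumes \<omega>: "\<omega> \<in> paths" and life: "0 < lifetime \<omega>"
  shows "\<exists>i. \<omega> (1 / Suc i) \<noteq> None"
proof (rule ccontr)
  assume "\<not> (\<exists>i. \<omega> (1 / Suc i) \<noteq> None)"
  then have le: "lifetime \<omega> \<le> ennreal (1 / Suc i)" for i
    using lifetime_le_iff[OF \<omega>, of "1 / Suc i"] by auto
  have "(\<lambda>i. ennreal (1 / Suc i)) \<longlonglongrightarrow> ennreal 0"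
    by (intro tendsto_ennrealI LIMSEQ_Suc[OF lim_1_over_n])
  then have "lifetime \<omega> \<le> ennreal 0" by (rule LIMSEQ_le_const) (use le in auto)
  then show False using life by simp
qed

lemma measurable_lifetime[measurable]: "lifetime \<in> borel_measurable path_space"
proof (rule borel_measurableI_le)
  \<comment> \<open>\<open>\<zeta> \<le> t\<close> is the event of being dead at time \<open>t\<close> only for \<open>t > 0\<close>, whence the limit from above below\<close>
  have *: "{\<omega> \<in> space path_space. lifetime \<omega> \<le> ennreal t} \<in> sets path_space" if "0 < t" for t
  proof -
    have [measurable]: "(\<lambda>\<omega>. \<omega> t) \<in> path_space \<rightarrow>\<^sub>M cemetery_borel" using that by (intro measurable_coordinate) auto
    have "{\<omega> \<in> space path_space. lifetime \<omega> \<le> ennreal t} = {\<omega> \<in> space path_space. \<omega> t = None}"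
      using that by (auto simp: lifetime_le_iff)
    also have "\<dots> \<in> sets path_space" by measurable
    finally show ?thesis .
  qed
  fix y :: ennreal
  show "{\<omega> \<in> space path_space. lifetime \<omega> \<le> y} \<in> sets path_space"
  proof (cases y)
    case (real r)
    have le_iff: "lifetime \<omega> \<le> y \<longleftrightarrow> (\<forall>n. lifetime \<omega> \<le> ennreal (r + 1 / Suc n))" for \<omega>
    proof
      assume "\<forall>n. lifetime \<omega> \<le> ennreal (r + 1 / Suc n)"
      moreover have "(\<lambda>n. ennreal (r + 1 / Suc n)) \<longlonglongrightarrow> ennreal (r + 0)"
        by (intro tendsto_intros LIMSEQ_Suc[OF lim_1_over_n])
      ultimately have "lifetime \<omega> \<le> ennreal (r + 0)" by (intro LIMSEQ_le_const) auto
      then show "lifetime \<omega> \<le> y" using real by simp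
    next
      assume "lifetime \<omega> \<le> y"
      also have "y \<le> ennreal (r + 1 / Suc n)" for n using real by (auto intro!: ennreal_leI)
      finally show "\<forall>n. lifetime \<omega> \<le> ennreal (r + 1 / Suc n)" by blast
    qed
    have "{\<omega> \<in> space path_space. lifetime \<omega> \<le> y} =
        (\<Inter>n. {\<omega> \<in> space path_space. lifetime \<omega> \<le> ennreal (r + 1 / Suc n)})"
      by (auto simp: le_iff)
    also have "\<dots> \<in> sets path_space"
      using real by (intro sets.countable_INT' image_subsetI *) (auto intro!: add_nonneg_pos)
    finally show ?thesis .
  next
    case top
    then show ?thesis using sets.top[of path_space] by simp
  qed
qed

text \<open>By right continuity, the path is in the open set \<open>U\<close> at time \<open>t\<close> iff some \<open>closure b \<subseteq> U\<close> of the
countable base contains its values at all sufficiently fine dyadic times above \<open>t\<close>. The converse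
direction uses that \<open>closure b\<close> is closed in the one-point compactification.\<close>

lemma measurable_evaluation:
  assumes lc: "locally_compact_space (euclidean :: 'a::{t2_space,second_countable_topology} topology)"
  shows "(\<lambda>(t, \<omega>). \<omega> (max 0 t)) \<in> borel \<Otimes>\<^sub>M (path_space :: (real \<Rightarrow> 'a::{t2_space,second_countable_topology} option) measure) \<rightarrow>\<^sub>M cemetery_borel"
proof -
  obtain \<B> :: "'a set set" where \<B>: "countable \<B>" "\<And>b. b \<in> \<B> \<Longrightarrow> open b" "\<And>b. b \<in> \<B> \<Longrightarrow> compact (closure b)"
    "\<And>U x. open U \<Longrightarrow> x \<in> U \<Longrightarrow> \<exists>b\<in>\<B>. x \<in> b \<and> closure b \<subseteq> U"
    using countable_base_of_compact_closures[OF lc] by metis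
  let ?M = "borel \<Otimes>\<^sub>M (path_space :: (real \<Rightarrow> 'a option) measure)"
  have disc[measurable]: "(\<lambda>p. snd p (dyadic_above n (max 0 (fst p)))) \<in> ?M \<rightarrow>\<^sub>M cemetery_borel" for n
  proof -
    have "(\<lambda>(t, \<omega>). (\<lambda>s \<omega>. \<omega> (max 0 s)) (dyadic_above n t) \<omega>) \<in> ?M \<rightarrow>\<^sub>M cemetery_borel"
      by (rule measurable_compose_dyadic_above[where T = UNIV]) (auto intro!: measurable_coordinate)
    then have "(\<lambda>(t, \<omega>). \<omega> (max 0 (dyadic_above n t))) \<in> ?M \<rightarrow>\<^sub>M cemetery_borel" by simp
    then have "(\<lambda>p. (\<lambda>(t, \<omega>). \<omega> (max 0 (dyadic_above n t))) (max 0 (fst p), snd p)) \<in> ?M \<rightarrow>\<^sub>M cemetery_borel"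
      by (rule measurable_compose[rotated]) measurable
    moreover have "max 0 (dyadic_above n (max 0 t)) = dyadic_above n (max 0 t)" for t
      using dyadic_above_greater[of "max 0 t" n] by simp
    ultimately show ?thesis by (simp only: case_prod_conv)
  qed
  have open_iff: "\<omega> t \<in> Some ` U \<longleftrightarrow>
      (\<exists>b\<in>{b \<in> \<B>. closure b \<subseteq> U}. \<exists>N. \<forall>n\<ge>N. \<omega> (dyadic_above n t) \<in> Some ` closure b)"
    if \<omega>: "\<omega> \<in> paths" and t: "0 \<le> t" and U: "open U" for \<omega> t and U :: "'a set"
  proof -
    have lim: "limitin (Alexandroff_compactification euclidean) \<omega> (\<omega> t) (at_right t)"
      using \<omega> t by (auto simp: paths_def)
    have ev: "eventually (\<lambda>n. \<omega> (dyadic_above n t) \<in> V) sequentially"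
      if "openin (Alexandroff_compactification euclidean) V" "\<omega> t \<in> V" for V
    proof -
      have "eventually (\<lambda>s. \<omega> s \<in> V) (at_right t)" using lim that unfolding limitin_def by auto
      then show ?thesis using dyadic_above_tendsto[of t] unfolding filterlim_iff by blast
    qed
    show ?thesis
    proof
      assume "\<omega> t \<in> Some ` U"
      then obtain x where x: "\<omega> t = Some x" "x \<in> U" by auto
      then obtain b where b: "b \<in> \<B>" "x \<in> b" "closure b \<subseteq> U" using \<B>(4)[OF U] by blast
      have "eventually (\<lambda>n. \<omega> (dyadic_above n t) \<in> Some ` b) sequentially"
        by (rule ev) (use b x \<B>(2) in auto)
      then obtain N where "\<forall>n\<ge>N. \<omega> (dyadic_above n t) \<in> Some ` b"
        unfolding eventually_sequentially by blast
      then have "\<forall>n\<ge>N. \<omega> (dyadic_above n t) \<in> Some ` closure b"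
        using closure_subset[of b] by (meson image_mono subsetD)
      then show "\<exists>b\<in>{b \<in> \<B>. closure b \<subseteq> U}. \<exists>N. \<forall>n\<ge>N. \<omega> (dyadic_above n t) \<in> Some ` closure b"
        using b by blast
    next
      assume "\<exists>b\<in>{b \<in> \<B>. closure b \<subseteq> U}. \<exists>N. \<forall>n\<ge>N. \<omega> (dyadic_above n t) \<in> Some ` closure b"
      then obtain b N where b: "b \<in> \<B>" "closure b \<subseteq> U"
        and N: "\<forall>n\<ge>N. \<omega> (dyadic_above n t) \<in> Some ` closure b" by blast
      have cl: "closedin (Alexandroff_compactification euclidean) (Some ` closure b)"
        using b \<B>(3) by simp
      show "\<omega> t \<in> Some ` U"
      proof (rule ccontr)
        assume "\<omega> t \<notin> Some ` U"
        then have "\<omega> t \<notin> Some ` closure b" using b by blast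
        moreover have "topspace (Alexandroff_compactification (euclidean :: 'a topology)) = UNIV"
          by (auto simp: image_iff)
        ultimately have "eventually (\<lambda>n. \<omega> (dyadic_above n t) \<in> - Some ` closure b) sequentially"
          using cl by (intro ev) (auto simp: closedin_def Compl_eq_Diff_UNIV)
        then obtain N' where "\<forall>n\<ge>N'. \<omega> (dyadic_above n t) \<notin> Some ` closure b"
          unfolding eventually_sequentially by auto
        then show False using N by (metis max.cobounded1 max.cobounded2)
      qed
    qed
  qed
  let ?pre = "\<lambda>B. {p \<in> space ?M. snd p (max 0 (fst p)) \<in> Some ` B}"
  have pre_open: "?pre U \<in> sets ?M" if U: "open U" for U
  proof -
    have [measurable]: "Some ` closure b \<in> sets cemetery_borel" for b :: "'a set"
      by (intro Some_image_in_cemetery_borel) auto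
    have "?pre U = {p \<in> space ?M. \<exists>b\<in>{b \<in> \<B>. closure b \<subseteq> U}.
        \<exists>N. \<forall>n\<ge>N. snd p (dyadic_above n (max 0 (fst p))) \<in> Some ` closure b}"
    proof (rule Collect_cong, rule conj_cong[OF refl])
      fix p :: "real \<times> (real \<Rightarrow> 'a option)" assume "p \<in> space ?M"
      then show "snd p (max 0 (fst p)) \<in> Some ` U \<longleftrightarrow> (\<exists>b\<in>{b \<in> \<B>. closure b \<subseteq> U}.
        \<exists>N. \<forall>n\<ge>N. snd p (dyadic_above n (max 0 (fst p))) \<in> Some ` closure b)"
        by (intro open_iff U) (simp_all add: space_pair_measure mem_Times_iff)
    qed
    also have "\<dots> \<in> sets ?M"
    proof (rule sets.sets_Collect_countable_Ex')
      show "countable {b \<in> \<B>. closure b \<subseteq> U}" using \<B>(1) by simp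
    qed measurable
    finally show ?thesis .
  qed
  have pre: "?pre B \<in> sets ?M" if "B \<in> sets borel" for B
  proof -
    from that have "B \<in> sigma_sets UNIV {S. open S}" by (simp add: borel_def)
    then show ?thesis
    proof induction
      case (Basic U)
      then show ?case by (intro pre_open) simp
    next
      case Empty
      then show ?case by simp
    next
      case (Compl B)
      have "?pre (UNIV - B) = ?pre UNIV - ?pre B" by auto
      then show ?case using sets.Diff[OF pre_open[OF open_UNIV] Compl.IH] by argo
    next
      case (Union A)
      have "?pre (\<Union>(range A)) = (\<Union>i. ?pre (A i))" by auto
      moreover have "(\<Union>i. ?pre (A i)) \<in> sets ?M" using Union.IH by (intro sets.countable_UN) auto
      ultimately show ?case by argo
    qed
  qed
  show ?thesis
    unfolding cemetery_borel_def
  proof (rule measurable_measure_of)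
    fix A :: "'a option set" assume "A \<in> {Some ` B | B. B \<in> sets borel}"
    then obtain B where "B \<in> sets borel" "A = Some ` B" by auto
    then show "(\<lambda>(t, \<omega>). \<omega> (max 0 t)) -` A \<inter> space ?M \<in> sets ?M"
      using pre[of B] by (simp add: vimage_def Int_def case_prod_unfold conj_commute)
  qed auto
qed

lemma measurable_tail_path:
  assumes lc: "locally_compact_space (euclidean :: 'a::{t2_space,second_countable_topology} topology)"
    and g[measurable]: "(\<lambda>(p, s, x). g p s x) \<in> borel_measurable (N \<Otimes>\<^sub>M borel \<Otimes>\<^sub>M (cemetery_borel :: 'a::{t2_space,second_countable_topology} option measure))"
    and X[measurable]: "X \<in> N \<rightarrow>\<^sub>M path_space" and t[measurable]: "t \<in> borel_measurable N"
    and nonneg: "\<And>p. 0 \<le> t p"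
  shows "(\<lambda>p. tail (\<lambda>s. g p s (X p s)) (t p)) \<in> borel_measurable N"
proof -
  note measurable_evaluation[OF lc, measurable]
  have "(\<lambda>q. (\<lambda>(t, \<omega>). \<omega> (max 0 t)) (snd q, X (fst q))) \<in> N \<Otimes>\<^sub>M borel \<rightarrow>\<^sub>M cemetery_borel"
    by (rule measurable_compose[OF _ measurable_evaluation[OF lc]]) measurable
  then have [measurable]: "(\<lambda>q. X (fst q) (max 0 (snd q))) \<in> N \<Otimes>\<^sub>M borel \<rightarrow>\<^sub>M cemetery_borel" by simp
  have "(\<lambda>p. tail (\<lambda>s. g p s (X p (max 0 s))) (t p)) \<in> borel_measurable N"
  proof (rule measurable_tail)
    have "(\<lambda>q. (\<lambda>(p, s, x). g p s x) (fst q, snd q, X (fst q) (max 0 (snd q)))) \<in> borel_measurable (N \<Otimes>\<^sub>M borel)"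
      by (rule measurable_compose[OF _ g]) measurable
    then show "(\<lambda>(p, s). g p s (X p (max 0 s))) \<in> borel_measurable (N \<Otimes>\<^sub>M borel)"
      by (simp add: case_prod_unfold)
  qed measurable
  also have "(\<lambda>p. tail (\<lambda>s. g p s (X p (max 0 s))) (t p)) = (\<lambda>p. tail (\<lambda>s. g p s (X p s)) (t p))"
  proof (intro ext tail_cong)
    fix p s assume "t p < s"
    then have "max 0 s = s" using nonneg[of p] by simp
    then show "g p s (X p (max 0 s)) = g p s (X p s)" by simp
  qed
  finally show ?thesis .
qed

text \<open>For \<open>\<alpha> > 0\<close> this is \<open>exp (- \<alpha> \<zeta>)\<close>, the mass that the exponential law of rate \<open>\<alpha>\<close> gives to the times after
death. As an integral over times it involves the path only through its values \<open>\<omega> s\<close>.\<close>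

definition killing_weight :: "real \<Rightarrow> (real \<Rightarrow> 'a option) \<Rightarrow> ennreal" where
  "killing_weight \<alpha> \<omega> = tail (\<lambda>s. ennreal (\<alpha> * exp (- \<alpha> * s)) * (if \<omega> s = None then 1 else 0)) 0"

lemma tail_exp_density:
  assumes "0 < \<alpha>"
  shows "tail (\<lambda>s. ennreal (\<alpha> * exp (- \<alpha> * s))) t = ennreal (exp (- \<alpha> * t))"
proof -
  have "tail (\<lambda>s. ennreal (\<alpha> * exp (- \<alpha> * s))) t = tail (\<lambda>s. ennreal \<alpha> * ennreal (exp (- s * \<alpha>))) t"
    using assms by (simp add: ennreal_mult' mult.commute)
  also have "\<dots> = ennreal \<alpha> * ennreal (exp (- t * \<alpha>) / \<alpha>)"
    using assms tail_exp[of \<alpha> t] by (subst tail_mult_left) auto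
  also have "\<dots> = ennreal (exp (- \<alpha> * t))"
    using assms by (simp add: ennreal_mult'[symmetric] mult.commute)
  finally show ?thesis .
qed

text \<open>Integrate \<open>exp (- \<alpha> \<zeta>)\<close> over \<open>\<alpha> > 0\<close>; if \<open>\<zeta> = \<infinity>\<close>, both sides vanish.\<close>

lemma inverse_lifetime:
  assumes "\<omega> \<in> paths" "0 < lifetime \<omega>"
  shows "inverse (lifetime \<omega>) = tail (\<lambda>\<alpha>. killing_weight \<alpha> \<omega>) 0"
proof (cases "lifetime \<omega>")
  case (real \<zeta>)
  then have \<zeta>: "0 < \<zeta>" using assms by simp
  have dead: "\<omega> s = None \<longleftrightarrow> \<zeta> \<le> s" if "0 < s" for s
    using lifetime_le_iff[OF assms(1) that] real that \<zeta> by (simp add: ennreal_le_iff)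
  have after: "\<omega> s = None" if "\<zeta> < s" for s using dead[of s] that \<zeta> by simp
  have weight: "killing_weight \<alpha> \<omega> = ennreal (exp (- \<alpha> * \<zeta>))" if "0 < \<alpha>" for \<alpha>
  proof -
    have "killing_weight \<alpha> \<omega> = tail (\<lambda>s. ennreal (\<alpha> * exp (- \<alpha> * s))) \<zeta>"
      unfolding killing_weight_def tail_def using AE_lborel_singleton[of \<zeta>] \<zeta>
      by (intro nn_integral_cong_AE)
        (auto elim!: eventually_mono simp: indicator_def dead after)
    then show ?thesis using tail_exp_density[OF that] by simp
  qed
  have "tail (\<lambda>\<alpha>. killing_weight \<alpha> \<omega>) 0 = tail (\<lambda>\<alpha>. ennreal (exp (- \<alpha> * \<zeta>))) 0"
    by (intro tail_cong weight)
  also have "\<dots> = ennreal (1 / \<zeta>)" using tail_exp[OF \<zeta>, of 0] by simp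
  finally show ?thesis using real \<zeta> by (simp add: inverse_ennreal inverse_eq_divide)
next
  case top
  then have alive: "\<omega> s \<noteq> None" if "0 < s" for s
    using lifetime_le_iff[OF assms(1) that] top by (simp add: top_unique)
  have "killing_weight \<alpha> \<omega> = 0" for \<alpha>
    unfolding killing_weight_def tail_def by (rule nn_integral_zero') (auto simp: indicator_def alive)
  then show ?thesis using top by (simp add: tail_def)
qed

lemma measurable_path:
  assumes lc: "locally_compact_space (euclidean :: 'a::{t2_space,second_countable_topology} topology)"
    and \<omega>: "\<omega> \<in> (paths :: (real \<Rightarrow> 'a::{t2_space,second_countable_topology} option) set)"
  shows "(\<lambda>s. \<omega> (max 0 s)) \<in> borel \<rightarrow>\<^sub>M cemetery_borel"
  using measurable_compose[OF measurable_Pair2'[of \<omega> path_space borel] measurable_evaluation[OF lc]] \<omega> by simp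

text \<open>The exponential law gives mass \<open>exp (- \<alpha> t)\<close> to \<open>(t, \<infinity>)\<close>. The part carried by times at which the path
is still alive is an occupation time, whose expectation is a potential.\<close>

lemma killing_weight_split:
  assumes lc: "locally_compact_space (euclidean :: 'a::{t2_space,second_countable_topology} topology)"
    and \<omega>: "\<omega> \<in> (paths :: (real \<Rightarrow> 'a::{t2_space,second_countable_topology} option) set)"
    and t: "0 < t" "\<omega> t \<noteq> None" and \<alpha>: "0 < \<alpha>"
  shows "killing_weight \<alpha> \<omega> + tail (\<lambda>s. ennreal (\<alpha> * exp (- \<alpha> * s)) * ext0 (\<lambda>_. 1) (\<omega> s)) t = ennreal (exp (- \<alpha> * t))"
proof -
  define d where "d s = ennreal (\<alpha> * exp (- \<alpha> * s))" for s
  have [measurable]: "d \<in> borel_measurable borel" unfolding d_def by measurable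
  note measurable_path[OF lc \<omega>, measurable]
  have alive: "t < s" if "\<omega> s = None" "0 < s" for s
    using paths_None_mono[OF \<omega> that(2) _ that(1), of t] t by force
  have "killing_weight \<alpha> \<omega> = tail (\<lambda>s. d s * (if \<omega> s = None then 1 else 0)) t"
    unfolding killing_weight_def tail_def d_def
  proof (rule nn_integral_cong)
    fix s
    show "ennreal (\<alpha> * exp (- \<alpha> * s)) * (if \<omega> s = None then 1 else 0) * indicator {0<..} s =
      ennreal (\<alpha> * exp (- \<alpha> * s)) * (if \<omega> s = None then 1 else 0) * indicator {t<..} s"
      using alive[of s] t by (auto simp: indicator_def)
  qed
  also have "\<dots> = tail (\<lambda>s. d s * (if \<omega> (max 0 s) = None then 1 else 0)) t"
    using t by (intro tail_cong) auto
  finally have 1: "killing_weight \<alpha> \<omega> = \<dots>" .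
  have 2: "tail (\<lambda>s. d s * ext0 (\<lambda>_. 1) (\<omega> s)) t = tail (\<lambda>s. d s * (if \<omega> (max 0 s) = None then 0 else 1)) t"
    using t by (intro tail_cong) (auto simp: ext0_eq)
  have "killing_weight \<alpha> \<omega> + tail (\<lambda>s. d s * ext0 (\<lambda>_. 1) (\<omega> s)) t = tail d t"
    unfolding 1 2 unfolding tail_def by (subst nn_integral_add[symmetric]) (auto intro!: nn_integral_cong)
  also have "\<dots> = ennreal (exp (- \<alpha> * t))"
    unfolding d_def by (rule tail_exp_density[OF \<alpha>])
  finally show ?thesis unfolding d_def .
qed

lemma measurable_killing_weight:
  assumes lc: "locally_compact_space (euclidean :: 'a::{t2_space,second_countable_topology} topology)"
  shows "(\<lambda>(\<alpha>, \<omega>). killing_weight \<alpha> \<omega>) \<in> borel_measurable (borel \<Otimes>\<^sub>M (path_space :: (real \<Rightarrow> 'a::{t2_space,second_countable_topology} option) measure))"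
proof -
  have "(\<lambda>p. tail (\<lambda>s. ennreal (fst p * exp (- fst p * s)) * (if snd p s = None then 1 else 0)) 0)
      \<in> borel_measurable (borel \<Otimes>\<^sub>M (path_space :: (real \<Rightarrow> 'a option) measure))"
    by (rule measurable_tail_path[OF lc, where g = "\<lambda>p s x. ennreal (fst p * exp (- fst p * s)) * (if x = None then 1 else 0)"])
      measurable
  then show ?thesis by (simp add: killing_weight_def case_prod_unfold)
qed

section \<open>Transition kernels and potentials\<close>

context process_with_potential_densities
begin

declare sets_m[measurable_cong]

abbreviation (input) \<Omega> :: "(real \<Rightarrow> 'a option) measure" where "\<Omega> \<equiv> path_space"

lemma space_m[simp]: "space m = UNIV"
  using sets_eq_imp_space_eq[OF sets_m] by simp

lemma measurable_m[simp]: "borel_measurable m = borel_measurable borel"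
  by (rule measurable_cong_sets) (simp_all add: sets_m)

sublocale m: sigma_finite_measure m
proof
  obtain \<B> :: "'a set set" where \<B>: "countable \<B>" "\<And>b. b \<in> \<B> \<Longrightarrow> open b" "\<And>b. b \<in> \<B> \<Longrightarrow> compact (closure b)"
    "\<And>U x. open U \<Longrightarrow> x \<in> U \<Longrightarrow> \<exists>b\<in>\<B>. x \<in> b \<and> closure b \<subseteq> U"
    using countable_base_of_compact_closures[OF locally_compact] by metis
  show "\<exists>A. countable A \<and> A \<subseteq> sets m \<and> \<Union>A = space m \<and> (\<forall>a\<in>A. emeasure m a \<noteq> \<infinity>)"
  proof (intro exI[of _ "closure ` \<B>"] conjI ballI)
    show "countable (closure ` \<B>)" using \<B>(1) by simp
    show "closure ` \<B> \<subseteq> sets m" unfolding sets_m by (intro image_subsetI borel_closed closed_closure)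
    have "x \<in> \<Union>(closure ` \<B>)" for x
    proof -
      obtain b where "b \<in> \<B>" "x \<in> b" using \<B>(4)[OF open_UNIV, of x] by auto
      then show ?thesis using closure_subset[of b] by auto
    qed
    then show "\<Union>(closure ` \<B>) = space m" by auto
    show "emeasure m a \<noteq> \<infinity>" if a: "a \<in> closure ` \<B>" for a
    proof -
      obtain b where "b \<in> \<B>" "a = closure b" using a by auto
      then show ?thesis using m_compact[OF \<B>(3), of b] by simp
    qed
  qed
qed

lemma sets_Pt[simp]: "0 \<le> t \<Longrightarrow> sets (Pt t x) = sets borel"
  and space_Pt[simp]: "0 \<le> t \<Longrightarrow> space (Pt t x) = UNIV"
  and subprob_Pt: "0 \<le> t \<Longrightarrow> subprob_space (Pt t x)"
proof -
  assume "0 \<le> t"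
  then have "Pt t x \<in> space (subprob_algebra borel)"
    using kernel measurable_space[of "Pt t" borel "subprob_algebra borel" x] by simp
  then show "sets (Pt t x) = sets borel" "space (Pt t x) = UNIV" "subprob_space (Pt t x)"
    using sets_eq_imp_space_eq[of "Pt t x" borel] by (auto simp: space_subprob_algebra)
qed

lemma measurable_Pt_eq[simp]: "0 \<le> t \<Longrightarrow> borel_measurable (Pt t x) = borel_measurable borel"
  by (rule measurable_cong_sets) simp_all

lemma prob_space_Px: "prob_space (Px x)" and sets_Px: "sets (Px x) = sets path_space"
  using measurable_space[OF laws, of x] by (auto simp: space_prob_algebra)

lemma space_Px: "space (Px x) = paths"
  using sets_eq_imp_space_eq[OF sets_Px] by simp

lemma coordinate_event: "t \<in> T \<Longrightarrow> B \<in> sets borel \<Longrightarrow> {\<omega> \<in> paths. \<omega> t \<in> Some ` B} \<in> sets (coord_space T)"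
  unfolding sets_coord_space by (intro sigma_sets.Basic) auto

lemma emeasure_Pt_eq_Px:
  assumes t: "0 \<le> t" and B: "B \<in> sets borel"
  shows "emeasure (Pt t x) B = emeasure (Px x) {\<omega> \<in> paths. \<omega> t \<in> Some ` B}"
proof -
  interpret prob_space "Px x" by (rule prob_space_Px)
  have "paths \<in> sets (coord_space ({0..} \<inter> {..0}))"
    using sets.top[of "coord_space ({0..} \<inter> {..0 :: real})"] by simp
  then have "emeasure (Px x) (paths \<inter> {\<omega> \<in> paths. \<omega> (0 + t) \<in> Some ` B}) =
      (\<integral>\<^sup>+\<omega>\<in>paths. ext0 (\<lambda>x. emeasure (Pt t x) B) (\<omega> 0) \<partial>Px x)"
    using markov[of x] t B unfolding markov_under_def by blast
  also have "\<dots> = (\<integral>\<^sup>+\<omega>. emeasure (Pt t x) B \<partial>Px x)"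
  proof (rule nn_integral_cong_AE)
    show "AE \<omega> in Px x. ext0 (\<lambda>x. emeasure (Pt t x) B) (\<omega> 0) * indicator paths \<omega> = emeasure (Pt t x) B"
      using start[of x] AE_space[of "Px x"] by eventually_elim (simp add: ext0_def space_Px)
  qed
  also have "\<dots> = emeasure (Pt t x) B" by (simp add: emeasure_space_1)
  finally show ?thesis by (simp add: Int_def conj_ac cong: conj_cong)
qed

text \<open>
Right continuity of the paths yields measurability of the semigroup in the time variable. Times are cut
off at \<open>0\<close> because the kernels are specified only for \<open>t \<ge> 0\<close>.\<close>

lemma measurable_Pt[measurable]: "(\<lambda>p. Pt (max 0 (fst p)) (snd p)) \<in> borel \<Otimes>\<^sub>M borel \<rightarrow>\<^sub>M subprob_algebra borel"
proof (rule measurable_subprob_algebra)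
  fix B :: "'a set" assume B[measurable]: "B \<in> sets borel"
  have [measurable]: "(\<lambda>p. Px (snd p)) \<in> borel \<Otimes>\<^sub>M borel \<rightarrow>\<^sub>M subprob_algebra path_space"
    using measurable_prob_algebraD[OF laws] by measurable
  have "emeasure (Pt (max 0 (fst p)) (snd p)) B = (\<integral>\<^sup>+\<omega>. ext0 (indicator B) (\<omega> (max 0 (fst p))) \<partial>Px (snd p))" for p
  proof -
    define t where "t = max 0 (fst p)"
    have t: "0 \<le> t" unfolding t_def by simp
    have ev: "{\<omega> \<in> paths. \<omega> t \<in> Some ` B} \<in> sets (Px (snd p))"
      by (subst sets_Px) (rule coordinate_event[OF _ B], simp add: t)
    have "emeasure (Pt t (snd p)) B = emeasure (Px (snd p)) {\<omega> \<in> paths. \<omega> t \<in> Some ` B}"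
      by (rule emeasure_Pt_eq_Px[OF t B])
    also have "\<dots> = (\<integral>\<^sup>+\<omega>. indicator {\<omega> \<in> paths. \<omega> t \<in> Some ` B} \<omega> \<partial>Px (snd p))"
      by (rule nn_integral_indicator[OF ev, symmetric])
    also have "\<dots> = (\<integral>\<^sup>+\<omega>. ext0 (indicator B) (\<omega> t) \<partial>Px (snd p))"
      by (intro nn_integral_cong) (auto simp: space_Px ext0_def indicator_def split: option.split)
    finally show ?thesis unfolding t_def .
  qed
  moreover have "(\<lambda>p. \<integral>\<^sup>+\<omega>. ext0 (indicator B) (\<omega> (max 0 (fst p))) \<partial>Px (snd p)) \<in> borel_measurable (borel \<Otimes>\<^sub>M (borel :: 'a measure))"
  proof (rule nn_integral_measurable_subprob_algebra2)
    have "(\<lambda>q. (\<lambda>(t, \<omega>). \<omega> (max 0 t)) (fst (fst q), snd q)) \<in> (borel \<Otimes>\<^sub>M (borel :: 'a measure)) \<Otimes>\<^sub>M path_space \<rightarrow>\<^sub>M (cemetery_borel :: 'a option measure)"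
      by (rule measurable_compose[OF _ measurable_evaluation[OF locally_compact]]) measurable
    then have "(\<lambda>q. ext0 (indicator B :: 'a \<Rightarrow> ennreal) (snd q (max 0 (fst (fst q))))) \<in> borel_measurable ((borel \<Otimes>\<^sub>M (borel :: 'a measure)) \<Otimes>\<^sub>M path_space)"
      by (intro measurable_compose[OF _ measurable_ext0_fixed]) simp_all
    then show "(\<lambda>(p, \<omega>). ext0 (indicator B :: 'a \<Rightarrow> ennreal) (\<omega> (max 0 (fst p)))) \<in> borel_measurable ((borel \<Otimes>\<^sub>M (borel :: 'a measure)) \<Otimes>\<^sub>M path_space)"
      by (simp add: case_prod_unfold)
  qed measurable
  ultimately show "(\<lambda>p. emeasure (Pt (max 0 (fst p)) (snd p)) B) \<in> borel_measurable (borel \<Otimes>\<^sub>M borel)"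
    by simp
qed (auto intro: subprob_Pt)

lemma measurable_nn_integral_Pt:
  assumes g: "(\<lambda>(p, y). g p y) \<in> borel_measurable (N \<Otimes>\<^sub>M borel)"
    and [measurable]: "t \<in> borel_measurable N" "x \<in> N \<rightarrow>\<^sub>M borel" and t: "\<And>p. p \<in> space N \<Longrightarrow> 0 \<le> t p"
  shows "(\<lambda>p. \<integral>\<^sup>+y. g p y \<partial>Pt (t p) (x p)) \<in> borel_measurable N"
proof -
  have "(\<lambda>p. \<integral>\<^sup>+y. g p y \<partial>Pt (max 0 (fst (t p, x p))) (snd (t p, x p))) \<in> borel_measurable N"
    by (rule nn_integral_measurable_subprob_algebra2[OF g measurable_compose[OF _ measurable_Pt]]) measurable
  then show ?thesis
    by (rule measurable_cong[THEN iffD1, rotated]) (use t in \<open>simp add: max_def\<close>)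
qed

lemma measurable_nn_integral_Pt_fixed[measurable]:
  assumes [measurable]: "g \<in> borel_measurable borel" and "0 \<le> t"
  shows "(\<lambda>x. \<integral>\<^sup>+y. g y \<partial>Pt t x) \<in> borel_measurable borel"
  by (rule measurable_nn_integral_Pt) (use assms in measurable)

lemma measurable_time_Pt[measurable]:
  assumes [measurable]: "g \<in> borel_measurable borel"
  shows "(\<lambda>t. \<integral>\<^sup>+y. g y \<partial>Pt (max 0 t) x) \<in> borel_measurable borel"
  by (rule measurable_nn_integral_Pt) auto

lemma u_meas[measurable]:
  assumes "0 \<le> \<alpha>" and [measurable]: "f \<in> N \<rightarrow>\<^sub>M borel" "g \<in> N \<rightarrow>\<^sub>M borel"
  shows "(\<lambda>x. u \<alpha> (f x) (g x)) \<in> borel_measurable N"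
  using measurable_compose[OF _ u_measurable[OF assms(1)], of "\<lambda>x. (f x, g x)" N] by simp

lemma tail_time_max: "tail (\<lambda>t. f t * F (max 0 t)) 0 = tail (\<lambda>t. f t * F t) 0"
  by (intro tail_cong) simp

text \<open>The measure with density \<open>u\<^sup>\<alpha>(x, \<cdot>)\<close> is the mixture of the \<open>P\<^sub>t(x, \<cdot>)\<close> with weights \<open>exp (- \<alpha> t)\<close>.\<close>

lemma potential_max:
  assumes g: "g \<in> borel_measurable borel" and \<alpha>[measurable]: "0 \<le> \<alpha>"
  shows "tail (\<lambda>t. ennreal (exp (- \<alpha> * t)) * (\<integral>\<^sup>+y. g y \<partial>Pt (max 0 t) x)) 0 = (\<integral>\<^sup>+y. u \<alpha> x y * g y \<partial>m)"
proof -
  define w where "w t = ennreal (exp (- \<alpha> * t)) * indicator {0<..} t" for t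
  define \<kappa> where "\<kappa> t = Pt (max 0 t) x" for t
  have [measurable]: "w \<in> borel_measurable borel" unfolding w_def by measurable
  have tail_eq: "tail (\<lambda>t. ennreal (exp (- \<alpha> * t)) * F t) 0 = (\<integral>\<^sup>+t. w t * F t \<partial>lborel)" for F
    unfolding tail_def w_def by (simp add: mult_ac)
  have "(\<integral>\<^sup>+y. g y \<partial>density m (\<lambda>y. u \<alpha> x y)) = (\<integral>\<^sup>+t. w t * (\<integral>\<^sup>+y. g y \<partial>\<kappa> t) \<partial>lborel)"
  proof (rule nn_integral_mixture[where M = borel])
    fix A :: "'a set" assume A: "A \<in> sets borel"
    have "emeasure (density m (\<lambda>y. u \<alpha> x y)) A = tail (\<lambda>t. ennreal (exp (- \<alpha> * t)) * emeasure (Pt t x) A) 0"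
      using u_density[OF \<alpha> A, of x] A unfolding set_nn_integral_atLeast_tail by (simp add: emeasure_density sets_m)
    also have "\<dots> = tail (\<lambda>t. ennreal (exp (- \<alpha> * t)) * emeasure (\<kappa> t) A) 0"
      by (intro tail_cong) (simp add: \<kappa>_def)
    finally show "emeasure (density m (\<lambda>y. u \<alpha> x y)) A = (\<integral>\<^sup>+t. w t * emeasure (\<kappa> t) A \<partial>lborel)"
      unfolding tail_eq .
  next
    fix g :: "'a \<Rightarrow> ennreal" assume [measurable]: "g \<in> borel_measurable borel"
    show "(\<lambda>t. w t * (\<integral>\<^sup>+y. g y \<partial>\<kappa> t)) \<in> borel_measurable lborel" unfolding \<kappa>_def by measurable
  qed (simp_all add: \<kappa>_def sets_m g)
  then show ?thesis
    unfolding tail_eq \<kappa>_def using g by (simp add: nn_integral_density)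
qed

lemma potential:
  assumes "g \<in> borel_measurable borel" and "0 \<le> \<alpha>"
  shows "tail (\<lambda>t. ennreal (exp (- \<alpha> * t)) * (\<integral>\<^sup>+y. g y \<partial>Pt t x)) 0 = (\<integral>\<^sup>+y. u \<alpha> x y * g y \<partial>m)"
  using potential_max[OF assms, of x] tail_time_max[of "\<lambda>t. ennreal (exp (- \<alpha> * t))" "\<lambda>t. \<integral>\<^sup>+y. g y \<partial>Pt t x"]
  by simp

lemma u_antimono: "0 \<le> \<alpha> \<Longrightarrow> \<alpha> \<le> \<beta> \<Longrightarrow> u \<beta> x y \<le> u \<alpha> x y"
  by (subst resolvent1[of \<alpha> \<beta>]) auto

text \<open>The right limit of \<open>u\<^sup>\<alpha>\<close> in \<open>\<alpha>\<close>. The densities are measurable in the two space variables for each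
\<open>\<alpha>\<close>, but integrating over \<open>\<alpha>\<close> requires joint measurability. Since \<open>u\<^sup>\<alpha>\<close> decreases in \<open>\<alpha>\<close>, the right
limit is an increasing limit along dyadic rates and is jointly measurable.\<close>

definition u_plus :: "real \<Rightarrow> 'a \<Rightarrow> 'a \<Rightarrow> ennreal" where
  "u_plus \<alpha> x y = (SUP n. u (max 0 (dyadic_above n \<alpha>)) x y)"

lemma measurable_u_plus':
  "(\<lambda>(\<alpha>, x, y). u_plus \<alpha> x y) \<in> borel_measurable (borel \<Otimes>\<^sub>M borel \<Otimes>\<^sub>M borel)"
proof -
  have [measurable]: "(\<lambda>(\<alpha>, q). (\<lambda>s (x, y). u (max 0 s) x y) (dyadic_above n \<alpha>) q) \<in>
      borel_measurable (borel \<Otimes>\<^sub>M borel \<Otimes>\<^sub>M borel)" for n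
    by (rule measurable_compose_dyadic_above[where T = UNIV]) (auto intro!: u_measurable)
  have "(\<lambda>p. SUP n. (\<lambda>(\<alpha>, q). (\<lambda>s (x, y). u (max 0 s) x y) (dyadic_above n \<alpha>) q) p) \<in>
      borel_measurable (borel \<Otimes>\<^sub>M borel \<Otimes>\<^sub>M borel)"
    by measurable
  then show ?thesis by (simp add: u_plus_def case_prod_unfold)
qed

lemma measurable_u_plus[measurable]:
  assumes [measurable]: "a \<in> borel_measurable N" "f \<in> N \<rightarrow>\<^sub>M borel" "g \<in> N \<rightarrow>\<^sub>M borel"
  shows "(\<lambda>x. u_plus (a x) (f x) (g x)) \<in> borel_measurable N"
  using measurable_compose[OF _ measurable_u_plus', of "\<lambda>x. (a x, f x, g x)" N] by simp

lemma AE_eq_if_set_integrals_eq: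
  assumes [measurable]: "f \<in> borel_measurable borel" "g \<in> borel_measurable borel"
    and "\<And>B. B \<in> sets borel \<Longrightarrow> (\<integral>\<^sup>+y. f y * indicator B y \<partial>m) = (\<integral>\<^sup>+y. g y * indicator B y \<partial>m)"
  shows "AE y in m. f y = g y"
proof (rule m.density_unique)
  show "density m f = density m g"
    using assms by (intro measure_eqI) (auto simp: emeasure_density sets_m)
qed simp_all

text \<open>The Laplace transform of \<open>t \<mapsto> P\<^sub>t(x, B)\<close> is right continuous in \<open>\<alpha>\<close> by monotone convergence, hence both
functions have the same integrals over every Borel set \<open>B\<close>.\<close>

lemma u_eq_u_plus:
  assumes \<alpha>: "0 \<le> \<alpha>"
  shows "AE y in m. u \<alpha> x y = u_plus \<alpha> x y"
proof (rule AE_eq_if_set_integrals_eq)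
  fix B :: "'a set" assume [measurable]: "B \<in> sets borel"
  let ?d = "\<lambda>n. dyadic_above n \<alpha>"
  define p where "p t = (\<integral>\<^sup>+y. indicator B y \<partial>Pt (max 0 t) x)" for t
  have [measurable]: "p \<in> borel_measurable borel" unfolding p_def by measurable
  have d: "\<alpha> < ?d n" "0 \<le> ?d n" for n using dyadic_above_greater[of \<alpha> n] \<alpha> by auto
  have d_mono: "?d n \<le> ?d k" if "k \<le> n" for k n using dyadic_above_antimono[of \<alpha>] that by (auto simp: decseq_def)
  have pot: "(\<integral>\<^sup>+y. u a x y * indicator B y \<partial>m) = tail (\<lambda>t. ennreal (exp (- a * t)) * p t) 0" if "0 \<le> a" for a
    unfolding p_def by (rule potential_max[symmetric]) (use that in auto)
  have sup: "(SUP n. ennreal (exp (- ?d n * t))) = ennreal (exp (- \<alpha> * t))" if "0 < t" for t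
  proof (rule LIMSEQ_unique)
    show "(\<lambda>n. ennreal (exp (- ?d n * t))) \<longlonglongrightarrow> (SUP n. ennreal (exp (- ?d n * t)))"
      by (rule LIMSEQ_SUP) (use that d_mono in \<open>auto simp: incseq_def intro!: ennreal_leI\<close>)
    have "(\<lambda>n. ?d n) \<longlonglongrightarrow> \<alpha>" using dyadic_above_tendsto[of \<alpha>] by (simp add: filterlim_at)
    then show "(\<lambda>n. ennreal (exp (- ?d n * t))) \<longlonglongrightarrow> ennreal (exp (- \<alpha> * t))"
      by (intro tendsto_intros)
  qed
  have "(\<integral>\<^sup>+y. u_plus \<alpha> x y * indicator B y \<partial>m) = (\<integral>\<^sup>+y. (SUP n. u (?d n) x y * indicator B y) \<partial>m)"
    using d by (simp add: u_plus_def SUP_mult_right_ennreal max_def)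
  also have "\<dots> = (SUP n. \<integral>\<^sup>+y. u (?d n) x y * indicator B y \<partial>m)"
    using d d_mono by (intro nn_integral_monotone_convergence_SUP)
      (auto simp: incseq_def le_fun_def intro!: mult_right_mono u_antimono)
  also have "\<dots> = (SUP n. tail (\<lambda>t. ennreal (exp (- ?d n * t)) * p t) 0)"
    using d by (simp add: pot)
  also have "\<dots> = (\<integral>\<^sup>+t. (SUP n. ennreal (exp (- ?d n * t)) * p t * indicator {0<..} t) \<partial>lborel)"
    unfolding tail_def using d_mono
    by (intro nn_integral_monotone_convergence_SUP[symmetric])
      (auto simp: incseq_def le_fun_def indicator_def intro!: mult_right_mono ennreal_leI)
  also have "\<dots> = tail (\<lambda>t. ennreal (exp (- \<alpha> * t)) * p t) 0"
    unfolding tail_def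
    using sup by (intro nn_integral_cong) (auto simp: indicator_def SUP_mult_right_ennreal[symmetric])
  also have "\<dots> = (\<integral>\<^sup>+y. u \<alpha> x y * indicator B y \<partial>m)" using pot \<alpha> by simp
  finally show "(\<integral>\<^sup>+y. u \<alpha> x y * indicator B y \<partial>m) = (\<integral>\<^sup>+y. u_plus \<alpha> x y * indicator B y \<partial>m)" ..
qed (use \<alpha> in measurable)

lemma nn_integral_u_plus:
  assumes \<alpha>: "0 \<le> \<alpha>"
  shows "(\<integral>\<^sup>+y. u_plus \<alpha> x y * g y \<partial>m) = (\<integral>\<^sup>+y. u \<alpha> x y * g y \<partial>m)"
  using u_eq_u_plus[OF \<alpha>, of x] by (intro nn_integral_cong_AE) (auto elim: eventually_mono)

text \<open>The iterated potential density \<open>u\<^sup>\<alpha> u\<^sup>\<alpha>\<close>, formed with the jointly measurable version. It is minus the derivative of \<open>u\<^sup>\<alpha>\<close> in \<open>\<alpha>\<close> according to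
the resolvent equation.\<close>

definition v :: "real \<Rightarrow> 'a \<Rightarrow> 'a \<Rightarrow> ennreal" where
  "v \<alpha> x y = (\<integral>\<^sup>+z. u_plus \<alpha> x z * u_plus \<alpha> z y \<partial>m)"

lemma measurable_v[measurable]:
  assumes [measurable]: "a \<in> borel_measurable N" "f \<in> N \<rightarrow>\<^sub>M borel" "g \<in> N \<rightarrow>\<^sub>M borel"
  shows "(\<lambda>x. v (a x) (f x) (g x)) \<in> borel_measurable N"
  unfolding v_def by measurable

lemma pair_m: "pair_sigma_finite m m"
  by standard

lemma nn_integral_v:
  assumes \<alpha>[measurable]: "0 \<le> \<alpha>" and [measurable]: "g \<in> borel_measurable borel"
  shows "(\<integral>\<^sup>+y. v \<alpha> x y * g y \<partial>m) = (\<integral>\<^sup>+z. u \<alpha> x z * (\<integral>\<^sup>+y. u \<alpha> z y * g y \<partial>m) \<partial>m)"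
proof -
  have "(\<integral>\<^sup>+y. v \<alpha> x y * g y \<partial>m) = (\<integral>\<^sup>+y. (\<integral>\<^sup>+z. u_plus \<alpha> x z * u_plus \<alpha> z y * g y \<partial>m) \<partial>m)"
    unfolding v_def by (intro nn_integral_cong nn_integral_multc[symmetric]) simp
  also have "\<dots> = (\<integral>\<^sup>+z. (\<integral>\<^sup>+y. u_plus \<alpha> x z * u_plus \<alpha> z y * g y \<partial>m) \<partial>m)"
    by (rule pair_sigma_finite.Fubini'[OF pair_m]) measurable
  also have "\<dots> = (\<integral>\<^sup>+z. u_plus \<alpha> x z * (\<integral>\<^sup>+y. u_plus \<alpha> z y * g y \<partial>m) \<partial>m)"
    by (intro nn_integral_cong) (simp add: mult.assoc nn_integral_cmult)
  finally show ?thesis by (simp add: nn_integral_u_plus \<alpha>)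
qed

text \<open>For each \<open>z\<close>, \<open>u\<^sup>\<alpha>(z, y)\<close> agrees with its measurable version only for almost every \<open>y\<close>, with an
exceptional set that depends on \<open>z\<close>. The comparison is therefore made after integration over \<open>y\<close>.\<close>

lemma v_eq:
  assumes \<alpha>[measurable]: "0 \<le> \<alpha>"
  shows "AE y in m. (\<integral>\<^sup>+z. u \<alpha> x z * u \<alpha> z y \<partial>m) = v \<alpha> x y"
proof (rule AE_eq_if_set_integrals_eq)
  fix B :: "'a set" assume [measurable]: "B \<in> sets borel"
  have "(\<integral>\<^sup>+y. (\<integral>\<^sup>+z. u \<alpha> x z * u \<alpha> z y \<partial>m) * indicator B y \<partial>m) =
      (\<integral>\<^sup>+y. (\<integral>\<^sup>+z. u \<alpha> x z * u \<alpha> z y * indicator B y \<partial>m) \<partial>m)"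
    by (intro nn_integral_cong nn_integral_multc[symmetric]) simp
  also have "\<dots> = (\<integral>\<^sup>+z. (\<integral>\<^sup>+y. u \<alpha> x z * u \<alpha> z y * indicator B y \<partial>m) \<partial>m)"
    by (rule pair_sigma_finite.Fubini'[OF pair_m]) measurable
  also have "\<dots> = (\<integral>\<^sup>+z. u \<alpha> x z * (\<integral>\<^sup>+y. u \<alpha> z y * indicator B y \<partial>m) \<partial>m)"
    by (intro nn_integral_cong) (simp add: mult.assoc nn_integral_cmult)
  finally show "(\<integral>\<^sup>+y. (\<integral>\<^sup>+z. u \<alpha> x z * u \<alpha> z y \<partial>m) * indicator B y \<partial>m) = (\<integral>\<^sup>+y. v \<alpha> x y * indicator B y \<partial>m)"
    by (simp add: nn_integral_v \<alpha>)
qed measurable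

text \<open>In the time domain \<open>u\<^sup>\<beta>\<close> weights \<open>P\<^sub>r\<close> by \<open>exp (- \<beta> r)\<close>. By the semigroup property \<open>v\<^sup>\<alpha>\<close> weights it by
\<open>r exp (- \<alpha> r)\<close>, because the splittings \<open>r = s + t\<close> form a segment of length \<open>r\<close>; and
\<open>\<integral> r exp (- \<alpha> r) d\<alpha> = exp (- \<beta> r)\<close> over \<open>\<alpha> > \<beta>\<close>. Unlike differences in the resolvent equation, this
computation involves no subtraction of infinite values and includes \<open>\<beta> = 0\<close>.\<close>

lemma u_eq_tail_v:
  assumes \<beta>: "0 \<le> \<beta>"
  shows "AE y in m. u \<beta> x y = tail (\<lambda>\<alpha>. v \<alpha> x y) \<beta>"
proof (rule AE_eq_if_set_integrals_eq)
  fix B :: "'a set" assume B[measurable]: "B \<in> sets borel"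
  define g :: "'a \<Rightarrow> ennreal" where "g = indicator B"
  have [measurable]: "g \<in> borel_measurable borel" unfolding g_def by measurable
  define p where "p t = (\<integral>\<^sup>+y. g y \<partial>Pt (max 0 t) x)" for t
  have [measurable]: "p \<in> borel_measurable borel" unfolding p_def by measurable
  have double: "(\<integral>\<^sup>+y. v \<alpha> x y * g y \<partial>m) = tail (\<lambda>r. ennreal r * (ennreal (exp (- \<alpha> * r)) * p r)) 0"
    if \<alpha>: "0 \<le> \<alpha>" for \<alpha>
  proof -
    let ?g = "\<lambda>z. \<integral>\<^sup>+y. u \<alpha> z y * g y \<partial>m"
    have inner: "(\<integral>\<^sup>+z. ?g z \<partial>Pt s x) = tail (\<lambda>t. ennreal (exp (- \<alpha> * t)) * p (s + t)) 0" if s: "0 < s" for s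
    proof -
      interpret P: subprob_space "Pt s x" using s by (intro subprob_Pt) simp
      interpret pair_sigma_finite lborel "Pt s x" by standard
      have [measurable_cong]: "sets (Pt s x) = sets borel" using s by simp
      have meas[measurable]: "(\<lambda>(t, z). \<integral>\<^sup>+y. g y \<partial>Pt (max 0 t) z) \<in> borel_measurable (borel \<Otimes>\<^sub>M borel)"
        unfolding case_prod_unfold by (rule measurable_nn_integral_Pt) auto
      have "(\<integral>\<^sup>+z. ?g z \<partial>Pt s x) =
          (\<integral>\<^sup>+z. tail (\<lambda>t. ennreal (exp (- \<alpha> * t)) * (\<integral>\<^sup>+y. g y \<partial>Pt (max 0 t) z)) 0 \<partial>Pt s x)"
        by (subst potential_max) (use \<alpha> in auto)
      also have "\<dots> = (\<integral>\<^sup>+t. (\<integral>\<^sup>+z. ennreal (exp (- \<alpha> * t)) * (\<integral>\<^sup>+y. g y \<partial>Pt (max 0 t) z) * indicator {0<..} t \<partial>Pt s x) \<partial>lborel)"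
        unfolding tail_def by (rule Fubini') measurable
      also have "\<dots> = tail (\<lambda>t. ennreal (exp (- \<alpha> * t)) * (\<integral>\<^sup>+z. (\<integral>\<^sup>+y. g y \<partial>Pt (max 0 t) z) \<partial>Pt s x)) 0"
        unfolding tail_def by (intro nn_integral_cong) (simp add: nn_integral_multc nn_integral_cmult)
      also have "\<dots> = tail (\<lambda>t. ennreal (exp (- \<alpha> * t)) * p (s + t)) 0"
      proof (intro tail_cong arg_cong2[where f = "(*)"] refl)
        fix t :: real assume t: "0 < t"
        have "Pt (s + t) x = Pt s x \<bind> Pt t" using s t by (intro semigroup) auto
        then have "(\<integral>\<^sup>+y. g y \<partial>Pt (s + t) x) = (\<integral>\<^sup>+z. (\<integral>\<^sup>+y. g y \<partial>Pt t z) \<partial>Pt s x)"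
          using kernel[of t] t s by (simp only:) (subst nn_integral_bind[where B = borel]; simp)
        then show "(\<integral>\<^sup>+z. (\<integral>\<^sup>+y. g y \<partial>Pt (max 0 t) z) \<partial>Pt s x) = p (s + t)"
          using s t by (simp add: p_def)
      qed
      finally show ?thesis .
    qed
    have [measurable]: "?g \<in> borel_measurable borel" using \<alpha> by measurable
    have "(\<integral>\<^sup>+y. v \<alpha> x y * g y \<partial>m) = tail (\<lambda>s. ennreal (exp (- \<alpha> * s)) * (\<integral>\<^sup>+z. ?g z \<partial>Pt s x)) 0"
      using nn_integral_v[OF \<alpha>, of g x] potential[of ?g \<alpha> x] \<alpha> by simp
    also have "\<dots> = tail (\<lambda>s. tail (\<lambda>t. ennreal (exp (- \<alpha> * (s + t))) * p (s + t)) 0) 0"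
    proof (intro tail_cong)
      fix s :: real assume "0 < s"
      then have "ennreal (exp (- \<alpha> * s)) * (\<integral>\<^sup>+z. ?g z \<partial>Pt s x) =
        tail (\<lambda>t. ennreal (exp (- \<alpha> * s)) * (ennreal (exp (- \<alpha> * t)) * p (s + t))) 0"
        by (simp add: inner tail_mult_left)
      also have "\<dots> = tail (\<lambda>t. ennreal (exp (- \<alpha> * (s + t))) * p (s + t)) 0"
        by (intro tail_cong) (simp add: mult.assoc[symmetric] ennreal_mult[symmetric] exp_add[symmetric] distrib_left)
      finally show "ennreal (exp (- \<alpha> * s)) * (\<integral>\<^sup>+z. ?g z \<partial>Pt s x) = \<dots>" .
    qed
    also have "\<dots> = tail (\<lambda>r. ennreal r * (ennreal (exp (- \<alpha> * r)) * p r)) 0"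
      by (rule tail_tail_add) measurable
    finally show ?thesis .
  qed
  have "(\<integral>\<^sup>+y. tail (\<lambda>\<alpha>. v \<alpha> x y) \<beta> * g y \<partial>m) = tail (\<lambda>\<alpha>. \<integral>\<^sup>+y. v \<alpha> x y * g y \<partial>m) \<beta>"
  proof -
    interpret pair_sigma_finite lborel m by standard
    have "(\<integral>\<^sup>+y. tail (\<lambda>\<alpha>. v \<alpha> x y) \<beta> * g y \<partial>m) =
        (\<integral>\<^sup>+y. (\<integral>\<^sup>+\<alpha>. v \<alpha> x y * indicator {\<beta><..} \<alpha> * g y \<partial>lborel) \<partial>m)"
      unfolding tail_def by (intro nn_integral_cong nn_integral_multc[symmetric]) simp
    also have "\<dots> = (\<integral>\<^sup>+\<alpha>. (\<integral>\<^sup>+y. v \<alpha> x y * indicator {\<beta><..} \<alpha> * g y \<partial>m) \<partial>lborel)"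
      by (rule Fubini') measurable
    also have "\<dots> = tail (\<lambda>\<alpha>. \<integral>\<^sup>+y. v \<alpha> x y * g y \<partial>m) \<beta>"
      unfolding tail_def
      by (subst nn_integral_multc[symmetric]) (auto simp: mult_ac)
    finally show ?thesis .
  qed
  also have "\<dots> = tail (\<lambda>\<alpha>. tail (\<lambda>r. ennreal r * (ennreal (exp (- \<alpha> * r)) * p r)) 0) \<beta>"
    using \<beta> by (intro tail_cong double) simp
  also have "\<dots> = tail (\<lambda>r. tail (\<lambda>\<alpha>. ennreal r * p r * ennreal (exp (- \<alpha> * r))) \<beta>) 0"
  proof -
    have "tail (\<lambda>\<alpha>. tail (\<lambda>r. ennreal r * (ennreal (exp (- \<alpha> * r)) * p r)) 0) \<beta> =
      (\<integral>\<^sup>+\<alpha>. (\<integral>\<^sup>+r. ennreal r * (ennreal (exp (- \<alpha> * r)) * p r) * indicator {0<..} r * indicator {\<beta><..} \<alpha> \<partial>lborel) \<partial>lborel)"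
      unfolding tail_def by (intro nn_integral_cong nn_integral_multc[symmetric]) simp
    also have "\<dots> = (\<integral>\<^sup>+r. (\<integral>\<^sup>+\<alpha>. ennreal r * (ennreal (exp (- \<alpha> * r)) * p r) * indicator {0<..} r * indicator {\<beta><..} \<alpha> \<partial>lborel) \<partial>lborel)"
      by (rule lborel_pair.Fubini') measurable
    also have "\<dots> = tail (\<lambda>r. tail (\<lambda>\<alpha>. ennreal r * p r * ennreal (exp (- \<alpha> * r))) \<beta>) 0"
      unfolding tail_def by (subst nn_integral_multc[symmetric]) (auto simp: mult_ac)
    finally show ?thesis .
  qed
  also have "\<dots> = tail (\<lambda>r. ennreal (exp (- \<beta> * r)) * p r) 0"
  proof (intro tail_cong)
    fix r :: real assume r: "0 < r"
    then have "tail (\<lambda>\<alpha>. ennreal r * p r * ennreal (exp (- \<alpha> * r))) \<beta> = p r * (ennreal r * ennreal (exp (- \<beta> * r) / r))"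
      by (subst tail_mult_left) (use tail_exp[OF r] in \<open>auto simp: mult_ac\<close>)
    also have "ennreal r * ennreal (exp (- \<beta> * r) / r) = ennreal (exp (- \<beta> * r))"
      using r by (subst ennreal_mult[symmetric]) auto
    finally show "tail (\<lambda>\<alpha>. ennreal r * p r * ennreal (exp (- \<alpha> * r))) \<beta> = ennreal (exp (- \<beta> * r)) * p r"
      by (simp add: mult.commute)
  qed
  also have "\<dots> = (\<integral>\<^sup>+y. u \<beta> x y * g y \<partial>m)"
    unfolding p_def by (rule potential_max) (use \<beta> in auto)
  finally show "(\<integral>\<^sup>+y. u \<beta> x y * indicator B y \<partial>m) = (\<integral>\<^sup>+y. tail (\<lambda>\<alpha>. v \<alpha> x y) \<beta> * indicator B y \<partial>m)"
    by (simp add: g_def)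
next
  show "(\<lambda>y. tail (\<lambda>\<alpha>. v \<alpha> x y) \<beta>) \<in> borel_measurable borel"
    by (rule measurable_tail) measurable
qed (use \<beta> in measurable)

end

section \<open>The measures Q\<close>

text \<open>Equality on the sets of \<open>G\<close> says that the measures with densities \<open>a\<close> and \<open>b\<close> have the same restriction
to \<open>G\<close>.\<close>

lemma nn_integral_eq_if_set_integrals_eq:
  assumes G: "space G = space M" "sets G \<subseteq> sets M"
    and [measurable]: "a \<in> borel_measurable M" "b \<in> borel_measurable M"
    and eq: "\<And>A. A \<in> sets G \<Longrightarrow> (\<integral>\<^sup>+x. indicator A x * a x \<partial>M) = (\<integral>\<^sup>+x. indicator A x * b x \<partial>M)"
    and F: "F \<in> borel_measurable G"
  shows "(\<integral>\<^sup>+x. F x * a x \<partial>M) = (\<integral>\<^sup>+x. F x * b x \<partial>M)"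
proof -
  have sub: "subalgebra (density M c) G" for c using G by (simp add: subalgebra_def)
  have [measurable]: "F \<in> borel_measurable M"
    using measurable_from_subalg[OF _ F] G by (simp add: subalgebra_def)
  have "restr_to_subalg (density M a) G = restr_to_subalg (density M b) G"
  proof (rule measure_eqI)
    fix A assume "A \<in> sets (restr_to_subalg (density M a) G)"
    then have A: "A \<in> sets G" by (simp add: sets_restr_to_subalg[OF sub])
    then have [measurable]: "A \<in> sets M" using G by auto
    have "emeasure (density M c) A = (\<integral>\<^sup>+x. indicator A x * c x \<partial>M)" if [measurable]: "c \<in> borel_measurable M" for c
      by (simp add: emeasure_density mult.commute)
    then show "emeasure (restr_to_subalg (density M a) G) A = emeasure (restr_to_subalg (density M b) G) A"
      using A by (simp add: emeasure_restr_to_subalg[OF sub] eq)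
  qed (simp add: sets_restr_to_subalg[OF sub])
  then have "integral\<^sup>N (density M a) F = integral\<^sup>N (density M b) F"
    using nn_integral_subalgebra2[OF sub F] by metis
  then show ?thesis by (simp add: nn_integral_density mult.commute)
qed

text \<open>Through this law, identities between expectations on the path space become identities between measures
on \<open>S\<close>.\<close>

lemma nn_integral_distr_alive:
  assumes [measurable]: "W \<in> borel_measurable M" "X \<in> M \<rightarrow>\<^sub>M cemetery_borel" "f \<in> borel_measurable borel"
  shows "(\<integral>\<^sup>+x. f x \<partial>distr (density M (\<lambda>\<omega>. W \<omega> * ext0 (\<lambda>_. 1) (X \<omega>))) borel (\<lambda>\<omega>. the (X \<omega>))) =
    (\<integral>\<^sup>+\<omega>. W \<omega> * ext0 f (X \<omega>) \<partial>M)"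
proof -
  have "(\<integral>\<^sup>+x. f x \<partial>distr (density M (\<lambda>\<omega>. W \<omega> * ext0 (\<lambda>_. 1) (X \<omega>))) borel (\<lambda>\<omega>. the (X \<omega>))) =
      (\<integral>\<^sup>+\<omega>. f (the (X \<omega>)) \<partial>density M (\<lambda>\<omega>. W \<omega> * ext0 (\<lambda>_. 1) (X \<omega>)))"
    by (rule nn_integral_distr) measurable
  also have "\<dots> = (\<integral>\<^sup>+\<omega>. W \<omega> * ext0 (\<lambda>_. 1) (X \<omega>) * f (the (X \<omega>)) \<partial>M)"
    by (rule nn_integral_density) measurable
  also have "\<dots> = (\<integral>\<^sup>+\<omega>. W \<omega> * ext0 f (X \<omega>) \<partial>M)"
    by (intro nn_integral_cong) (auto simp: ext0_eq)
  finally show ?thesis .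
qed

text \<open>The Markov property is given for events. It extends to functions \<open>g\<close> of the state at time \<open>s + t\<close> by
\<open>nn_integral_mixture\<close> and then to functions \<open>F\<close> of the past by comparing densities on the past.\<close>

lemma markov_under_nn_integral:
  fixes M :: "(real \<Rightarrow> 'a::topological_space option) measure"
  assumes markov: "markov_under T K M" and M: "sets M = sets path_space"
    and T: "T \<subseteq> {0..}" "s \<in> T" "s + t \<in> T" "0 \<le> t"
    and K: "\<And>x. sets (K t x) = sets borel"
    and K_meas: "\<And>g. g \<in> borel_measurable borel \<Longrightarrow> (\<lambda>x. \<integral>\<^sup>+y. g y \<partial>K t x) \<in> borel_measurable borel"
    and F: "F \<in> borel_measurable (coord_space (T \<inter> {..s}))" and g: "g \<in> borel_measurable borel"
  shows "(\<integral>\<^sup>+\<omega>. F \<omega> * ext0 g (\<omega> (s + t)) \<partial>M) = (\<integral>\<^sup>+\<omega>. F \<omega> * ext0 (\<lambda>x. \<integral>\<^sup>+y. g y \<partial>K t x) (\<omega> s) \<partial>M)"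
proof -
  note [measurable_cong] = M
  have space_M: "space M = paths" using sets_eq_imp_space_eq[OF M] by simp
  have "(\<lambda>\<omega>. \<omega> r) \<in> M \<rightarrow>\<^sub>M cemetery_borel" if "r \<in> T" for r
    using measurable_coordinate[of r "{0..}"] that T(1) by (subst measurable_cong_sets[OF M refl]) auto
  note [measurable] = this[OF T(2)] this[OF T(3)]
  note [measurable_cong] = K
  note K_meas[measurable]
  have sub: "sets (coord_space (T \<inter> {..s})) \<subseteq> sets M"
    unfolding M using T(1) by (intro sets_coord_space_mono) auto
  have for_sets: "(\<integral>\<^sup>+\<omega>. indicator A \<omega> * ext0 g (\<omega> (s + t)) \<partial>M) =
      (\<integral>\<^sup>+\<omega>. indicator A \<omega> * ext0 (\<lambda>x. \<integral>\<^sup>+y. g y \<partial>K t x) (\<omega> s) \<partial>M)"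
    if A: "A \<in> sets (coord_space (T \<inter> {..s}))" for A
  proof -
    have A_M[measurable]: "A \<in> sets M" using A sub by auto
    define R where "R = distr (density M (\<lambda>\<omega>. indicator A \<omega> * ext0 (\<lambda>_. 1) (\<omega> (s + t)))) borel (\<lambda>\<omega>. the (\<omega> (s + t)))"
    have R: "(\<integral>\<^sup>+x. f x \<partial>R) = (\<integral>\<^sup>+\<omega>. indicator A \<omega> * ext0 f (\<omega> (s + t)) \<partial>M)"
      if "f \<in> borel_measurable borel" for f
      unfolding R_def by (rule nn_integral_distr_alive[OF _ _ that]) measurable
    have "(\<integral>\<^sup>+x. g x \<partial>R) =
        (\<integral>\<^sup>+\<omega>. indicator A \<omega> * ext0 (\<lambda>_. 1) (\<omega> s) * (\<integral>\<^sup>+y. g y \<partial>K t (the (\<omega> s))) \<partial>M)"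
    proof (rule nn_integral_mixture[where M = borel])
      fix B :: "'a set" assume B[measurable]: "B \<in> sets borel"
      have ev: "{\<omega> \<in> paths. \<omega> (s + t) \<in> Some ` B} \<in> sets M"
      proof -
        have "{\<omega> \<in> space M. \<omega> (s + t) \<in> Some ` B} \<in> sets M" by measurable
        then show ?thesis by (simp add: space_M)
      qed
      have "emeasure R B = (\<integral>\<^sup>+x. indicator B x \<partial>R)" by (simp add: R_def)
      also have "\<dots> = (\<integral>\<^sup>+\<omega>. indicator A \<omega> * ext0 (indicator B) (\<omega> (s + t)) \<partial>M)" by (rule R) measurable
      also have "\<dots> = (\<integral>\<^sup>+\<omega>. indicator (A \<inter> {\<omega> \<in> paths. \<omega> (s + t) \<in> Some ` B}) \<omega> \<partial>M)"
        by (intro nn_integral_cong) (auto simp: space_M ext0_def indicator_def split: option.split)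
      also have "\<dots> = emeasure M (A \<inter> {\<omega> \<in> paths. \<omega> (s + t) \<in> Some ` B})"
        using ev by (intro nn_integral_indicator) auto
      also have "\<dots> = (\<integral>\<^sup>+\<omega>\<in>A. ext0 (\<lambda>x. emeasure (K t x) B) (\<omega> s) \<partial>M)"
        using markov T A B unfolding markov_under_def by blast
      also have "\<dots> = (\<integral>\<^sup>+\<omega>. indicator A \<omega> * ext0 (\<lambda>_. 1) (\<omega> s) * emeasure (K t (the (\<omega> s))) B \<partial>M)"
        by (intro nn_integral_cong) (auto simp: ext0_eq mult.commute)
      finally show "emeasure R B = \<dots>" .
    next
      fix f :: "'a \<Rightarrow> ennreal" assume [measurable]: "f \<in> borel_measurable borel"
      show "(\<lambda>\<omega>. indicator A \<omega> * ext0 (\<lambda>_. 1) (\<omega> s) * (\<integral>\<^sup>+y. f y \<partial>K t (the (\<omega> s)))) \<in> borel_measurable M"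
        by measurable
    qed (simp_all add: R_def K g)
    also have "\<dots> = (\<integral>\<^sup>+\<omega>. indicator A \<omega> * ext0 (\<lambda>x. \<integral>\<^sup>+y. g y \<partial>K t x) (\<omega> s) \<partial>M)"
      by (intro nn_integral_cong) (auto simp: ext0_eq)
    finally show ?thesis unfolding R[OF g] .
  qed
  show ?thesis
  proof (rule nn_integral_eq_if_set_integrals_eq[OF _ sub _ _ for_sets F])
    show "(\<lambda>\<omega>. ext0 g (\<omega> (s + t))) \<in> borel_measurable M"
      "(\<lambda>\<omega>. ext0 (\<lambda>x. \<integral>\<^sup>+y. g y \<partial>K t x) (\<omega> s)) \<in> borel_measurable M"
      using g by measurable
  qed (auto simp: space_M)
qed

context process_with_potential_densities
begin

abbreviation (input) h :: "'a \<Rightarrow> 'a \<Rightarrow> ennreal" where "h z x \<equiv> u 0 x z"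

lemma h_cancel: "y \<noteq> z \<Longrightarrow> h z y * inverse (h z y) = 1"
  using u_pos[of 0 y z] u_off_diagonal[of y z] ennreal_divide_self[of "h z y"]
  by (simp add: divide_ennreal_def)

text \<open>All points are polar; in particular the singularity of \<open>h z\<close> at \<open>z\<close> is never seen at positive times.\<close>

lemma AE_Pt_neq:
  assumes t: "0 < t"
  shows "AE y in Pt t x. y \<noteq> z"
proof -
  have B: "{z} \<in> sets borel" by simp
  have "AE \<omega> in Px x. \<omega> t \<noteq> Some z" using points_polar[where x = x and y = z] t by (auto elim: eventually_mono)
  then have "AE \<omega> in Px x. \<not> (\<omega> t \<in> Some ` {z})" by simp
  then have "emeasure (Px x) {\<omega> \<in> space (Px x). \<omega> t \<in> Some ` {z}} = 0"
    using coordinate_event[of t "{0..}", OF _ B] t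
    by (subst AE_iff_measurable[symmetric, where P = "\<lambda>\<omega>. \<not> (\<omega> t \<in> Some ` {z})"]) (auto simp: sets_Px space_Px)
  then have "emeasure (Pt t x) {z} = 0"
    using emeasure_Pt_eq_Px[OF _ B, of t x] t by (simp add: space_Px)
  then show ?thesis using t by (intro AE_I[where N = "{z}"]) auto
qed

lemma nn_integral_h_semigroup:
  assumes [measurable]: "g \<in> borel_measurable borel" and t: "0 \<le> t"
  shows "(\<integral>\<^sup>+y. g y \<partial>h_semigroup Pt (u 0) z t x) =
    (\<integral>\<^sup>+y. indicator (- {z}) y * (h z y / h z x) * g y \<partial>Pt t x)"
proof -
  have [measurable_cong]: "sets (Pt t x) = sets borel" using t by simp
  show ?thesis unfolding h_semigroup_def by (rule nn_integral_density) measurable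
qed

text \<open>
Conjugating with \<open>h\<close> turns the transformed semigroup back into the original one. The factor \<open>h z y\<close>
cancels because it is finite and positive off the polar point \<open>z\<close>.\<close>

lemma nn_integral_h_semigroup_div:
  assumes [measurable]: "g \<in> borel_measurable borel" and t: "0 < t"
  shows "(\<integral>\<^sup>+y. g y / h z y \<partial>h_semigroup Pt (u 0) z t x) = (\<integral>\<^sup>+y. g y \<partial>Pt t x) / h z x"
proof -
  have "(\<integral>\<^sup>+y. g y / h z y \<partial>h_semigroup Pt (u 0) z t x) =
    (\<integral>\<^sup>+y. indicator (- {z}) y * (h z y / h z x) * (g y / h z y) \<partial>Pt t x)"
    using t by (intro nn_integral_h_semigroup) auto
  also have "\<dots> = (\<integral>\<^sup>+y. g y * inverse (h z x) \<partial>Pt t x)"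
  proof (rule nn_integral_cong_AE)
    show "AE y in Pt t x. indicator (- {z}) y * (h z y / h z x) * (g y / h z y) = g y * inverse (h z x)"
      using AE_Pt_neq[OF t]
    proof eventually_elim
      fix y assume y: "y \<noteq> z"
      have "indicator (- {z}) y * (h z y / h z x) * (g y / h z y) = (h z y * inverse (h z y)) * (g y * inverse (h z x))"
        using y by (simp add: divide_ennreal_def mult_ac)
      then show "indicator (- {z}) y * (h z y / h z x) * (g y / h z y) = g y * inverse (h z x)"
        using h_cancel[OF y] by simp
    qed
  qed
  also have "\<dots> = (\<integral>\<^sup>+y. g y \<partial>Pt t x) / h z x"
    using t by (simp add: nn_integral_multc divide_ennreal_def)
  finally show ?thesis .
qed

lemma measurable_h_semigroup:
  assumes [measurable]: "g \<in> borel_measurable borel" and t: "0 \<le> t"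
  shows "(\<lambda>x. \<integral>\<^sup>+y. g y \<partial>h_semigroup Pt (u 0) z t x) \<in> borel_measurable borel"
  unfolding nn_integral_h_semigroup[OF assms]
  using t by (intro measurable_nn_integral_Pt) auto

end

locale loop_bridges = process_with_potential_densities Pt Px m u
  for Pt :: "real \<Rightarrow> 'a::{t2_space,second_countable_topology} \<Rightarrow> 'a measure" and Px m u +
  fixes Q :: "'a \<Rightarrow> (real \<Rightarrow> 'a option) measure"
  assumes Q: "\<And>z. is_Qzz Pt (u 0) z (Q z)"
begin

lemma sets_Q[measurable_cong]: "sets (Q z) = sets path_space"
  using Q[of z] by (simp add: is_Qzz_def)

lemma space_Q: "space (Q z) = paths"
  using sets_eq_imp_space_eq[OF sets_Q] by simp

lemma start_Q: "AE \<omega> in Q z. \<omega> 0 = Some z \<and> 0 < lifetime \<omega>"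
  using Q[of z] unfolding is_Qzz_def by blast

lemma measurable_coordinate_Q: "0 \<le> t \<Longrightarrow> (\<lambda>\<omega>. \<omega> t) \<in> Q z \<rightarrow>\<^sub>M cemetery_borel"
  by (subst measurable_cong_sets[OF sets_Q refl]) (rule measurable_coordinate, simp)

lemma measurable_ext0_Q: "f \<in> borel_measurable borel \<Longrightarrow> 0 \<le> t \<Longrightarrow> (\<lambda>\<omega>. ext0 f (\<omega> t)) \<in> borel_measurable (Q z)"
  using measurable_compose[OF measurable_coordinate_Q measurable_ext0_fixed] .

lemma measurable_Q_past: "F \<in> borel_measurable (coord_space ({0<..} \<inter> {..t})) \<Longrightarrow> F \<in> borel_measurable (Q z)"
  by (subst measurable_cong_sets[OF sets_Q refl]) (rule measurable_coord_space_mono[of "{0<..} \<inter> {..t}"], auto)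

lemma entrance_Q:
  assumes t: "0 < t" and g[measurable]: "g \<in> borel_measurable borel"
  shows "(\<integral>\<^sup>+\<omega>. ext0 g (\<omega> t) \<partial>Q z) = (\<integral>\<^sup>+x. h z x * g x \<partial>Pt t z)"
proof -
  have [measurable]: "(\<lambda>\<omega>. \<omega> t) \<in> Q z \<rightarrow>\<^sub>M cemetery_borel" using t by (intro measurable_coordinate_Q) simp
  have [measurable_cong]: "sets (Pt t z) = sets borel" using t by simp
  define N where "N = distr (density (Q z) (\<lambda>\<omega>. 1 * ext0 (\<lambda>_. 1) (\<omega> t))) borel (\<lambda>\<omega>. the (\<omega> t))"
  have N: "(\<integral>\<^sup>+x. f x \<partial>N) = (\<integral>\<^sup>+\<omega>. ext0 f (\<omega> t) \<partial>Q z)" if "f \<in> borel_measurable borel" for f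
    unfolding N_def by (subst nn_integral_distr_alive[OF _ _ that]) simp_all
  have "N = entrance_law Pt (u 0) z t"
  proof (rule measure_eqI)
    show "sets N = sets (entrance_law Pt (u 0) z t)" using t by (simp add: N_def entrance_law_def)
    fix B assume "B \<in> sets N"
    then have B[measurable]: "B \<in> sets borel" by (simp add: N_def)
    have ev: "{\<omega> \<in> paths. \<omega> t \<in> Some ` B} \<in> sets (Q z)"
      unfolding sets_Q using t by (intro coordinate_event[OF _ B]) simp
    have "emeasure N B = (\<integral>\<^sup>+x. indicator B x \<partial>N)" by (simp add: N_def)
    also have "\<dots> = (\<integral>\<^sup>+\<omega>. ext0 (indicator B) (\<omega> t) \<partial>Q z)" by (rule N) measurable
    also have "\<dots> = (\<integral>\<^sup>+\<omega>. indicator {\<omega> \<in> paths. \<omega> t \<in> Some ` B} \<omega> \<partial>Q z)"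
      by (intro nn_integral_cong) (auto simp: space_Q ext0_def indicator_def split: option.split)
    also have "\<dots> = emeasure (Q z) {\<omega> \<in> paths. \<omega> t \<in> Some ` B}" using ev by simp
    also have "\<dots> = emeasure (entrance_law Pt (u 0) z t) B"
      using Q[of z] t B unfolding is_Qzz_def by blast
    finally show "emeasure N B = emeasure (entrance_law Pt (u 0) z t) B" .
  qed
  then have "(\<integral>\<^sup>+\<omega>. ext0 g (\<omega> t) \<partial>Q z) = (\<integral>\<^sup>+x. g x \<partial>entrance_law Pt (u 0) z t)" using N[OF g] by simp
  also have "\<dots> = (\<integral>\<^sup>+x. h z x * g x \<partial>Pt t z)" unfolding entrance_law_def by (rule nn_integral_density) measurable
  finally show ?thesis .
qed

lemma Q_not_start:
  assumes t: "0 < t"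
  shows "AE \<omega> in Q z. \<omega> t \<noteq> Some z"
proof -
  have [measurable]: "(\<lambda>\<omega>. \<omega> t) \<in> Q z \<rightarrow>\<^sub>M cemetery_borel" using t by (intro measurable_coordinate_Q) simp
  have "(\<integral>\<^sup>+\<omega>. ext0 (indicator {z}) (\<omega> t) \<partial>Q z) = (\<integral>\<^sup>+x. h z x * indicator {z} x \<partial>Pt t z)"
    by (rule entrance_Q[OF t]) measurable
  also have "\<dots> = (\<integral>\<^sup>+x. 0 \<partial>Pt t z)"
    using AE_Pt_neq[OF t, of z z] by (intro nn_integral_cong_AE) (auto elim: eventually_mono)
  finally have "(\<integral>\<^sup>+\<omega>. ext0 (indicator {z}) (\<omega> t) \<partial>Q z) = 0" by simp
  then have "AE \<omega> in Q z. ext0 (indicator {z} :: 'a \<Rightarrow> ennreal) (\<omega> t) = 0"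
    by (rule nn_integral_0_iff_AE[THEN iffD1, rotated]) measurable
  then show ?thesis by eventually_elim (auto simp: ext0_def)
qed

lemma entrance_div:
  assumes t: "0 < t" and [measurable]: "g \<in> borel_measurable borel"
  shows "(\<integral>\<^sup>+\<omega>. ext0 (\<lambda>x. g x / h z x) (\<omega> t) \<partial>Q z) = (\<integral>\<^sup>+x. g x \<partial>Pt t z)"
proof -
  have "(\<integral>\<^sup>+\<omega>. ext0 (\<lambda>x. g x / h z x) (\<omega> t) \<partial>Q z) = (\<integral>\<^sup>+x. h z x * (g x / h z x) \<partial>Pt t z)"
    by (rule entrance_Q[OF t]) measurable
  also have "\<dots> = (\<integral>\<^sup>+x. g x \<partial>Pt t z)"
  proof (rule nn_integral_cong_AE)
    show "AE x in Pt t z. h z x * (g x / h z x) = g x"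
      using AE_Pt_neq[OF t, of z z]
    proof eventually_elim
      fix x assume "x \<noteq> z"
      then show "h z x * (g x / h z x) = g x"
        using h_cancel[of x z] by (metis divide_ennreal_def mult.assoc mult.commute mult.right_neutral)
    qed
  qed
  finally show ?thesis .
qed

lemma markov_Q:
  assumes s: "0 < s" "0 \<le> t" and F: "F \<in> borel_measurable (coord_space ({0<..} \<inter> {..s}))"
    and g: "g \<in> borel_measurable borel"
  shows "(\<integral>\<^sup>+\<omega>. F \<omega> * ext0 g (\<omega> (s + t)) \<partial>Q z) =
    (\<integral>\<^sup>+\<omega>. F \<omega> * ext0 (\<lambda>x. \<integral>\<^sup>+y. g y \<partial>h_semigroup Pt (u 0) z t x) (\<omega> s) \<partial>Q z)"
proof (rule markov_under_nn_integral[where T = "{0<..}"])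
  show "markov_under {0<..} (h_semigroup Pt (u 0) z) (Q z)" using Q[of z] unfolding is_Qzz_def by blast
  show "sets (Q z) = sets path_space" by (rule sets_Q)
  show "sets (h_semigroup Pt (u 0) z t x) = sets borel" for x using s by (simp add: h_semigroup_def)
qed (use s F g in \<open>auto intro: measurable_h_semigroup\<close>)

text \<open>On functions of the form \<open>g / h\<close> the transformed process behaves like the original semigroup; in
this form the transform drops out of the computation of occupation times.\<close>

lemma markov_div:
  assumes s: "0 < s" "s < t" and F: "F \<in> borel_measurable (coord_space ({0<..} \<inter> {..s}))"
    and [measurable]: "g \<in> borel_measurable borel"
  shows "(\<integral>\<^sup>+\<omega>. F \<omega> * ext0 (\<lambda>x. g x / h z x) (\<omega> t) \<partial>Q z) =
    (\<integral>\<^sup>+\<omega>. F \<omega> * ext0 (\<lambda>x. (\<integral>\<^sup>+y. g y \<partial>Pt (t - s) x) / h z x) (\<omega> s) \<partial>Q z)"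
  using markov_Q[of s "t - s" F "\<lambda>x. g x / h z x" z] s F
  by (simp add: nn_integral_h_semigroup_div)

text \<open>At time \<open>t\<close>, the path has density \<open>h z\<close> with respect to \<open>P\<^sub>t(z, \<cdot>)\<close> under \<open>Q z\<close>, which may have infinite mass since
\<open>h z\<close> is unbounded. On these events the density is at most \<open>n\<close>, so that they have finite mass.\<close>

definition moderate :: "real \<Rightarrow> nat \<Rightarrow> 'a \<Rightarrow> (real \<Rightarrow> 'a option) set" where
  "moderate t n z = {\<omega> \<in> paths. \<omega> t \<in> Some ` {x. x \<noteq> z \<and> h z x \<le> of_nat n}}"

lemma borel_level_set[measurable]: "{x. x \<noteq> z \<and> h z x \<le> of_nat n} \<in> sets borel"
proof -
  have "{x \<in> space borel. x \<noteq> z \<and> h z x \<le> of_nat n} \<in> sets borel" by measurable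
  then show ?thesis by simp
qed

lemma moderate_in_coord_space: "t \<in> T \<Longrightarrow> moderate t n z \<in> sets (coord_space T)"
  unfolding moderate_def by (intro coordinate_event borel_level_set)

lemma moderate_in_Q: "0 \<le> t \<Longrightarrow> moderate t n z \<in> sets (Q z)"
  unfolding sets_Q by (intro moderate_in_coord_space) simp

lemma emeasure_moderate:
  assumes t: "0 < t"
  shows "emeasure (Q z) (moderate t n z) < \<infinity>"
proof -
  interpret P: subprob_space "Pt t z" using t by (intro subprob_Pt) simp
  have "emeasure (Q z) (moderate t n z) = (\<integral>\<^sup>+\<omega>. indicator (moderate t n z) \<omega> \<partial>Q z)"
    using t moderate_in_Q by simp
  also have "\<dots> = (\<integral>\<^sup>+\<omega>. ext0 (indicator {x. x \<noteq> z \<and> h z x \<le> of_nat n}) (\<omega> t) \<partial>Q z)"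
    by (intro nn_integral_cong) (auto simp: moderate_def space_Q ext0_def indicator_def split: option.split)
  also have "\<dots> = (\<integral>\<^sup>+x. h z x * indicator {x. x \<noteq> z \<and> h z x \<le> of_nat n} x \<partial>Pt t z)"
    using t by (intro entrance_Q) auto
  also have "\<dots> \<le> (\<integral>\<^sup>+x. of_nat n \<partial>Pt t z)"
    by (intro nn_integral_mono) (auto simp: indicator_def)
  also have "\<dots> < \<infinity>" using P.emeasure_finite t by (simp add: ennreal_mult_eq_top_iff less_top[symmetric])
  finally show ?thesis .
qed

lemma ex_moderate:
  assumes "\<omega> \<in> paths" "\<omega> t \<noteq> None" "\<omega> t \<noteq> Some z"
  shows "\<exists>n. \<omega> \<in> moderate t n z"
proof -
  obtain x where x: "\<omega> t = Some x" "x \<noteq> z" using assms by auto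
  then have "h z x < \<infinity>" by (intro u_off_diagonal)
  then obtain n :: nat where "h z x \<le> of_nat n"
    using ennreal_Ex_less_of_nat less_imp_le by (metis infinity_ennreal_def)
  then show ?thesis using x assms by (auto simp: moderate_def)
qed

text \<open>Almost every path is alive at some time \<open>1 / (i + 1)\<close>, and then it is away from \<open>z\<close>, where \<open>h z\<close> is
finite. Fubini's theorem for times and paths rests on this.\<close>

lemma sigma_finite_Q: "sigma_finite_measure (Q z)"
proof
  define D where "D i n = moderate (1 / Suc i) n z" for i n :: nat
  have D: "D i n \<in> sets (Q z)" for i n unfolding D_def by (intro moderate_in_Q) simp
  have fin: "emeasure (Q z) (D i n) \<noteq> \<infinity>" for i n
    using emeasure_moderate[of "1 / Suc i" z n] by (simp add: D_def)
  define N where "N = paths - (\<Union>i n. D i n)"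
  have N: "N \<in> sets (Q z)"
    unfolding N_def using D sets.top[of "Q z"] by (auto simp: space_Q)
  have "AE \<omega> in Q z. \<forall>i. \<omega> (1 / Suc i) \<noteq> Some z" by (subst AE_all_countable) (auto intro!: Q_not_start)
  then have "AE \<omega> in Q z. \<omega> \<notin> N"
    using start_Q[of z] AE_space[of "Q z"]
  proof eventually_elim
    case (elim \<omega>)
    have \<omega>: "\<omega> \<in> paths" using elim by (simp add: space_Q)
    obtain i where "\<omega> (1 / Suc i) \<noteq> None" using alive_early[OF \<omega>] elim by blast
    then obtain n where "\<omega> \<in> D i n" using ex_moderate[OF \<omega>] elim unfolding D_def by metis
    then show ?case by (auto simp: N_def)
  qed
  then have "emeasure (Q z) N = 0"
    using N by (subst (asm) AE_iff_measurable[OF N]) (auto simp: space_Q N_def)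
  then have N_fin: "emeasure (Q z) N \<noteq> \<infinity>" by simp
  show "\<exists>A. countable A \<and> A \<subseteq> sets (Q z) \<and> \<Union>A = space (Q z) \<and> (\<forall>a\<in>A. emeasure (Q z) a \<noteq> \<infinity>)"
  proof (intro exI conjI)
    let ?A = "insert N (\<Union>i. range (D i))"
    show "countable ?A" by (intro countable_insert countable_UN countable_image) auto
    show "?A \<subseteq> sets (Q z)" using D N by blast
    show "\<forall>a\<in>?A. emeasure (Q z) a \<noteq> \<infinity>" using fin N_fin by blast
    have "D i n \<subseteq> paths" for i n by (auto simp: D_def moderate_def)
    then have sub: "(\<Union>i n. D i n) \<subseteq> paths" by (intro UN_least)
    have "\<Union>?A = N \<union> (\<Union>i n. D i n)" by (auto simp only: Union_insert UN_iff Union_iff Un_iff)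
    also have "\<dots> = paths" unfolding N_def using sub by (rule Diff_partition[THEN trans[OF Un_commute]])
    finally show "\<Union>?A = space (Q z)" by (simp only: space_Q)
  qed
qed

end

section \<open>Occupation times under Q\<close>

text \<open>For \<open>p = [j\<^sub>1, \<dots>, j\<^sub>n]\<close> this is
\<open>\<integral> g(x, y\<^sub>1) f\<^bsub>j1\<^esub>(y\<^sub>1) g(y\<^sub>1, y\<^sub>2) \<dots> f\<^bsub>jn\<^esub>(y\<^sub>n) g(y\<^sub>n, z) dm(y\<^sub>1) \<dots> dm(y\<^sub>n)\<close>, the kernel of an
alternating product of the operator \<open>g\<close> and multiplications.\<close>

primrec chain :: "'a measure \<Rightarrow> ('a \<Rightarrow> 'a \<Rightarrow> ennreal) \<Rightarrow> ('i \<Rightarrow> 'a \<Rightarrow> ennreal) \<Rightarrow> 'i list \<Rightarrow> 'a \<Rightarrow> 'a \<Rightarrow> ennreal" where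
  "chain m g f [] = g"
| "chain m g f (j # p) = (\<lambda>x z. \<integral>\<^sup>+y. g x y * (f j y * chain m g f p y z) \<partial>m)"

lemma sum_permutations_of_set_Cons:
  assumes "finite J" "J \<noteq> {}"
  shows "(\<Sum>p\<in>permutations_of_set J. F p) = (\<Sum>j\<in>J. \<Sum>p\<in>permutations_of_set (J - {j}). F (j # p))"
proof -
  have "(\<Sum>p\<in>permutations_of_set J. F p) =
      (\<Sum>p\<in>(\<Union>j\<in>J. (#) j ` permutations_of_set (J - {j})). F p)"
    using assms by (subst permutations_of_set_nonempty) auto
  also have "\<dots> = (\<Sum>j\<in>J. \<Sum>p\<in>(#) j ` permutations_of_set (J - {j}). F p)"
    using assms by (intro sum.UNION_disjoint) auto
  also have "\<dots> = (\<Sum>j\<in>J. \<Sum>p\<in>permutations_of_set (J - {j}). F (j # p))"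
    by (simp add: sum.reindex)
  finally show ?thesis .
qed

context process_with_potential_densities
begin

lemma measurable_chain_pair:
  assumes g[measurable]: "(\<lambda>(x, y). g x y) \<in> borel_measurable (borel \<Otimes>\<^sub>M (borel :: 'a measure))"
    and f[measurable]: "\<And>j. f j \<in> borel_measurable borel"
  shows "(\<lambda>(x, z). chain m g f p x z) \<in> borel_measurable (borel \<Otimes>\<^sub>M borel)"
proof (induction p)
  case Nil
  then show ?case using g by simp
next
  case (Cons j p)
  note Cons[measurable]
  show ?case by simp
qed

lemma measurable_chain[measurable (raw)]:
  assumes "(\<lambda>(x, y). g x y) \<in> borel_measurable (borel \<Otimes>\<^sub>M (borel :: 'a measure))"
    and "\<And>j. f j \<in> borel_measurable borel"
    and [measurable]: "X \<in> N \<rightarrow>\<^sub>M borel" "Z \<in> N \<rightarrow>\<^sub>M borel"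
  shows "(\<lambda>w. chain m g f p (X w) (Z w)) \<in> borel_measurable N"
  using measurable_compose[OF _ measurable_chain_pair[OF assms(1,2)], of "\<lambda>w. (X w, Z w)" N] by simp

end

context loop_bridges
begin

lemma evaluation[measurable]: "(\<lambda>p. snd p (max 0 (fst p))) \<in> borel \<Otimes>\<^sub>M path_space \<rightarrow>\<^sub>M (cemetery_borel :: 'a option measure)"
  using measurable_evaluation[OF locally_compact] by (simp add: case_prod_unfold)

lemma measurable_occupation:
  assumes [measurable]: "f \<in> borel_measurable borel"
  shows "(\<lambda>p. tail (\<lambda>s. ext0 f (snd p s)) (max 0 (fst p))) \<in> borel_measurable (borel \<Otimes>\<^sub>M \<Omega>)"
  by (rule measurable_tail_path[OF locally_compact, where g = "\<lambda>_ _. ext0 f"]) auto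

lemma measurable_occupation_fixed:
  assumes "f \<in> borel_measurable borel" "0 \<le> t"
  shows "(\<lambda>\<omega>. tail (\<lambda>s. ext0 f (\<omega> s)) t) \<in> borel_measurable \<Omega>"
proof -
  have "(\<lambda>\<omega>. (\<lambda>p. tail (\<lambda>s. ext0 f (snd p s)) (max 0 (fst p))) (t, \<omega>)) \<in> borel_measurable \<Omega>"
    by (rule measurable_compose[OF _ measurable_occupation[OF assms(1)]]) measurable
  then show ?thesis using assms by simp
qed

lemma measurable_killing_weight_fixed[measurable]: "killing_weight \<alpha> \<in> borel_measurable \<Omega>"
  using measurable_compose[OF measurable_Pair1' measurable_killing_weight[OF locally_compact], of \<alpha>] by simp

lemma nn_integral_tail_Q:
  assumes t: "0 \<le> t"
    and H[measurable]: "(\<lambda>p. H (max 0 (fst p)) (snd p)) \<in> borel_measurable (borel \<Otimes>\<^sub>M \<Omega>)"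
  shows "(\<integral>\<^sup>+\<omega>. tail (\<lambda>s. H s \<omega>) t \<partial>Q z) = tail (\<lambda>s. \<integral>\<^sup>+\<omega>. H s \<omega> \<partial>Q z) t"
proof -
  interpret Q: sigma_finite_measure "Q z" by (rule sigma_finite_Q)
  interpret pair_sigma_finite lborel "Q z" by standard
  have mx: "tail (\<lambda>s. a s) t = tail (\<lambda>s. a (max 0 s)) t" for a
    using t by (intro tail_cong) auto
  have [measurable]: "(\<lambda>(s, \<omega>). H (max 0 s) \<omega>) \<in> borel_measurable (lborel \<Otimes>\<^sub>M Q z)"
    using H unfolding case_prod_unfold by (simp cong: measurable_cong_sets sets_pair_measure_cong add: sets_Q)
  have sec: "(\<lambda>\<omega>. H (max 0 s) \<omega>) \<in> borel_measurable (Q z)" for s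
    using measurable_compose[OF measurable_Pair1'[of s lborel "Q z"], of "\<lambda>(s, \<omega>). H (max 0 s) \<omega>" borel] by simp
  have "(\<integral>\<^sup>+\<omega>. tail (\<lambda>s. H s \<omega>) t \<partial>Q z) = (\<integral>\<^sup>+\<omega>. (\<integral>\<^sup>+s. H (max 0 s) \<omega> * indicator {t<..} s \<partial>lborel) \<partial>Q z)"
    by (subst mx) (simp add: tail_def)
  also have "\<dots> = (\<integral>\<^sup>+s. (\<integral>\<^sup>+\<omega>. H (max 0 s) \<omega> * indicator {t<..} s \<partial>Q z) \<partial>lborel)"
    by (rule Fubini') measurable
  also have "\<dots> = tail (\<lambda>s. \<integral>\<^sup>+\<omega>. H (max 0 s) \<omega> \<partial>Q z) t"
    unfolding tail_def by (intro nn_integral_cong nn_integral_multc sec)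
  also have "\<dots> = tail (\<lambda>s. \<integral>\<^sup>+\<omega>. H s \<omega> \<partial>Q z) t"
    by (subst mx) simp
  finally show ?thesis .
qed

lemma measurable_past_snd[measurable (raw)]:
  "F \<in> borel_measurable (coord_space ({0<..} \<inter> {..t})) \<Longrightarrow>
    (\<lambda>p. F (snd p)) \<in> borel_measurable (borel \<Otimes>\<^sub>M \<Omega>)"
  by (rule measurable_compose[OF measurable_snd]) (rule measurable_coord_space_mono[of "{0<..} \<inter> {..t}"], auto)

lemma measurable_coordinate_snd:
  "0 \<le> t \<Longrightarrow> (\<lambda>p. snd p t) \<in> borel \<Otimes>\<^sub>M \<Omega> \<rightarrow>\<^sub>M cemetery_borel"
  by (rule measurable_compose[OF measurable_snd measurable_coordinate]) simp

text \<open>For \<open>s > t\<close> the Markov property at time \<open>t\<close> contributes \<open>P\<^bsub>s-t\<^esub> g\<close>; the weights \<open>exp (- \<alpha> s)\<close> sum these up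
to the \<open>\<alpha>\<close>-potential of \<open>g\<close> and leave the factor \<open>exp (- \<alpha> t)\<close>.\<close>

lemma discounted_potential_Q:
  assumes \<alpha>: "0 \<le> \<alpha>" and t: "0 < t"
    and F: "F \<in> borel_measurable (coord_space ({0<..} \<inter> {..t}))"
    and g[measurable]: "g \<in> borel_measurable borel"
  shows "tail (\<lambda>s. ennreal (exp (- \<alpha> * s)) * (\<integral>\<^sup>+\<omega>. F \<omega> * ext0 (\<lambda>x. g x / u 0 x z) (\<omega> s) \<partial>Q z)) t =
    ennreal (exp (- \<alpha> * t)) * (\<integral>\<^sup>+\<omega>. F \<omega> * ext0 (\<lambda>x. (\<integral>\<^sup>+y. u \<alpha> x y * g y \<partial>m) / u 0 x z) (\<omega> t) \<partial>Q z)"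
proof -
  note measurable_past_snd[OF F, measurable] measurable_Q_past[OF F, measurable]
  have [measurable]: "(\<lambda>p. snd p t) \<in> borel \<Otimes>\<^sub>M \<Omega> \<rightarrow>\<^sub>M cemetery_borel"
    "(\<lambda>\<omega>. \<omega> t) \<in> Q z \<rightarrow>\<^sub>M cemetery_borel"
    using t by (auto intro: measurable_coordinate_snd measurable_coordinate_Q)
  define P where "P s x = (\<integral>\<^sup>+y. g y \<partial>Pt (max 0 s) x)" for s x
  have [measurable]: "(\<lambda>(s, x). P s x) \<in> borel_measurable (borel \<Otimes>\<^sub>M borel)"
    unfolding P_def case_prod_unfold by (rule measurable_nn_integral_Pt) auto
  let ?e = "\<lambda>s. ennreal (exp (- \<alpha> * s))"
  let ?R = "\<lambda>s \<omega>. ?e s * (F \<omega> * ext0 (\<lambda>x. P (s - t) x / u 0 x z) (\<omega> t))"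
  have H: "(\<lambda>p. ?R (max 0 (fst p)) (snd p)) \<in> borel_measurable (borel \<Otimes>\<^sub>M \<Omega>)"
  proof -
    have "(\<lambda>p. ext0 ((\<lambda>p x. P (max 0 (fst p) - t) x / u 0 x z) p) (snd p t)) \<in>
      borel_measurable (borel \<Otimes>\<^sub>M \<Omega>)"
      by (rule measurable_ext0) (unfold case_prod_unfold, measurable)
    then show ?thesis by measurable
  qed
  have "tail (\<lambda>s. ?e s * (\<integral>\<^sup>+\<omega>. F \<omega> * ext0 (\<lambda>x. g x / u 0 x z) (\<omega> s) \<partial>Q z)) t =
      tail (\<lambda>s. \<integral>\<^sup>+\<omega>. ?R s \<omega> \<partial>Q z) t"
  proof (rule tail_cong)
    fix s assume s: "t < s"
    have "(\<integral>\<^sup>+\<omega>. F \<omega> * ext0 (\<lambda>x. g x / u 0 x z) (\<omega> s) \<partial>Q z) =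
        (\<integral>\<^sup>+\<omega>. F \<omega> * ext0 (\<lambda>x. P (s - t) x / u 0 x z) (\<omega> t) \<partial>Q z)"
      using markov_div[OF t s F g] s by (simp add: P_def)
    then show "?e s * (\<integral>\<^sup>+\<omega>. F \<omega> * ext0 (\<lambda>x. g x / u 0 x z) (\<omega> s) \<partial>Q z) = (\<integral>\<^sup>+\<omega>. ?R s \<omega> \<partial>Q z)"
      by (simp add: nn_integral_cmult)
  qed
  also have "\<dots> = (\<integral>\<^sup>+\<omega>. tail (\<lambda>s. ?R s \<omega>) t \<partial>Q z)"
    using t by (intro nn_integral_tail_Q[symmetric] H) simp
  also have "\<dots> = (\<integral>\<^sup>+\<omega>. ?e t * (F \<omega> * ext0 (\<lambda>x. (\<integral>\<^sup>+y. u \<alpha> x y * g y \<partial>m) / u 0 x z) (\<omega> t)) \<partial>Q z)"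
  proof (rule nn_integral_cong)
    fix \<omega>
    show "tail (\<lambda>s. ?R s \<omega>) t = ?e t * (F \<omega> * ext0 (\<lambda>x. (\<integral>\<^sup>+y. u \<alpha> x y * g y \<partial>m) / u 0 x z) (\<omega> t))"
    proof (cases "\<omega> t")
      case None
      then show ?thesis by (simp add: ext0_def tail_def)
    next
      case (Some x)
      have "tail (\<lambda>s. ?R s \<omega>) t = tail (\<lambda>s. (F \<omega> * inverse (u 0 x z)) * (?e s * P (s - t) x)) t"
        using Some by (intro tail_cong) (simp add: ext0_def divide_ennreal_def mult_ac)
      also have "\<dots> = (F \<omega> * inverse (u 0 x z)) * tail (\<lambda>s. ?e s * P (s - t) x) t"
        by (rule tail_mult_left) measurable
      also have "tail (\<lambda>s. ?e s * P (s - t) x) t = tail (\<lambda>s. ?e (t + s) * P s x) 0"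
        using tail_shift[of "\<lambda>s. ?e s * P (s - t) x" 0 t] by simp
      also have "\<dots> = tail (\<lambda>s. ?e t * (?e s * P s x)) 0"
        by (intro tail_cong) (simp add: mult.assoc[symmetric] ennreal_mult[symmetric] exp_add[symmetric] distrib_left)
      also have "\<dots> = ?e t * (\<integral>\<^sup>+y. u \<alpha> x y * g y \<partial>m)"
        unfolding potential_max[OF g \<alpha>, symmetric] P_def[symmetric] by (rule tail_mult_left) measurable
      finally show ?thesis using Some by (simp add: ext0_def divide_ennreal_def mult_ac)
    qed
  qed
  also have "\<dots> = ?e t * (\<integral>\<^sup>+\<omega>. F \<omega> * ext0 (\<lambda>x. (\<integral>\<^sup>+y. u \<alpha> x y * g y \<partial>m) / u 0 x z) (\<omega> t) \<partial>Q z)"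
    using \<alpha> by (intro nn_integral_cmult) measurable
  finally show ?thesis .
qed

lemma discounted_entrance_Q:
  assumes \<alpha>: "0 \<le> \<alpha>" and g[measurable]: "g \<in> borel_measurable borel"
  shows "tail (\<lambda>s. ennreal (exp (- \<alpha> * s)) * (\<integral>\<^sup>+\<omega>. ext0 (\<lambda>x. g x / u 0 x z) (\<omega> s) \<partial>Q z)) 0 = (\<integral>\<^sup>+y. u \<alpha> z y * g y \<partial>m)"
  unfolding potential[OF g \<alpha>, symmetric]
  by (intro tail_cong) (simp add: entrance_div)

text \<open>The resolvent equation divided by \<open>h\<close>. For the transformed process started at \<open>x\<close>, the summands are the
probabilities of dying before and of surviving an independent exponential time of rate \<open>\<alpha>\<close>.\<close>

lemma u_quotient_split:
  assumes \<alpha>: "0 \<le> \<alpha>" and x: "x \<noteq> z"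
  shows "u \<alpha> x z / u 0 x z + ennreal \<alpha> * ((\<integral>\<^sup>+y. u \<alpha> x y * u 0 y z \<partial>m) / u 0 x z) = 1"
proof -
  have "u 0 x z = u \<alpha> x z + ennreal \<alpha> * (\<integral>\<^sup>+y. u \<alpha> x y * u 0 y z \<partial>m)"
    using resolvent2[of 0 \<alpha> x z] \<alpha> by simp
  then have "u 0 x z * inverse (u 0 x z) =
      u \<alpha> x z * inverse (u 0 x z) + ennreal \<alpha> * (\<integral>\<^sup>+y. u \<alpha> x y * u 0 y z \<partial>m) * inverse (u 0 x z)"
    by (metis distrib_right)
  then show ?thesis using h_cancel[OF x] by (simp add: divide_ennreal_def mult.assoc)
qed

text \<open>Being alive at time \<open>s\<close> is the function \<open>1 = h / h\<close> of the state, so that \<open>discounted_potential_Q\<close> with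
\<open>g = h\<close> applies.\<close>

lemma survival_Q:
  assumes \<alpha>: "0 < \<alpha>" and t: "0 < t"
    and F: "F \<in> borel_measurable (coord_space ({0<..} \<inter> {..t}))"
  shows "(\<integral>\<^sup>+\<omega>. F \<omega> * tail (\<lambda>s. ennreal (\<alpha> * exp (- \<alpha> * s)) * ext0 (\<lambda>_. 1) (\<omega> s)) t \<partial>Q z) =
    (\<integral>\<^sup>+\<omega>. F \<omega> * (ennreal (exp (- \<alpha> * t)) *
      ext0 (\<lambda>x. ennreal \<alpha> * ((\<integral>\<^sup>+y. u \<alpha> x y * u 0 y z \<partial>m) / u 0 x z)) (\<omega> t)) \<partial>Q z)"
proof -
  let ?c = "ennreal (exp (- \<alpha> * t))"
  let ?S = "\<lambda>\<omega>. tail (\<lambda>s. ennreal (\<alpha> * exp (- \<alpha> * s)) * ext0 (\<lambda>_. 1) (\<omega> s)) t"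
  let ?b = "\<lambda>x. (\<integral>\<^sup>+y. u \<alpha> x y * u 0 y z \<partial>m) / u 0 x z"
  have \<alpha>0: "0 \<le> \<alpha>" using \<alpha> by simp
  note [measurable] = measurable_Q_past[OF F] measurable_past_snd[OF F] \<alpha>0
  have [measurable]: "(\<lambda>\<omega>. \<omega> t) \<in> Q z \<rightarrow>\<^sub>M cemetery_borel" using t by (intro measurable_coordinate_Q) simp
  have S_tail: "(\<lambda>p. ennreal (\<alpha> * exp (- \<alpha> * max 0 (fst p))) * (F (snd p) * ext0 (\<lambda>_. 1) (snd p (max 0 (fst p)))))
    \<in> borel_measurable (borel \<Otimes>\<^sub>M \<Omega>)"
    by measurable
  have "(\<integral>\<^sup>+\<omega>. F \<omega> * ?S \<omega> \<partial>Q z) =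
      (\<integral>\<^sup>+\<omega>. tail (\<lambda>s. ennreal (\<alpha> * exp (- \<alpha> * s)) * (F \<omega> * ext0 (\<lambda>_. 1) (\<omega> s))) t \<partial>Q z)"
  proof (rule nn_integral_cong)
    fix \<omega> assume "\<omega> \<in> space (Q z)"
    then have [measurable]: "(\<lambda>s. \<omega> (max 0 s)) \<in> borel \<rightarrow>\<^sub>M cemetery_borel"
      by (intro measurable_path locally_compact) (simp add: space_Q)
    have mx: "tail (\<lambda>s. a s (\<omega> s)) t = tail (\<lambda>s. a s (\<omega> (max 0 s))) t" for a
      using t by (intro tail_cong) auto
    have "F \<omega> * ?S \<omega> = F \<omega> * tail (\<lambda>s. ennreal (\<alpha> * exp (- \<alpha> * s)) * ext0 (\<lambda>_. 1) (\<omega> (max 0 s))) t"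
      by (subst mx) simp
    also have "\<dots> = tail (\<lambda>s. F \<omega> * (ennreal (\<alpha> * exp (- \<alpha> * s)) * ext0 (\<lambda>_. 1) (\<omega> (max 0 s)))) t"
      by (rule tail_mult_left[symmetric]) measurable
    also have "\<dots> = tail (\<lambda>s. ennreal (\<alpha> * exp (- \<alpha> * s)) * (F \<omega> * ext0 (\<lambda>_. 1) (\<omega> s))) t"
      by (subst mx) (simp add: mult_ac)
    finally show "F \<omega> * ?S \<omega> = tail (\<lambda>s. ennreal (\<alpha> * exp (- \<alpha> * s)) * (F \<omega> * ext0 (\<lambda>_. 1) (\<omega> s))) t" .
  qed
  also have "\<dots> = tail (\<lambda>s. \<integral>\<^sup>+\<omega>. ennreal (\<alpha> * exp (- \<alpha> * s)) * (F \<omega> * ext0 (\<lambda>_. 1) (\<omega> s)) \<partial>Q z) t"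
    using t by (intro nn_integral_tail_Q S_tail) simp
  also have "\<dots> = tail (\<lambda>s. ennreal (exp (- \<alpha> * s)) * (\<integral>\<^sup>+\<omega>. (ennreal \<alpha> * F \<omega>) * ext0 (\<lambda>x. u 0 x z / u 0 x z) (\<omega> s) \<partial>Q z)) t"
  proof (rule tail_cong)
    fix s assume s: "t < s"
    then have s0: "0 < s" using t by simp
    have [measurable]: "(\<lambda>\<omega>. \<omega> s) \<in> Q z \<rightarrow>\<^sub>M cemetery_borel" using s0 by (intro measurable_coordinate_Q) simp
    have "(\<integral>\<^sup>+\<omega>. ennreal (\<alpha> * exp (- \<alpha> * s)) * (F \<omega> * ext0 (\<lambda>_. 1) (\<omega> s)) \<partial>Q z) =
        (\<integral>\<^sup>+\<omega>. ennreal (exp (- \<alpha> * s)) * ((ennreal \<alpha> * F \<omega>) * ext0 (\<lambda>x. u 0 x z / u 0 x z) (\<omega> s)) \<partial>Q z)"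
    proof (rule nn_integral_cong_AE)
      show "AE \<omega> in Q z. ennreal (\<alpha> * exp (- \<alpha> * s)) * (F \<omega> * ext0 (\<lambda>_. 1) (\<omega> s)) =
        ennreal (exp (- \<alpha> * s)) * ((ennreal \<alpha> * F \<omega>) * ext0 (\<lambda>x. u 0 x z / u 0 x z) (\<omega> s))"
        using Q_not_start[OF s0]
      proof eventually_elim
        case (elim \<omega>)
        then have "ext0 (\<lambda>_. 1) (\<omega> s) = ext0 (\<lambda>x. u 0 x z / u 0 x z) (\<omega> s)"
          using h_cancel[of _ z] by (auto simp: ext0_def divide_ennreal_def split: option.split)
        then show ?case using \<alpha> by (simp add: ennreal_mult mult_ac)
      qed
    qed
    then show "(\<integral>\<^sup>+\<omega>. ennreal (\<alpha> * exp (- \<alpha> * s)) * (F \<omega> * ext0 (\<lambda>_. 1) (\<omega> s)) \<partial>Q z) =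
        ennreal (exp (- \<alpha> * s)) * (\<integral>\<^sup>+\<omega>. (ennreal \<alpha> * F \<omega>) * ext0 (\<lambda>x. u 0 x z / u 0 x z) (\<omega> s) \<partial>Q z)"
      by (simp add: nn_integral_cmult)
  qed
  also have "\<dots> = ?c * (\<integral>\<^sup>+\<omega>. (ennreal \<alpha> * F \<omega>) * ext0 ?b (\<omega> t) \<partial>Q z)"
    using F \<alpha> t by (intro discounted_potential_Q) auto
  also have "\<dots> = (\<integral>\<^sup>+\<omega>. ?c * ((ennreal \<alpha> * F \<omega>) * ext0 ?b (\<omega> t)) \<partial>Q z)"
    by (rule nn_integral_cmult[symmetric]) measurable
  also have "\<dots> = (\<integral>\<^sup>+\<omega>. F \<omega> * (?c * ext0 (\<lambda>x. ennreal \<alpha> * ?b x) (\<omega> t)) \<partial>Q z)"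
    by (intro nn_integral_cong) (auto simp: ext0_eq mult_ac)
  finally show ?thesis .
qed

text \<open>Conditionally on the past of \<open>t\<close>, the expectation of \<open>exp (- \<alpha> \<zeta>)\<close> is \<open>exp (- \<alpha> t) u\<^sup>\<alpha>(x, z) / u(x, z)\<close>
for \<open>x = X\<^sub>t\<close>: the complementary weight \<open>\<alpha> \<integral> exp (- \<alpha> s) ds\<close> of the times \<open>s > t\<close> before death is given by
\<open>survival_Q\<close>, and both add up as in \<open>u_quotient_split\<close>. Subtracting the complementary part
requires finite mass, so the identity is first proved on the events \<open>D n\<close> and then extended
monotonically.\<close>

lemma killing_weight_Q:
  assumes \<alpha>: "0 < \<alpha>" and t: "0 < t"
    and F: "F \<in> borel_measurable (coord_space ({0<..} \<inter> {..t}))"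
  shows "(\<integral>\<^sup>+\<omega>. F \<omega> * (ext0 (\<lambda>_. 1) (\<omega> t) * killing_weight \<alpha> \<omega>) \<partial>Q z) =
    ennreal (exp (- \<alpha> * t)) * (\<integral>\<^sup>+\<omega>. F \<omega> * ext0 (\<lambda>x. u \<alpha> x z / u 0 x z) (\<omega> t) \<partial>Q z)"
proof -
  let ?G = "coord_space ({0<..} \<inter> {..t}) :: (real \<Rightarrow> 'a option) measure"
  let ?c = "ennreal (exp (- \<alpha> * t))"
  have \<alpha>0: "0 \<le> \<alpha>" using \<alpha> by simp
  note [measurable] = measurable_Q_past[OF F] \<alpha>0
  have [measurable]: "(\<lambda>\<omega>. \<omega> t) \<in> Q z \<rightarrow>\<^sub>M cemetery_borel" "killing_weight \<alpha> \<in> borel_measurable (Q z)"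
    using t by (auto intro: measurable_coordinate_Q)
  define D where "D n = moderate t n z" for n
  have D: "D n \<in> sets ?G" for n unfolding D_def using t by (intro moderate_in_coord_space) simp
  have sub: "sets ?G \<subseteq> sets (Q z)" unfolding sets_Q by (intro sets_coord_space_mono) auto
  have D_Q[measurable]: "D n \<in> sets (Q z)" for n using D sub by auto
  have D_fin: "emeasure (Q z) (D n) \<noteq> \<infinity>" for n using emeasure_moderate[OF t, of z n] by (simp add: D_def)
  \<comment> \<open>on \<open>D n\<close> everything is finite, so that the survival part \<open>?S\<close> can be cancelled\<close>
  have local_eq: "(\<integral>\<^sup>+\<omega>. indicator (A \<inter> D n) \<omega> * killing_weight \<alpha> \<omega> \<partial>Q z) =
      (\<integral>\<^sup>+\<omega>. indicator (A \<inter> D n) \<omega> * (?c * ext0 (\<lambda>x. u \<alpha> x z / u 0 x z) (\<omega> t)) \<partial>Q z)"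
    if A: "A \<in> sets ?G" for A n
  proof -
    define I :: "(real \<Rightarrow> 'a option) \<Rightarrow> ennreal" where "I = indicator (A \<inter> D n)"
    have I_G: "I \<in> borel_measurable ?G" unfolding I_def using A D by (intro borel_measurable_indicator) auto
    note [measurable] = measurable_Q_past[OF I_G] measurable_past_snd[OF I_G]
    have I0: "I \<omega> = 0 \<or> (\<exists>x. \<omega> \<in> paths \<and> \<omega> t = Some x \<and> x \<noteq> z)" for \<omega>
      by (auto simp: I_def D_def moderate_def indicator_def)
    let ?S = "\<lambda>\<omega>. tail (\<lambda>s. ennreal (\<alpha> * exp (- \<alpha> * s)) * ext0 (\<lambda>_. 1) (\<omega> s)) t"
    let ?b = "\<lambda>x. (\<integral>\<^sup>+y. u \<alpha> x y * u 0 y z \<partial>m) / u 0 x z"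
    have survival: "(\<integral>\<^sup>+\<omega>. I \<omega> * ?S \<omega> \<partial>Q z) = (\<integral>\<^sup>+\<omega>. I \<omega> * (?c * ext0 (\<lambda>x. ennreal \<alpha> * ?b x) (\<omega> t)) \<partial>Q z)"
      by (rule survival_Q[OF \<alpha> t I_G])
    have S_meas: "?S \<in> borel_measurable (Q z)"
    proof -
      have "(\<lambda>\<omega>. tail (\<lambda>s. ennreal (\<alpha> * exp (- \<alpha> * s)) * ext0 (\<lambda>_. 1) (\<omega> s)) t) \<in> borel_measurable \<Omega>"
        by (rule measurable_tail_path[OF locally_compact, where g = "\<lambda>_ s x. ennreal (\<alpha> * exp (- \<alpha> * s)) * ext0 (\<lambda>_. 1) x"])
          (use t in \<open>auto intro: less_imp_le\<close>)
      then show ?thesis by measurable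
    qed
    note S_meas[measurable]
    have "(\<integral>\<^sup>+\<omega>. I \<omega> * killing_weight \<alpha> \<omega> \<partial>Q z) + (\<integral>\<^sup>+\<omega>. I \<omega> * ?S \<omega> \<partial>Q z) =
        (\<integral>\<^sup>+\<omega>. I \<omega> * killing_weight \<alpha> \<omega> + I \<omega> * ?S \<omega> \<partial>Q z)"
      by (rule nn_integral_add[symmetric]) measurable
    also have "\<dots> = (\<integral>\<^sup>+\<omega>. I \<omega> * ?c \<partial>Q z)"
    proof (rule nn_integral_cong)
      fix \<omega>
      show "I \<omega> * killing_weight \<alpha> \<omega> + I \<omega> * ?S \<omega> = I \<omega> * ?c"
      proof (cases "I \<omega> = 0")
        case False
        then have "\<omega> \<in> paths" "\<omega> t \<noteq> None" using I0[of \<omega>] by auto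
        then have "killing_weight \<alpha> \<omega> + ?S \<omega> = ?c" using killing_weight_split[OF locally_compact] t \<alpha> by blast
        then show ?thesis by (simp only: distrib_left[symmetric])
      qed simp
    qed
    also have "\<dots> = (\<integral>\<^sup>+\<omega>. I \<omega> * (?c * ext0 (\<lambda>x. u \<alpha> x z / u 0 x z) (\<omega> t)) +
        I \<omega> * (?c * ext0 (\<lambda>x. ennreal \<alpha> * ?b x) (\<omega> t)) \<partial>Q z)"
    proof (rule nn_integral_cong)
      fix \<omega>
      show "I \<omega> * ?c = I \<omega> * (?c * ext0 (\<lambda>x. u \<alpha> x z / u 0 x z) (\<omega> t)) + I \<omega> * (?c * ext0 (\<lambda>x. ennreal \<alpha> * ?b x) (\<omega> t))"
      proof (cases "I \<omega> = 0")
        case False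
        then obtain x where "\<omega> t = Some x" "x \<noteq> z" using I0[of \<omega>] by auto
        then show ?thesis
          using u_quotient_split[OF \<alpha>0, of x z] by (simp add: ext0_def distrib_left[symmetric])
      qed simp
    qed
    also have "\<dots> = (\<integral>\<^sup>+\<omega>. I \<omega> * (?c * ext0 (\<lambda>x. u \<alpha> x z / u 0 x z) (\<omega> t)) \<partial>Q z) +
        (\<integral>\<^sup>+\<omega>. I \<omega> * (?c * ext0 (\<lambda>x. ennreal \<alpha> * ?b x) (\<omega> t)) \<partial>Q z)"
      by (rule nn_integral_add) measurable
    finally have sum: "(\<integral>\<^sup>+\<omega>. I \<omega> * killing_weight \<alpha> \<omega> \<partial>Q z) + (\<integral>\<^sup>+\<omega>. I \<omega> * ?S \<omega> \<partial>Q z) =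
        (\<integral>\<^sup>+\<omega>. I \<omega> * (?c * ext0 (\<lambda>x. u \<alpha> x z / u 0 x z) (\<omega> t)) \<partial>Q z) + (\<integral>\<^sup>+\<omega>. I \<omega> * ?S \<omega> \<partial>Q z)"
      unfolding survival .
    have "(\<integral>\<^sup>+\<omega>. I \<omega> * ?S \<omega> \<partial>Q z) \<le> (\<integral>\<^sup>+\<omega>. indicator (D n) \<omega> * ?c \<partial>Q z)"
    proof (rule nn_integral_mono)
      fix \<omega>
      show "I \<omega> * ?S \<omega> \<le> indicator (D n) \<omega> * ?c"
      proof (cases "I \<omega> = 0")
        case False
        then have "\<omega> \<in> paths" "\<omega> t \<noteq> None" using I0[of \<omega>] by auto
        then have "killing_weight \<alpha> \<omega> + ?S \<omega> = ?c" using killing_weight_split[OF locally_compact] t \<alpha> by blast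
        then have "?S \<omega> \<le> ?c" by (metis add.commute le_iff_add)
        then show ?thesis using False by (auto simp: I_def indicator_def split: if_splits)
      qed simp
    qed
    also have "\<dots> = emeasure (Q z) (D n) * ?c" by (simp add: nn_integral_multc)
    also have "\<dots> < \<infinity>" using D_fin[of n] by (simp add: ennreal_mult_eq_top_iff less_top[symmetric])
    finally have "(\<integral>\<^sup>+\<omega>. I \<omega> * ?S \<omega> \<partial>Q z) \<noteq> \<infinity>" by simp
    then have "(\<integral>\<^sup>+\<omega>. I \<omega> * killing_weight \<alpha> \<omega> \<partial>Q z) = (\<integral>\<^sup>+\<omega>. I \<omega> * (?c * ext0 (\<lambda>x. u \<alpha> x z / u 0 x z) (\<omega> t)) \<partial>Q z)"
      using sum ennreal_add_left_cancel[of "\<integral>\<^sup>+\<omega>. I \<omega> * ?S \<omega> \<partial>Q z"] by (simp add: add.commute)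
    then show ?thesis unfolding I_def .
  qed
  have for_sets: "(\<integral>\<^sup>+\<omega>. indicator A \<omega> * (ext0 (\<lambda>_. 1) (\<omega> t) * killing_weight \<alpha> \<omega>) \<partial>Q z) =
      (\<integral>\<^sup>+\<omega>. indicator A \<omega> * (?c * ext0 (\<lambda>x. u \<alpha> x z / u 0 x z) (\<omega> t)) \<partial>Q z)"
    if A: "A \<in> sets ?G" for A
  proof -
    have A_Q[measurable]: "A \<in> sets (Q z)" using A sub by auto
    have D_mono: "D n \<subseteq> D k" if "n \<le> k" for n k
      using that by (auto simp: D_def moderate_def elim!: order_trans)
    have "(\<integral>\<^sup>+\<omega>. indicator A \<omega> * (ext0 (\<lambda>_. 1) (\<omega> t) * a \<omega>) \<partial>Q z) =
        (SUP n. \<integral>\<^sup>+\<omega>. indicator (A \<inter> D n) \<omega> * a \<omega> \<partial>Q z)"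
      if [measurable]: "a \<in> borel_measurable (Q z)" for a
    proof -
      have "(\<integral>\<^sup>+\<omega>. indicator A \<omega> * (ext0 (\<lambda>_. 1) (\<omega> t) * a \<omega>) \<partial>Q z) =
          (\<integral>\<^sup>+\<omega>. (SUP n. indicator (A \<inter> D n) \<omega> * a \<omega>) \<partial>Q z)"
      proof (rule nn_integral_cong_AE)
        show "AE \<omega> in Q z. indicator A \<omega> * (ext0 (\<lambda>_. 1) (\<omega> t) * a \<omega>) = (SUP n. indicator (A \<inter> D n) \<omega> * a \<omega>)"
          using Q_not_start[OF t] AE_space[of "Q z"]
        proof eventually_elim
          case (elim \<omega>)
          show ?case
          proof (cases "\<omega> t")
            case None
            then have "\<omega> \<notin> D n" for n by (auto simp: D_def moderate_def)
            then show ?thesis using None by (simp add: ext0_def)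
          next
            case (Some x)
            then obtain N where inD: "\<omega> \<in> D N"
              using ex_moderate[of \<omega> t z] elim by (auto simp: D_def space_Q)
            have "(SUP n. indicator (A \<inter> D n) \<omega> * a \<omega>) = indicator A \<omega> * a \<omega>"
            proof (rule antisym)
              show "(SUP n. indicator (A \<inter> D n) \<omega> * a \<omega>) \<le> indicator A \<omega> * a \<omega>"
                by (rule SUP_least) (auto simp: indicator_def)
              show "indicator A \<omega> * a \<omega> \<le> (SUP n. indicator (A \<inter> D n) \<omega> * a \<omega>)"
                by (rule SUP_upper2[of N]) (use inD in \<open>auto simp: indicator_def\<close>)
            qed
            then show ?thesis using Some by (simp add: ext0_def)
          qed
        qed
      qed
      also have "\<dots> = (SUP n. \<integral>\<^sup>+\<omega>. indicator (A \<inter> D n) \<omega> * a \<omega> \<partial>Q z)"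
        using D_mono by (intro nn_integral_monotone_convergence_SUP)
          (auto simp: incseq_def le_fun_def indicator_def subset_eq)
      finally show ?thesis .
    qed
    note sup = this
    have "(\<integral>\<^sup>+\<omega>. indicator A \<omega> * (ext0 (\<lambda>_. 1) (\<omega> t) * killing_weight \<alpha> \<omega>) \<partial>Q z) =
      (\<integral>\<^sup>+\<omega>. indicator A \<omega> * (ext0 (\<lambda>_. 1) (\<omega> t) * (?c * ext0 (\<lambda>x. u \<alpha> x z / u 0 x z) (\<omega> t))) \<partial>Q z)"
    proof -
      have W: "killing_weight \<alpha> \<in> borel_measurable (Q z)" by measurable
      have c: "(\<lambda>\<omega>. ?c * ext0 (\<lambda>x. u \<alpha> x z / u 0 x z) (\<omega> t)) \<in> borel_measurable (Q z)" by measurable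
      show ?thesis unfolding sup[OF W] sup[OF c] local_eq[OF A] ..
    qed
    also have "\<dots> = (\<integral>\<^sup>+\<omega>. indicator A \<omega> * (?c * ext0 (\<lambda>x. u \<alpha> x z / u 0 x z) (\<omega> t)) \<partial>Q z)"
      by (intro nn_integral_cong) (auto simp: ext0_eq)
    finally show ?thesis .
  qed
  have "(\<integral>\<^sup>+\<omega>. F \<omega> * (ext0 (\<lambda>_. 1) (\<omega> t) * killing_weight \<alpha> \<omega>) \<partial>Q z) =
      (\<integral>\<^sup>+\<omega>. F \<omega> * (?c * ext0 (\<lambda>x. u \<alpha> x z / u 0 x z) (\<omega> t)) \<partial>Q z)"
    by (rule nn_integral_eq_if_set_integrals_eq[OF _ sub _ _ for_sets F]) (simp_all add: space_Q)
  also have "\<dots> = (\<integral>\<^sup>+\<omega>. ?c * (F \<omega> * ext0 (\<lambda>x. u \<alpha> x z / u 0 x z) (\<omega> t)) \<partial>Q z)"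
    by (simp add: mult_ac)
  also have "\<dots> = ?c * (\<integral>\<^sup>+\<omega>. F \<omega> * ext0 (\<lambda>x. u \<alpha> x z / u 0 x z) (\<omega> t) \<partial>Q z)"
    by (rule nn_integral_cmult) measurable
  finally show ?thesis .
qed

text \<open>By \<open>prod_tail\<close>, decide which of the times comes first. Along a fixed path the integrands are measurable
in time because evaluation is jointly measurable.\<close>

lemma nn_integral_occupations_split:
  assumes f[measurable]: "\<And>j. f j \<in> borel_measurable borel" and J: "finite J" "J \<noteq> {}"
    and G[measurable]: "G \<in> borel_measurable \<Omega>" and t: "0 \<le> t"
  shows "(\<integral>\<^sup>+\<omega>. G \<omega> * (\<Prod>j\<in>J. tail (\<lambda>s. ext0 (f j) (\<omega> s)) t) \<partial>Q z) =
    (\<Sum>j\<in>J. tail (\<lambda>s. \<integral>\<^sup>+\<omega>. G \<omega> * (ext0 (f j) (\<omega> s) * (\<Prod>i\<in>J - {j}. tail (\<lambda>r. ext0 (f i) (\<omega> r)) s)) \<partial>Q z) t)"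
proof -
  let ?A = "\<lambda>j \<omega>. tail (\<lambda>s. ext0 (f j) (\<omega> s))"
  let ?H = "\<lambda>j s \<omega>. G \<omega> * (ext0 (f j) (\<omega> s) * (\<Prod>i\<in>J - {j}. ?A i \<omega> s))"
  have H_meas: "(\<lambda>p. ?H j (max 0 (fst p)) (snd p)) \<in> borel_measurable (borel \<Otimes>\<^sub>M \<Omega>)" for j
  proof -
    note [measurable] = measurable_occupation[OF f]
    show ?thesis by measurable
  qed
  have "(\<integral>\<^sup>+\<omega>. G \<omega> * (\<Prod>j\<in>J. ?A j \<omega> t) \<partial>Q z) = (\<integral>\<^sup>+\<omega>. (\<Sum>j\<in>J. tail (\<lambda>s. ?H j s \<omega>) t) \<partial>Q z)"
  proof (rule nn_integral_cong)
    fix \<omega> assume \<omega>: "\<omega> \<in> space (Q z)"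
    then have path[measurable]: "(\<lambda>s. \<omega> (max 0 s)) \<in> borel \<rightarrow>\<^sub>M cemetery_borel"
      by (intro measurable_path locally_compact) (simp add: space_Q)
    let ?a = "\<lambda>j s. ext0 (f j) (\<omega> (max 0 s))"
    have A_eq: "?A j \<omega> s = tail (?a j) s" if "0 \<le> s" for j s
      using that by (intro tail_cong) simp
    have "(\<Prod>j\<in>J. ?A j \<omega> t) = (\<Prod>j\<in>J. tail (?a j) t)" using t by (simp add: A_eq)
    also have "\<dots> = (\<Sum>j\<in>J. tail (\<lambda>s. ?a j s * (\<Prod>i\<in>J - {j}. tail (?a i) s)) t)"
      using J by (intro prod_tail) auto
    finally have "G \<omega> * (\<Prod>j\<in>J. ?A j \<omega> t) =
        (\<Sum>j\<in>J. G \<omega> * tail (\<lambda>s. ?a j s * (\<Prod>i\<in>J - {j}. tail (?a i) s)) t)"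
      by (simp add: sum_distrib_left)
    also have "\<dots> = (\<Sum>j\<in>J. tail (\<lambda>s. G \<omega> * (?a j s * (\<Prod>i\<in>J - {j}. tail (?a i) s))) t)"
      by (intro sum.cong refl tail_mult_left[symmetric]) measurable
    also have "\<dots> = (\<Sum>j\<in>J. tail (\<lambda>s. ?H j s \<omega>) t)"
      using t by (intro sum.cong refl tail_cong) (simp add: A_eq)
    finally show "G \<omega> * (\<Prod>j\<in>J. ?A j \<omega> t) = (\<Sum>j\<in>J. tail (\<lambda>s. ?H j s \<omega>) t)" .
  qed
  also have "\<dots> = (\<Sum>j\<in>J. \<integral>\<^sup>+\<omega>. tail (\<lambda>s. ?H j s \<omega>) t \<partial>Q z)"
  proof (rule nn_integral_sum)
    fix j assume "j \<in> J"
    have "(\<lambda>\<omega>. tail (\<lambda>s. (\<lambda>p. ?H j (max 0 (fst p)) (snd p)) (s, \<omega>)) t) \<in> borel_measurable \<Omega>"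
    proof (rule measurable_tail)
      have "(\<lambda>q. (\<lambda>p. ?H j (max 0 (fst p)) (snd p)) (snd q, fst q)) \<in> borel_measurable (\<Omega> \<Otimes>\<^sub>M borel)"
        by (rule measurable_compose[OF _ H_meas]) measurable
      then show "(\<lambda>(\<omega>, s). (\<lambda>p. ?H j (max 0 (fst p)) (snd p)) (s, \<omega>)) \<in> borel_measurable (\<Omega> \<Otimes>\<^sub>M borel)"
        by (simp add: case_prod_unfold)
    qed simp
    also have "(\<lambda>\<omega>. tail (\<lambda>s. (\<lambda>p. ?H j (max 0 (fst p)) (snd p)) (s, \<omega>)) t) = (\<lambda>\<omega>. tail (\<lambda>s. ?H j s \<omega>) t)"
      using t by (intro ext tail_cong) simp
    finally show "(\<lambda>\<omega>. tail (\<lambda>s. ?H j s \<omega>) t) \<in> borel_measurable (Q z)"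
      by (subst measurable_cong_sets[OF sets_Q refl])
  qed
  also have "\<dots> = (\<Sum>j\<in>J. tail (\<lambda>s. \<integral>\<^sup>+\<omega>. ?H j s \<omega> \<partial>Q z) t)"
    by (intro sum.cong refl nn_integral_tail_Q t H_meas)
  finally show ?thesis .
qed

text \<open>
Induction on \<open>J\<close>: let \<open>s\<close> be the first of the remaining times and \<open>j\<close> its index. The induction hypothesis
at time \<open>s\<close>, with \<open>f j\<close> at that time absorbed into the past, replaces everything after \<open>s\<close> by chains
divided by \<open>h\<close>; integrating over \<open>s\<close> then prepends one potential \<open>u\<^sup>\<alpha>\<close> to the chains.\<close>

lemma occupation_Q_past:
  assumes \<alpha>: "0 < \<alpha>" and f[measurable]: "\<And>j. f j \<in> borel_measurable borel"
    and J: "finite J" and t: "0 < t"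
    and F: "F \<in> borel_measurable (coord_space ({0<..} \<inter> {..t}))"
  shows "(\<integral>\<^sup>+\<omega>. F \<omega> * (ext0 (\<lambda>_. 1) (\<omega> t) * (killing_weight \<alpha> \<omega> * (\<Prod>j\<in>J. tail (\<lambda>s. ext0 (f j) (\<omega> s)) t))) \<partial>Q z) =
    ennreal (exp (- \<alpha> * t)) *
      (\<integral>\<^sup>+\<omega>. F \<omega> * ext0 (\<lambda>x. (\<Sum>p\<in>permutations_of_set J. chain m (u \<alpha>) f p x z) / u 0 x z) (\<omega> t) \<partial>Q z)"
  using J t F
proof (induction J arbitrary: t F rule: finite_psubset_induct)
  case (psubset J)
  show ?case
  proof (cases "J = {}")
    case True
    then show ?thesis using killing_weight_Q[OF \<alpha> psubset.prems] by simp
  next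
    case False
    have t: "0 < t" and F: "F \<in> borel_measurable (coord_space ({0<..} \<inter> {..t}))" by fact+
    have \<alpha>0: "0 \<le> \<alpha>" using \<alpha> by simp
    have u_pair[measurable]: "(\<lambda>(x, y). u \<alpha> x y) \<in> borel_measurable (borel \<Otimes>\<^sub>M borel)" using \<alpha>0 by (rule u_measurable)
    note [measurable] = measurable_past_snd[OF F] measurable_Q_past[OF F]
    have [measurable]: "(\<lambda>p. snd p t) \<in> borel \<Otimes>\<^sub>M \<Omega> \<rightarrow>\<^sub>M cemetery_borel"
      "(\<lambda>\<omega>. \<omega> t) \<in> Q z \<rightarrow>\<^sub>M cemetery_borel"
      using t by (auto intro: measurable_coordinate_snd measurable_coordinate_Q)
    let ?e = "\<lambda>s. ennreal (exp (- \<alpha> * s))"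
    let ?A = "\<lambda>j \<omega>. tail (\<lambda>s. ext0 (f j) (\<omega> s))"
    define S where "S j x = (\<Sum>p\<in>permutations_of_set (J - {j}). chain m (u \<alpha>) f p x z)" for j x
    have [measurable]: "S j \<in> borel_measurable borel" for j unfolding S_def by measurable
    let ?G = "\<lambda>\<omega>. F \<omega> * ext0 (\<lambda>_. 1) (\<omega> t) * killing_weight \<alpha> \<omega>"
    let ?H = "\<lambda>j s \<omega>. ?G \<omega> * (ext0 (f j) (\<omega> s) * (\<Prod>i\<in>J - {j}. ?A i \<omega> s))"
    have [measurable]: "F \<in> borel_measurable \<Omega>" "(\<lambda>\<omega>. \<omega> t) \<in> \<Omega> \<rightarrow>\<^sub>M cemetery_borel"
      using measurable_coord_space_mono[OF _ F, of "{0..}"] t by (auto intro: measurable_coordinate)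
    have "(\<integral>\<^sup>+\<omega>. F \<omega> * (ext0 (\<lambda>_. 1) (\<omega> t) * (killing_weight \<alpha> \<omega> * (\<Prod>j\<in>J. ?A j \<omega> t))) \<partial>Q z) =
        (\<integral>\<^sup>+\<omega>. ?G \<omega> * (\<Prod>j\<in>J. ?A j \<omega> t) \<partial>Q z)"
      by (simp only: mult.assoc)
    also have "\<dots> = (\<Sum>j\<in>J. tail (\<lambda>s. \<integral>\<^sup>+\<omega>. ?H j s \<omega> \<partial>Q z) t)"
      using psubset.hyps False t f by (intro nn_integral_occupations_split) (auto, measurable)
    also have "\<dots> = (\<Sum>j\<in>J. ?e t * (\<integral>\<^sup>+\<omega>. F \<omega> * ext0 (\<lambda>x. (\<integral>\<^sup>+y. u \<alpha> x y * (f j y * S j y) \<partial>m) / u 0 x z) (\<omega> t) \<partial>Q z))"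
    proof (rule sum.cong[OF refl])
      fix j assume j: "j \<in> J"
      have "tail (\<lambda>s. \<integral>\<^sup>+\<omega>. ?H j s \<omega> \<partial>Q z) t = tail (\<lambda>s. ?e s * (\<integral>\<^sup>+\<omega>. F \<omega> * ext0 (\<lambda>x. (f j x * S j x) / u 0 x z) (\<omega> s) \<partial>Q z)) t"
      proof (rule tail_cong)
        fix s assume s: "t < s"
        then have s0: "0 < s" using t by simp
        define F' where "F' \<omega> = F \<omega> * (ext0 (\<lambda>_. 1) (\<omega> t) * ext0 (f j) (\<omega> s))" for \<omega>
        have F': "F' \<in> borel_measurable (coord_space ({0<..} \<inter> {..s}))"
        proof -
          have "F \<in> borel_measurable (coord_space ({0<..} \<inter> {..s}))"
            by (rule measurable_coord_space_mono[OF _ F]) (use s in auto)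
          moreover have "(\<lambda>\<omega>. ext0 (\<lambda>_. 1 :: ennreal) (\<omega> t)) \<in> borel_measurable (coord_space ({0<..} \<inter> {..s}))"
            "(\<lambda>\<omega>. ext0 (f j) (\<omega> s)) \<in> borel_measurable (coord_space ({0<..} \<inter> {..s}))"
            using t s by (auto intro!: measurable_ext0_coordinate)
          ultimately show ?thesis unfolding F'_def by measurable
        qed
        have "(\<integral>\<^sup>+\<omega>. ?H j s \<omega> \<partial>Q z) =
            (\<integral>\<^sup>+\<omega>. F' \<omega> * (ext0 (\<lambda>_. 1) (\<omega> s) * (killing_weight \<alpha> \<omega> * (\<Prod>i\<in>J - {j}. ?A i \<omega> s))) \<partial>Q z)"
          by (intro nn_integral_cong) (auto simp: F'_def ext0_def mult_ac split: option.split)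
        also have "\<dots> = ?e s * (\<integral>\<^sup>+\<omega>. F' \<omega> * ext0 (\<lambda>x. S j x / u 0 x z) (\<omega> s) \<partial>Q z)"
          unfolding S_def using j by (intro psubset.IH s0 F') auto
        also have "(\<integral>\<^sup>+\<omega>. F' \<omega> * ext0 (\<lambda>x. S j x / u 0 x z) (\<omega> s) \<partial>Q z) =
            (\<integral>\<^sup>+\<omega>. F \<omega> * ext0 (\<lambda>x. (f j x * S j x) / u 0 x z) (\<omega> s) \<partial>Q z)"
        proof (rule nn_integral_cong)
          fix \<omega> assume "\<omega> \<in> space (Q z)"
          then have "\<omega> s = None" if "\<omega> t = None"
            using paths_None_mono[of \<omega> t s] that t s by (simp add: space_Q)
          then show "F' \<omega> * ext0 (\<lambda>x. S j x / u 0 x z) (\<omega> s) = F \<omega> * ext0 (\<lambda>x. (f j x * S j x) / u 0 x z) (\<omega> s)"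
            by (auto simp: F'_def ext0_eq divide_ennreal_def mult_ac)
        qed
        finally show "(\<integral>\<^sup>+\<omega>. ?H j s \<omega> \<partial>Q z) = ?e s * (\<integral>\<^sup>+\<omega>. F \<omega> * ext0 (\<lambda>x. (f j x * S j x) / u 0 x z) (\<omega> s) \<partial>Q z)" .
      qed
      also have "\<dots> = ?e t * (\<integral>\<^sup>+\<omega>. F \<omega> * ext0 (\<lambda>x. (\<integral>\<^sup>+y. u \<alpha> x y * (f j y * S j y) \<partial>m) / u 0 x z) (\<omega> t) \<partial>Q z)"
        by (rule discounted_potential_Q[OF \<alpha>0 t F]) measurable
      finally show "tail (\<lambda>s. \<integral>\<^sup>+\<omega>. ?H j s \<omega> \<partial>Q z) t = \<dots>" .
    qed
    also have "\<dots> = ?e t * (\<Sum>j\<in>J. \<integral>\<^sup>+\<omega>. F \<omega> * ext0 (\<lambda>x. (\<integral>\<^sup>+y. u \<alpha> x y * (f j y * S j y) \<partial>m) / u 0 x z) (\<omega> t) \<partial>Q z)"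
      by (simp only: sum_distrib_left)
    also have "(\<Sum>j\<in>J. \<integral>\<^sup>+\<omega>. F \<omega> * ext0 (\<lambda>x. (\<integral>\<^sup>+y. u \<alpha> x y * (f j y * S j y) \<partial>m) / u 0 x z) (\<omega> t) \<partial>Q z) =
        (\<integral>\<^sup>+\<omega>. (\<Sum>j\<in>J. F \<omega> * ext0 (\<lambda>x. (\<integral>\<^sup>+y. u \<alpha> x y * (f j y * S j y) \<partial>m) / u 0 x z) (\<omega> t)) \<partial>Q z)"
      using \<alpha>0 by (intro nn_integral_sum[symmetric]) measurable
    also have "\<dots> = (\<integral>\<^sup>+\<omega>. F \<omega> * ext0 (\<lambda>x. (\<Sum>p\<in>permutations_of_set J. chain m (u \<alpha>) f p x z) / u 0 x z) (\<omega> t) \<partial>Q z)"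
    proof -
      have "(\<Sum>p\<in>permutations_of_set J. chain m (u \<alpha>) f p x z) = (\<Sum>j\<in>J. \<integral>\<^sup>+y. u \<alpha> x y * (f j y * S j y) \<partial>m)" for x
        unfolding sum_permutations_of_set_Cons[OF psubset.hyps False] S_def sum_distrib_left chain.simps
        using \<alpha>0 by (intro sum.cong refl nn_integral_sum[symmetric]) measurable
      then have "F \<omega> * ext0 (\<lambda>x. (\<Sum>p\<in>permutations_of_set J. chain m (u \<alpha>) f p x z) / u 0 x z) (\<omega> t) =
          (\<Sum>j\<in>J. F \<omega> * ext0 (\<lambda>x. (\<integral>\<^sup>+y. u \<alpha> x y * (f j y * S j y) \<partial>m) / u 0 x z) (\<omega> t))" for \<omega>
        by (cases "\<omega> t") (simp_all add: ext0_def divide_ennreal_def sum_distrib_right sum_distrib_left)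
      then show ?thesis by simp
    qed
    finally show ?thesis .
  qed
qed

text \<open>Before the first time there is no past, only the entrance law from \<open>z\<close>. Its density \<open>h\<close> cancels the
denominator left by \<open>occupation_Q_past\<close>, so that the chains start and end at \<open>z\<close>.\<close>

lemma occupation_Q:
  assumes \<alpha>: "0 < \<alpha>" and f[measurable]: "\<And>j. f j \<in> borel_measurable borel"
    and J: "finite J" "J \<noteq> {}"
  shows "(\<integral>\<^sup>+\<omega>. killing_weight \<alpha> \<omega> * (\<Prod>j\<in>J. tail (\<lambda>s. ext0 (f j) (\<omega> s)) 0) \<partial>Q z) =
    (\<Sum>p\<in>permutations_of_set J. chain m (u \<alpha>) f p z z)"
proof -
  have \<alpha>0: "0 \<le> \<alpha>" using \<alpha> by simp
  have u_pair[measurable]: "(\<lambda>(x, y). u \<alpha> x y) \<in> borel_measurable (borel \<Otimes>\<^sub>M borel)" using \<alpha>0 by (rule u_measurable)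
  let ?e = "\<lambda>s. ennreal (exp (- \<alpha> * s))"
  let ?A = "\<lambda>j \<omega>. tail (\<lambda>s. ext0 (f j) (\<omega> s))"
  define S where "S j x = (\<Sum>p\<in>permutations_of_set (J - {j}). chain m (u \<alpha>) f p x z)" for j x
  have [measurable]: "S j \<in> borel_measurable borel" for j unfolding S_def by measurable
  let ?H = "\<lambda>j s \<omega>. killing_weight \<alpha> \<omega> * (ext0 (f j) (\<omega> s) * (\<Prod>i\<in>J - {j}. ?A i \<omega> s))"
  have "(\<integral>\<^sup>+\<omega>. killing_weight \<alpha> \<omega> * (\<Prod>j\<in>J. ?A j \<omega> 0) \<partial>Q z) = (\<Sum>j\<in>J. tail (\<lambda>s. \<integral>\<^sup>+\<omega>. ?H j s \<omega> \<partial>Q z) 0)"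
    using J f by (intro nn_integral_occupations_split) auto
  also have "\<dots> = (\<Sum>j\<in>J. \<integral>\<^sup>+y. u \<alpha> z y * (f j y * S j y) \<partial>m)"
  proof (rule sum.cong[OF refl])
    fix j assume j: "j \<in> J"
    have "tail (\<lambda>s. \<integral>\<^sup>+\<omega>. ?H j s \<omega> \<partial>Q z) 0 = tail (\<lambda>s. ?e s * (\<integral>\<^sup>+\<omega>. ext0 (\<lambda>x. (f j x * S j x) / u 0 x z) (\<omega> s) \<partial>Q z)) 0"
    proof (rule tail_cong)
      fix s :: real assume s: "0 < s"
      have "(\<integral>\<^sup>+\<omega>. ?H j s \<omega> \<partial>Q z) =
          (\<integral>\<^sup>+\<omega>. ext0 (f j) (\<omega> s) * (ext0 (\<lambda>_. 1) (\<omega> s) * (killing_weight \<alpha> \<omega> * (\<Prod>i\<in>J - {j}. ?A i \<omega> s))) \<partial>Q z)"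
        by (intro nn_integral_cong) (auto simp: ext0_def mult_ac split: option.split)
      also have "\<dots> = ?e s * (\<integral>\<^sup>+\<omega>. ext0 (f j) (\<omega> s) * ext0 (\<lambda>x. S j x / u 0 x z) (\<omega> s) \<partial>Q z)"
        unfolding S_def using s J f by (intro occupation_Q_past \<alpha> measurable_ext0_coordinate) auto
      also have "(\<lambda>\<omega>. ext0 (f j) (\<omega> s) * ext0 (\<lambda>x. S j x / u 0 x z) (\<omega> s)) = (\<lambda>\<omega>. ext0 (\<lambda>x. (f j x * S j x) / u 0 x z) (\<omega> s))"
        by (auto simp: ext0_eq divide_ennreal_def mult_ac)
      finally show "(\<integral>\<^sup>+\<omega>. ?H j s \<omega> \<partial>Q z) = ?e s * (\<integral>\<^sup>+\<omega>. ext0 (\<lambda>x. (f j x * S j x) / u 0 x z) (\<omega> s) \<partial>Q z)" .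
    qed
    also have "\<dots> = (\<integral>\<^sup>+y. u \<alpha> z y * (f j y * S j y) \<partial>m)"
      by (rule discounted_entrance_Q[OF \<alpha>0]) measurable
    finally show "tail (\<lambda>s. \<integral>\<^sup>+\<omega>. ?H j s \<omega> \<partial>Q z) 0 = \<dots>" .
  qed
  also have "\<dots> = (\<Sum>p\<in>permutations_of_set J. chain m (u \<alpha>) f p z z)"
    unfolding sum_permutations_of_set_Cons[OF J] S_def sum_distrib_left chain.simps
    using \<alpha>0 by (intro sum.cong refl nn_integral_sum) measurable
  finally show ?thesis .
qed

end

section \<open>The loop measure\<close>

context loop_bridges
begin

text \<open>Peel off the largest time \<open>b\<close> with the Markov property at the previous time \<open>s\<close>. This multiplies the
factor at \<open>s\<close> by \<open>K z\<close>, the transformed semigroup applied to \<open>g b z\<close>. Written with the original kernels,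
\<open>K\<close> is jointly measurable in \<open>z\<close> and the state.\<close>

lemma measurable_fdd_Q:
  assumes "finite T" "T \<noteq> {}" "T \<subseteq> {0<..}"
    and g: "\<And>t. (\<lambda>(z, x). g t z x) \<in> borel_measurable (borel \<Otimes>\<^sub>M borel)"
  shows "(\<lambda>z. \<integral>\<^sup>+\<omega>. (\<Prod>t\<in>T. ext0 (g t z) (\<omega> t)) \<partial>Q z) \<in> borel_measurable borel"
  using assms
proof (induction T arbitrary: g rule: finite_linorder_max_induct)
  case empty
  then show ?case by simp
next
  case (insert b A)
  note g = insert.prems(3) and g[measurable]
  have g_fixed[measurable]: "g t z \<in> borel_measurable borel" for t z
    using measurable_compose[OF measurable_Pair1' g[of t], of z] by simp
  have [measurable]: "(\<lambda>q. g t (fst q) (snd q)) \<in> borel_measurable (borel \<Otimes>\<^sub>M borel)" for t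
    using g[of t] by (simp add: case_prod_unfold)
  have [measurable]: "(\<lambda>q. g t (fst (fst q)) (snd q)) \<in> borel_measurable ((borel \<Otimes>\<^sub>M (borel :: 'a measure)) \<Otimes>\<^sub>M borel)" for t
  proof -
    have "(\<lambda>q. (\<lambda>(z, x). g t z x) (fst (fst q), snd q)) \<in> borel_measurable ((borel \<Otimes>\<^sub>M (borel :: 'a measure)) \<Otimes>\<^sub>M borel)"
      by (rule measurable_compose[OF _ g]) measurable
    then show ?thesis by simp
  qed
  have b: "0 < b" using insert.prems by simp
  show ?case
  proof (cases "A = {}")
    case True
    then have "(\<integral>\<^sup>+\<omega>. (\<Prod>t\<in>insert b A. ext0 (g t z) (\<omega> t)) \<partial>Q z) = (\<integral>\<^sup>+x. u 0 x z * g b z x \<partial>Pt b z)" for z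
      using entrance_Q[OF b g_fixed] by simp
    moreover have "(\<lambda>z. \<integral>\<^sup>+x. u 0 x z * g b z x \<partial>Pt b z) \<in> borel_measurable borel"
      using b by (intro measurable_nn_integral_Pt) (auto simp: case_prod_unfold)
    ultimately show ?thesis by simp
  next
    case False
    define s where "s = Max A"
    have s: "s \<in> A" "0 < s" "s < b" and le_s: "\<And>t. t \<in> A \<Longrightarrow> t \<le> s"
      using insert.hyps insert.prems False by (auto simp: s_def subset_eq)
    define K where "K z x = (\<integral>\<^sup>+y. (if y = z then 0 else u 0 y z / u 0 x z) * g b z y \<partial>Pt (b - s) x)" for z x
    have K_meas: "(\<lambda>(z, x). K z x) \<in> borel_measurable (borel \<Otimes>\<^sub>M borel)"
      unfolding K_def case_prod_unfold using s by (intro measurable_nn_integral_Pt) auto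
    define g' where "g' t z x = g t z x * (if t = s then K z x else 1)" for t z x
    have "(\<integral>\<^sup>+\<omega>. (\<Prod>t\<in>insert b A. ext0 (g t z) (\<omega> t)) \<partial>Q z) = (\<integral>\<^sup>+\<omega>. (\<Prod>t\<in>A. ext0 (g' t z) (\<omega> t)) \<partial>Q z)" for z
    proof -
      have past: "(\<lambda>\<omega>. \<Prod>t\<in>A. ext0 (g t z) (\<omega> t)) \<in> borel_measurable (coord_space ({0<..} \<inter> {..s}))"
        using insert.prems le_s by (intro borel_measurable_prod_ennreal measurable_ext0_coordinate) auto
      have "b \<notin> A" using insert.hyps by auto
      then have "(\<integral>\<^sup>+\<omega>. (\<Prod>t\<in>insert b A. ext0 (g t z) (\<omega> t)) \<partial>Q z) =
          (\<integral>\<^sup>+\<omega>. (\<Prod>t\<in>A. ext0 (g t z) (\<omega> t)) * ext0 (g b z) (\<omega> (s + (b - s))) \<partial>Q z)"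
        using insert.hyps by (simp add: mult.commute)
      also have "\<dots> = (\<integral>\<^sup>+\<omega>. (\<Prod>t\<in>A. ext0 (g t z) (\<omega> t)) *
          ext0 (\<lambda>x. \<integral>\<^sup>+y. g b z y \<partial>h_semigroup Pt (u 0) z (b - s) x) (\<omega> s) \<partial>Q z)"
        using s by (intro markov_Q past) auto
      also have "\<dots> = (\<integral>\<^sup>+\<omega>. (\<Prod>t\<in>A. ext0 (g' t z) (\<omega> t)) \<partial>Q z)"
      proof (rule nn_integral_cong)
        fix \<omega>
        have K: "(\<integral>\<^sup>+y. g b z y \<partial>h_semigroup Pt (u 0) z (b - s) x) = K z x" for x
          unfolding K_def using s
          by (subst nn_integral_h_semigroup) (auto intro!: nn_integral_cong simp: indicator_def)
        have "(\<Prod>t\<in>A - {s}. ext0 (g' t z) (\<omega> t)) = (\<Prod>t\<in>A - {s}. ext0 (g t z) (\<omega> t))"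
          by (intro prod.cong) (auto simp: g'_def ext0_eq)
        moreover have "ext0 (g' s z) (\<omega> s) = ext0 (g s z) (\<omega> s) * ext0 (K z) (\<omega> s)"
          by (simp add: ext0_eq g'_def)
        ultimately show "(\<Prod>t\<in>A. ext0 (g t z) (\<omega> t)) *
          ext0 (\<lambda>x. \<integral>\<^sup>+y. g b z y \<partial>h_semigroup Pt (u 0) z (b - s) x) (\<omega> s) = (\<Prod>t\<in>A. ext0 (g' t z) (\<omega> t))"
          using s insert.hyps by (simp add: prod.remove[of A s] K mult_ac)
      qed
      finally show ?thesis .
    qed
    moreover have "(\<lambda>z. \<integral>\<^sup>+\<omega>. (\<Prod>t\<in>A. ext0 (g' t z) (\<omega> t)) \<partial>Q z) \<in> borel_measurable borel"
    proof (rule insert.IH)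
      show "(\<lambda>(z, x). g' t z x) \<in> borel_measurable (borel \<Otimes>\<^sub>M borel)" for t
        using g[of t] K_meas unfolding g'_def case_prod_unfold by (cases "t = s") simp_all
    qed (use insert.prems False in auto)
    ultimately show ?thesis by simp
  qed
qed

text \<open>The weight \<open>1 / h\<close> at an early time cancels the density of the entrance law, so that the total mass
becomes that of a transition probability from \<open>z\<close>, which is at most one. For finite measures,
measurability in \<open>z\<close> extends from cylinder events to all events.\<close>

definition Q_early :: "nat \<Rightarrow> 'a \<Rightarrow> (real \<Rightarrow> 'a option) measure" where
  "Q_early i z = density (Q z) (\<lambda>\<omega>. ext0 (\<lambda>x. 1 / u 0 x z) (\<omega> (1 / Suc i)))"

lemma measurable_Q_early: "Q_early i \<in> borel \<rightarrow>\<^sub>M subprob_algebra path_space"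
proof -
  let ?t = "1 / real (Suc i)"
  \<comment> \<open>an intersection-stable generator; time \<open>0\<close>, at which \<open>Q z\<close> is carried by \<open>{\<omega>. \<omega> 0 = Some z}\<close>, is
    treated separately from the positive times\<close>
  define G :: "(real \<Rightarrow> 'a option) set set" where
    "G = {{\<omega> \<in> paths. \<forall>t\<in>T. \<omega> t \<in> Some ` B t} | T B. finite T \<and> T \<subseteq> {0..} \<and> (\<forall>t. B t \<in> sets borel)}"
  have G_sets: "X \<in> sets path_space" if X_G: "X \<in> G" for X
  proof -
    obtain T B where X: "X = {\<omega> \<in> paths. \<forall>t\<in>T. \<omega> t \<in> Some ` B t}" "finite T" "T \<subseteq> {0..}" "\<And>t. B t \<in> sets borel"
      using X_G unfolding G_def by blast
    have "{\<omega> \<in> space path_space. \<forall>t\<in>T. \<omega> t \<in> Some ` B t} \<in> sets path_space"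
    proof (rule sets.sets_Collect_finite_All)
      show "{\<omega> \<in> space path_space. \<omega> t \<in> Some ` B t} \<in> sets path_space" if "t \<in> T" for t
        using coordinate_event[of t "{0..}", OF _ X(4)] X(3) that by auto
    qed (rule X(2))
    then show ?thesis using X by simp
  qed
  have [measurable]: "(\<lambda>\<omega>. \<omega> ?t) \<in> Q z \<rightarrow>\<^sub>M cemetery_borel" for z by (intro measurable_coordinate_Q) simp
  have emeasure_G: "(\<lambda>z. emeasure (Q_early i z) X) \<in> borel_measurable borel" if X_G: "X \<in> G" for X
  proof -
    obtain T B where X: "X = {\<omega> \<in> paths. \<forall>t\<in>T. \<omega> t \<in> Some ` B t}" "finite T" "T \<subseteq> {0..}" and B[measurable]: "\<And>t. B t \<in> sets borel"
      using X_G unfolding G_def by blast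
    define g :: "real \<Rightarrow> 'a \<Rightarrow> 'a \<Rightarrow> ennreal" where
      "g t z x = (if t \<in> T then indicator (B t) x else 1) * (if t = ?t then 1 / u 0 x z else 1)" for t z x
    have g: "(\<lambda>(z, x). g t z x) \<in> borel_measurable (borel \<Otimes>\<^sub>M borel)" for t
      unfolding g_def by measurable
    let ?T = "insert ?t (T - {0})"
    have "emeasure (Q_early i z) X =
        (if 0 \<in> T then indicator (B 0) z else 1) * (\<integral>\<^sup>+\<omega>. (\<Prod>t\<in>?T. ext0 (g t z) (\<omega> t)) \<partial>Q z)" for z
    proof -
      have [measurable]: "(\<lambda>\<omega>. \<Prod>t\<in>?T. ext0 (g t z) (\<omega> t)) \<in> borel_measurable (Q z)"
      proof (intro borel_measurable_prod_ennreal measurable_ext0_Q)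
        show "g t z \<in> borel_measurable borel" for t
          using measurable_compose[OF measurable_Pair1' g[of t], of z] by simp
      qed (use X(3) in auto)
      have [measurable]: "X \<in> sets path_space" by (rule G_sets[OF X_G])
      have "emeasure (Q_early i z) X = (\<integral>\<^sup>+\<omega>. ext0 (\<lambda>x. 1 / u 0 x z) (\<omega> ?t) * indicator X \<omega> \<partial>Q z)"
        unfolding Q_early_def by (intro emeasure_density) measurable
      also have "\<dots> = (\<integral>\<^sup>+\<omega>. (if 0 \<in> T then indicator (B 0) z else 1) * (\<Prod>t\<in>?T. ext0 (g t z) (\<omega> t)) \<partial>Q z)"
      proof (rule nn_integral_cong_AE)
        show "AE \<omega> in Q z. ext0 (\<lambda>x. 1 / u 0 x z) (\<omega> ?t) * indicator X \<omega> =
            (if 0 \<in> T then indicator (B 0) z else 1) * (\<Prod>t\<in>?T. ext0 (g t z) (\<omega> t))"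
          using start_Q[of z] AE_space[of "Q z"]
        proof eventually_elim
          case (elim \<omega>)
          then have start: "\<omega> 0 = Some z" and \<omega>: "\<omega> \<in> paths" by (auto simp: space_Q)
          define I :: "real \<Rightarrow> ennreal" where "I t = (if t \<in> T then ext0 (indicator (B t)) (\<omega> t) else 1)" for t
          have ind: "indicator X \<omega> = (\<Prod>t\<in>T. I t)"
          proof (cases "\<omega> \<in> X")
            case True
            then have "I t = 1" for t using X by (force simp: ext0_def I_def)
            then show ?thesis using True by simp
          next
            case False
            then obtain t where "t \<in> T" "\<omega> t \<notin> Some ` B t" using X \<omega> by auto
            then have "I t = 0" by (auto simp: I_def ext0_def indicator_def split: option.split)
            then show ?thesis using False X(2) \<open>t \<in> T\<close> by (subst prod_zero) auto
          qed
          have T0: "(\<Prod>t\<in>T. I t) = (if 0 \<in> T then indicator (B 0) z else 1) * (\<Prod>t\<in>T - {0}. I t)"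
            using X(2) start by (cases "0 \<in> T") (auto simp: prod.remove[of T 0] I_def[of 0] ext0_def)
          have "(\<Prod>t\<in>?T. ext0 (g t z) (\<omega> t)) = ext0 (g ?t z) (\<omega> ?t) * (\<Prod>t\<in>T - {0} - {?t}. ext0 (g t z) (\<omega> t))"
            using X(2) by (simp add: prod.insert_remove)
          also have "(\<Prod>t\<in>T - {0} - {?t}. ext0 (g t z) (\<omega> t)) = (\<Prod>t\<in>T - {0} - {?t}. I t)"
            by (intro prod.cong) (auto simp: I_def g_def ext0_eq)
          also have "ext0 (g ?t z) (\<omega> ?t) = I ?t * ext0 (\<lambda>x. 1 / u 0 x z) (\<omega> ?t)"
            by (auto simp: I_def g_def ext0_eq)
          also have "\<dots> * (\<Prod>t\<in>T - {0} - {?t}. I t) = ext0 (\<lambda>x. 1 / u 0 x z) (\<omega> ?t) * (\<Prod>t\<in>T - {0}. I t)"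
          proof (cases "?t \<in> T")
            case True
            then have "?t \<in> T - {0}" by simp
            then show ?thesis using X(2) prod.remove[of "T - {0}" ?t I] by (simp only: finite_Diff mult_ac)
          next
            case False
            then have "T - {0} - {?t} = T - {0}" "I ?t = 1" by (auto simp: I_def)
            then show ?thesis by simp
          qed
          finally show ?case unfolding ind T0 by (simp add: mult_ac)
        qed
      qed
      also have "\<dots> = (if 0 \<in> T then indicator (B 0) z else 1) * (\<integral>\<^sup>+\<omega>. (\<Prod>t\<in>?T. ext0 (g t z) (\<omega> t)) \<partial>Q z)"
        by (rule nn_integral_cmult) measurable
      finally show ?thesis .
    qed
    moreover have "(\<lambda>z. \<integral>\<^sup>+\<omega>. (\<Prod>t\<in>?T. ext0 (g t z) (\<omega> t)) \<partial>Q z) \<in> borel_measurable borel"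
      using X g by (intro measurable_fdd_Q) (auto simp: order_less_le)
    ultimately show ?thesis by simp
  qed
  show ?thesis
  proof (rule measurable_subprob_algebra_generated[where \<Omega> = paths and G = G])
    show "sets path_space = sigma_sets paths G"
      unfolding sets_coord_space
    proof (rule sigma_sets_eqI)
      fix a :: "(real \<Rightarrow> 'a option) set" assume "a \<in> {{\<omega> \<in> paths. \<omega> t \<in> Some ` B} |t B. t \<in> {0..} \<and> B \<in> sets borel}"
      then obtain t B where a: "a = {\<omega> \<in> paths. \<omega> t \<in> Some ` B}" "0 \<le> t" "B \<in> sets borel" by auto
      have "a \<in> G" unfolding G_def by (rule CollectI, intro exI[of _ "{t}"] exI[of _ "\<lambda>_. B"]) (use a in auto)
      then show "a \<in> sigma_sets paths G" by (rule sigma_sets.Basic)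
    next
      fix b assume "b \<in> G"
      then show "b \<in> sigma_sets paths {{\<omega> \<in> paths. \<omega> t \<in> Some ` B} |t B. t \<in> {0..} \<and> B \<in> sets borel}"
        using G_sets sets_coord_space by blast
    qed
    show "Int_stable G"
    proof (rule Int_stableI)
      fix a b assume "a \<in> G" "b \<in> G"
      obtain T B where a: "a = {\<omega> \<in> paths. \<forall>t\<in>T. \<omega> t \<in> Some ` B t}" "finite T" "T \<subseteq> {0..}" "\<And>t. B t \<in> sets borel"
        using \<open>a \<in> G\<close> unfolding G_def by blast
      obtain T' B' where b: "b = {\<omega> \<in> paths. \<forall>t\<in>T'. \<omega> t \<in> Some ` B' t}" "finite T'" "T' \<subseteq> {0..}" "\<And>t. B' t \<in> sets borel"
        using \<open>b \<in> G\<close> unfolding G_def by blast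
      let ?C = "\<lambda>t. (if t \<in> T then B t else UNIV) \<inter> (if t \<in> T' then B' t else UNIV)"
      have "a \<inter> b = {\<omega> \<in> paths. \<forall>t\<in>T \<union> T'. \<omega> t \<in> Some ` ?C t}"
        unfolding a b by (auto simp: image_iff split: if_splits) (metis IntI UNIV_I option.inject)+
      then show "a \<inter> b \<in> G"
        unfolding G_def using a b by (intro CollectI exI[of _ "T \<union> T'"] exI[of _ ?C]) auto
    qed
    show "G \<subseteq> Pow paths" by (auto simp: G_def)
    show "subprob_space (Q_early i z)" for z
    proof (rule subprob_spaceI)
      interpret P: subprob_space "Pt ?t z" by (intro subprob_Pt) simp
      have "emeasure (Q_early i z) (space (Q_early i z)) =
          (\<integral>\<^sup>+\<omega>. ext0 (\<lambda>x. 1 / u 0 x z) (\<omega> ?t) * indicator (space (Q z)) \<omega> \<partial>Q z)"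
        unfolding Q_early_def space_density by (rule emeasure_density) measurable
      also have "\<dots> = (\<integral>\<^sup>+\<omega>. ext0 (\<lambda>x. 1 / u 0 x z) (\<omega> ?t) \<partial>Q z)"
        by (intro nn_integral_cong) simp
      also have "\<dots> = (\<integral>\<^sup>+x. 1 \<partial>Pt ?t z)" by (rule entrance_div) auto
      also have "\<dots> \<le> 1" using P.emeasure_space_le_1 by simp
      finally show "emeasure (Q_early i z) (space (Q_early i z)) \<le> 1" .
      show "space (Q_early i z) \<noteq> {}"
        using prob_space.not_empty[OF prob_space_Px, of z] by (simp add: Q_early_def space_Q space_Px)
    qed
    show "sets (Q_early i z) = sets path_space" for z by (simp add: Q_early_def sets_Q)
    show "(\<lambda>z. emeasure (Q_early i z) X) \<in> borel_measurable borel" if "X \<in> G" for X by (rule emeasure_G[OF that])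
    have "paths \<in> G" unfolding G_def by (rule CollectI, intro exI[of _ "{}"] exI[of _ "\<lambda>_. {}"]) auto
    then show "(\<lambda>z. emeasure (Q_early i z) paths) \<in> borel_measurable borel" by (rule emeasure_G)
  qed
qed

text \<open>Undo the weight: multiplying \<open>Q_early i z\<close> by \<open>h\<close> gives \<open>Q z\<close> restricted to the paths alive at time
\<open>1 / (i + 1)\<close>, and these events increase to the whole space up to a null set.\<close>

lemma measurable_nn_integral_Q:
  assumes F[measurable]: "(\<lambda>(p, \<omega>). F p \<omega>) \<in> borel_measurable (N \<Otimes>\<^sub>M path_space)" and Z[measurable]: "Z \<in> N \<rightarrow>\<^sub>M borel"
  shows "(\<lambda>p. \<integral>\<^sup>+\<omega>. F p \<omega> \<partial>Q (Z p)) \<in> borel_measurable N"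
proof -
  have eq: "(\<integral>\<^sup>+\<omega>. F p \<omega> \<partial>Q (Z p)) =
      (SUP i. \<integral>\<^sup>+\<omega>. F p \<omega> * ext0 (\<lambda>x. u 0 x (Z p)) (\<omega> (1 / Suc i)) \<partial>Q_early i (Z p))" if p: "p \<in> space N" for p
  proof -
    let ?z = "Z p"
    have [measurable]: "F p \<in> borel_measurable (Q ?z)"
      using measurable_compose[OF measurable_Pair1'[OF p] F] by (subst measurable_cong_sets[OF sets_Q refl]) simp
    have [measurable]: "(\<lambda>\<omega>. \<omega> (1 / real (Suc i))) \<in> Q z \<rightarrow>\<^sub>M cemetery_borel" for i z
      by (intro measurable_coordinate_Q) simp
    have early: "(\<integral>\<^sup>+\<omega>. F p \<omega> * ext0 (\<lambda>x. u 0 x ?z) (\<omega> (1 / Suc i)) \<partial>Q_early i ?z) =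
        (\<integral>\<^sup>+\<omega>. F p \<omega> * ext0 (\<lambda>_. 1) (\<omega> (1 / Suc i)) \<partial>Q ?z)" for i
    proof -
      have "(\<integral>\<^sup>+\<omega>. F p \<omega> * ext0 (\<lambda>x. u 0 x ?z) (\<omega> (1 / Suc i)) \<partial>Q_early i ?z) =
          (\<integral>\<^sup>+\<omega>. ext0 (\<lambda>x. 1 / u 0 x ?z) (\<omega> (1 / Suc i)) * (F p \<omega> * ext0 (\<lambda>x. u 0 x ?z) (\<omega> (1 / Suc i))) \<partial>Q ?z)"
        unfolding Q_early_def by (rule nn_integral_density) measurable
      also have "\<dots> = (\<integral>\<^sup>+\<omega>. F p \<omega> * ext0 (\<lambda>_. 1) (\<omega> (1 / Suc i)) \<partial>Q ?z)"
      proof (rule nn_integral_cong_AE)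
        have pos: "0 < 1 / real (Suc i)" by simp
        show "AE \<omega> in Q ?z. ext0 (\<lambda>x. 1 / u 0 x ?z) (\<omega> (1 / Suc i)) * (F p \<omega> * ext0 (\<lambda>x. u 0 x ?z) (\<omega> (1 / Suc i))) =
            F p \<omega> * ext0 (\<lambda>_. 1) (\<omega> (1 / Suc i))"
          using Q_not_start[OF pos, of ?z]
        proof eventually_elim
          case (elim \<omega>)
          then show ?case using h_cancel[of _ ?z]
            by (cases "\<omega> (1 / Suc i)") (simp_all add: ext0_def divide_ennreal_def mult_ac)
        qed
      qed
      finally show ?thesis .
    qed
    have "(\<integral>\<^sup>+\<omega>. F p \<omega> \<partial>Q ?z) = (\<integral>\<^sup>+\<omega>. (SUP i. F p \<omega> * ext0 (\<lambda>_. 1) (\<omega> (1 / Suc i))) \<partial>Q ?z)"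
    proof (rule nn_integral_cong_AE)
      show "AE \<omega> in Q ?z. F p \<omega> = (SUP i. F p \<omega> * ext0 (\<lambda>_. 1) (\<omega> (1 / Suc i)))"
        using start_Q[of ?z] AE_space[of "Q ?z"]
      proof eventually_elim
        case (elim \<omega>)
        then obtain i where i: "\<omega> (1 / Suc i) \<noteq> None" using alive_early[of \<omega>] by (auto simp: space_Q)
        show ?case
        proof (rule antisym)
          show "F p \<omega> \<le> (SUP i. F p \<omega> * ext0 (\<lambda>_. 1) (\<omega> (1 / Suc i)))"
            by (rule SUP_upper2[of i]) (use i in \<open>auto simp: ext0_eq\<close>)
          show "(SUP i. F p \<omega> * ext0 (\<lambda>_. 1) (\<omega> (1 / Suc i))) \<le> F p \<omega>"
            by (rule SUP_least) (simp add: ext0_eq)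
        qed
      qed
    qed
    also have "\<dots> = (SUP i. \<integral>\<^sup>+\<omega>. F p \<omega> * ext0 (\<lambda>_. 1) (\<omega> (1 / Suc i)) \<partial>Q ?z)"
    proof (rule nn_integral_monotone_convergence_SUP_AE)
      show "AE \<omega> in Q ?z. F p \<omega> * ext0 (\<lambda>_. 1) (\<omega> (1 / Suc i)) \<le> F p \<omega> * ext0 (\<lambda>_. 1) (\<omega> (1 / Suc (Suc i)))" for i
      proof (rule AE_I2)
        fix \<omega> assume "\<omega> \<in> space (Q ?z)"
        then have "\<omega> (1 / Suc i) = None" if "\<omega> (1 / Suc (Suc i)) = None"
          using that paths_None_mono[of \<omega> "1 / Suc (Suc i)" "1 / Suc i"] by (simp add: space_Q frac_le)
        then show "F p \<omega> * ext0 (\<lambda>_. 1) (\<omega> (1 / Suc i)) \<le> F p \<omega> * ext0 (\<lambda>_. 1) (\<omega> (1 / Suc (Suc i)))"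
          by (auto simp: ext0_eq)
      qed
    qed measurable
    finally show ?thesis by (simp only: early)
  qed
  have "(\<lambda>p. SUP i. \<integral>\<^sup>+\<omega>. F p \<omega> * ext0 (\<lambda>x. u 0 x (Z p)) (\<omega> (1 / Suc i)) \<partial>Q_early i (Z p)) \<in> borel_measurable N"
  proof (rule borel_measurable_SUP)
    fix i
    have [measurable]: "(\<lambda>q. snd q (1 / real (Suc i))) \<in> N \<Otimes>\<^sub>M \<Omega> \<rightarrow>\<^sub>M cemetery_borel"
      by (rule measurable_compose[OF measurable_snd measurable_coordinate]) simp
    have "(\<lambda>q. ext0 ((\<lambda>q x. u 0 x (Z (fst q))) q) (snd q (1 / real (Suc i)))) \<in> borel_measurable (N \<Otimes>\<^sub>M path_space)"
      by (rule measurable_ext0) (unfold case_prod_unfold, measurable)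
    then have [measurable]: "(\<lambda>q. ext0 (\<lambda>x. u 0 x (Z (fst q))) (snd q (1 / real (Suc i)))) \<in> borel_measurable (N \<Otimes>\<^sub>M path_space)"
      by simp
    show "(\<lambda>p. \<integral>\<^sup>+\<omega>. F p \<omega> * ext0 (\<lambda>x. u 0 x (Z p)) (\<omega> (1 / Suc i)) \<partial>Q_early i (Z p)) \<in> borel_measurable N"
    proof (rule nn_integral_measurable_subprob_algebra2)
      show "(\<lambda>p. Q_early i (Z p)) \<in> N \<rightarrow>\<^sub>M subprob_algebra path_space"
        by (rule measurable_compose[OF Z measurable_Q_early])
      have "(\<lambda>q. F (fst q) (snd q)) \<in> borel_measurable (N \<Otimes>\<^sub>M path_space)"
        using F by (simp add: case_prod_unfold)
      then show "(\<lambda>(p, \<omega>). F p \<omega> * ext0 (\<lambda>x. u 0 x (Z p)) (\<omega> (1 / Suc i))) \<in> borel_measurable (N \<Otimes>\<^sub>M path_space)"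
        unfolding case_prod_unfold by measurable
    qed
  qed simp
  then show ?thesis
    by (rule measurable_cong[THEN iffD1, rotated]) (simp add: eq)
qed

lemma space_loop_measure[simp]: "space (loop_measure m Q) = paths"
  and sets_loop_measure[measurable_cong, simp]: "sets (loop_measure m Q) = sets path_space"
proof -
  have "sets \<Omega> \<subseteq> Pow paths" using sets.space_closed[of path_space] by simp
  then show "space (loop_measure m Q) = paths" "sets (loop_measure m Q) = sets path_space"
    unfolding loop_measure_def
    by (auto simp: space_measure_of_conv sets_measure_of sets.sigma_sets_eq[of path_space, simplified])
qed

text \<open>The set function defining the loop measure is countably additive because the inner integrals are
measurable in \<open>z\<close>, so that sums and integrals may be interchanged.\<close>

lemma emeasure_loop_measure:
  assumes A: "A \<in> sets path_space"
  shows "emeasure (loop_measure m Q) A = (\<integral>\<^sup>+z. (\<integral>\<^sup>+\<omega>\<in>A. inverse (lifetime \<omega>) \<partial>Q z) \<partial>m)"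
proof -
  let ?\<mu> = "\<lambda>A. \<integral>\<^sup>+z. (\<integral>\<^sup>+\<omega>\<in>A. inverse (lifetime \<omega>) \<partial>Q z) \<partial>m"
  let ?D = "\<lambda>z. density (Q z) (\<lambda>\<omega>. inverse (lifetime \<omega>))"
  have density: "emeasure (?D z) A = (\<integral>\<^sup>+\<omega>\<in>A. inverse (lifetime \<omega>) \<partial>Q z)" if "A \<in> sets path_space" for A z
    using that by (intro emeasure_density) (auto simp: sets_Q)
  have meas: "(\<lambda>z. emeasure (?D z) A) \<in> borel_measurable m" if A[measurable]: "A \<in> sets path_space" for A
    unfolding density[OF A] measurable_m
    by (rule measurable_nn_integral_Q) (unfold case_prod_unfold, measurable)
  show ?thesis
  proof (rule emeasure_measure_of[OF loop_measure_def])
    show "sets path_space \<subseteq> Pow (paths :: (real \<Rightarrow> 'a option) set)" using sets.space_closed[of path_space] by simp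
    show "A \<in> sets (loop_measure m Q)" using A by simp
    show "positive (sets (loop_measure m Q)) ?\<mu>" by (simp add: positive_def)
    show "countably_additive (sets (loop_measure m Q)) ?\<mu>"
    proof (rule countably_additiveI)
      fix A :: "nat \<Rightarrow> (real \<Rightarrow> 'a option) set"
      assume "range A \<subseteq> sets (loop_measure m Q)" and disj: "disjoint_family A"
      then have A: "A i \<in> sets path_space" for i by auto
      have "(\<Sum>i. ?\<mu> (A i)) = (\<Sum>i. \<integral>\<^sup>+z. emeasure (?D z) (A i) \<partial>m)" by (simp add: density[OF A])
      also have "\<dots> = (\<integral>\<^sup>+z. (\<Sum>i. emeasure (?D z) (A i)) \<partial>m)"
        by (rule nn_integral_suminf[symmetric]) (rule meas[OF A])
      also have "\<dots> = (\<integral>\<^sup>+z. emeasure (?D z) (\<Union>i. A i) \<partial>m)"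
        using A disj by (intro nn_integral_cong suminf_emeasure) (auto simp: sets_Q)
      also have "\<dots> = ?\<mu> (\<Union>i. A i)" using A by (subst density) auto
      finally show "(\<Sum>i. ?\<mu> (A i)) = ?\<mu> (\<Union>i. A i)" .
    qed
  qed
qed

lemma nn_integral_loop_measure:
  assumes F: "F \<in> borel_measurable path_space"
  shows "(\<integral>\<^sup>+\<omega>. F \<omega> \<partial>loop_measure m Q) = (\<integral>\<^sup>+z. (\<integral>\<^sup>+\<omega>. F \<omega> * inverse (lifetime \<omega>) \<partial>Q z) \<partial>m)"
proof -
  let ?D = "\<lambda>z. density (Q z) (\<lambda>\<omega>. inverse (lifetime \<omega>))"
  have density: "(\<integral>\<^sup>+\<omega>. F \<omega> * inverse (lifetime \<omega>) \<partial>Q z) = (\<integral>\<^sup>+\<omega>. F \<omega> \<partial>?D z)"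
    if [measurable]: "F \<in> borel_measurable path_space" for F z
    by (subst nn_integral_density) (auto simp: mult.commute)
  have meas: "(\<lambda>z. \<integral>\<^sup>+\<omega>. F \<omega> \<partial>?D z) \<in> borel_measurable m"
    if [measurable]: "F \<in> borel_measurable path_space" for F
    unfolding density[OF that, symmetric] measurable_m
    by (rule measurable_nn_integral_Q) (unfold case_prod_unfold, measurable)
  have "(\<integral>\<^sup>+\<omega>. F \<omega> \<partial>loop_measure m Q) = (\<integral>\<^sup>+z. 1 * (\<integral>\<^sup>+\<omega>. F \<omega> \<partial>?D z) \<partial>m)"
  proof (rule nn_integral_mixture[where M = path_space])
    fix A :: "(real \<Rightarrow> 'a option) set" assume A: "A \<in> sets path_space"
    then have "emeasure (?D z) A = (\<integral>\<^sup>+\<omega>\<in>A. inverse (lifetime \<omega>) \<partial>Q z)" for z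
      by (intro emeasure_density) (auto simp: sets_Q)
    then show "emeasure (loop_measure m Q) A = (\<integral>\<^sup>+z. 1 * emeasure (?D z) A \<partial>m)"
      using emeasure_loop_measure[OF A] by simp
  qed (use meas F in \<open>auto simp: sets_Q\<close>)
  then show ?thesis by (simp add: density[OF F])
qed

text \<open>Writing \<open>1 / \<zeta>\<close> as an integral of \<open>exp (- \<alpha> \<zeta>)\<close> over \<open>\<alpha>\<close> removes the lifetime.\<close>

lemma nn_integral_loop_measure_tail:
  assumes F[measurable]: "F \<in> borel_measurable path_space"
  shows "(\<integral>\<^sup>+\<omega>. F \<omega> \<partial>loop_measure m Q) =
    tail (\<lambda>\<alpha>. \<integral>\<^sup>+z. (\<integral>\<^sup>+\<omega>. killing_weight \<alpha> \<omega> * F \<omega> \<partial>Q z) \<partial>m) 0"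
proof -
  interpret lm: pair_sigma_finite lborel m by standard
  note [measurable] = measurable_killing_weight[OF locally_compact]
  have W_fixed[measurable]: "(\<lambda>\<alpha>. killing_weight \<alpha> \<omega>) \<in> borel_measurable borel" if "\<omega> \<in> paths" for \<omega> :: "real \<Rightarrow> 'a option"
    using measurable_compose[OF measurable_Pair2'[of \<omega> path_space borel] measurable_killing_weight[OF locally_compact]] that by simp
  have inner: "(\<integral>\<^sup>+\<omega>. F \<omega> * inverse (lifetime \<omega>) \<partial>Q z) = tail (\<lambda>\<alpha>. \<integral>\<^sup>+\<omega>. killing_weight \<alpha> \<omega> * F \<omega> \<partial>Q z) 0" for z
  proof -
    interpret Q: sigma_finite_measure "Q z" by (rule sigma_finite_Q)
    interpret pair_sigma_finite lborel "Q z" by standard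
    have "(\<integral>\<^sup>+\<omega>. F \<omega> * inverse (lifetime \<omega>) \<partial>Q z) =
        (\<integral>\<^sup>+\<omega>. (\<integral>\<^sup>+\<alpha>. killing_weight \<alpha> \<omega> * F \<omega> * indicator {0<..} \<alpha> \<partial>lborel) \<partial>Q z)"
    proof (rule nn_integral_cong_AE)
      show "AE \<omega> in Q z. F \<omega> * inverse (lifetime \<omega>) = (\<integral>\<^sup>+\<alpha>. killing_weight \<alpha> \<omega> * F \<omega> * indicator {0<..} \<alpha> \<partial>lborel)"
        using start_Q[of z] AE_space[of "Q z"]
      proof eventually_elim
        case (elim \<omega>)
        then have \<omega>: "\<omega> \<in> paths" by (simp add: space_Q)
        have "F \<omega> * inverse (lifetime \<omega>) = F \<omega> * tail (\<lambda>\<alpha>. killing_weight \<alpha> \<omega>) 0"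
          using inverse_lifetime[OF \<omega>] elim by simp
        also have "\<dots> = tail (\<lambda>\<alpha>. F \<omega> * killing_weight \<alpha> \<omega>) 0"
          by (rule tail_mult_left[symmetric]) (rule W_fixed[OF \<omega>])
        finally show ?case by (simp add: tail_def mult.commute)
      qed
    qed
    also have "\<dots> = (\<integral>\<^sup>+\<alpha>. (\<integral>\<^sup>+\<omega>. killing_weight \<alpha> \<omega> * F \<omega> * indicator {0<..} \<alpha> \<partial>Q z) \<partial>lborel)"
      by (rule Fubini') measurable
    also have "\<dots> = tail (\<lambda>\<alpha>. \<integral>\<^sup>+\<omega>. killing_weight \<alpha> \<omega> * F \<omega> \<partial>Q z) 0"
      unfolding tail_def by (intro nn_integral_cong nn_integral_multc) measurable
    finally show ?thesis .
  qed
  have joint: "(\<lambda>p. \<integral>\<^sup>+\<omega>. killing_weight (fst p) \<omega> * F \<omega> \<partial>Q (snd p)) \<in> borel_measurable (borel \<Otimes>\<^sub>M borel)"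
  proof (rule measurable_nn_integral_Q)
    have "(\<lambda>q. (\<lambda>(\<alpha>, \<omega>). killing_weight \<alpha> \<omega>) (fst (fst q), snd q)) \<in> borel_measurable ((borel \<Otimes>\<^sub>M borel) \<Otimes>\<^sub>M \<Omega>)"
      by (rule measurable_compose[OF _ measurable_killing_weight[OF locally_compact]]) measurable
    then show "(\<lambda>(p, \<omega>). killing_weight (fst p) \<omega> * F \<omega>) \<in> borel_measurable ((borel \<Otimes>\<^sub>M (borel :: 'a measure)) \<Otimes>\<^sub>M path_space)"
      by (simp add: case_prod_unfold)
  qed simp
  have sec: "(\<lambda>z. \<integral>\<^sup>+\<omega>. killing_weight \<alpha> \<omega> * F \<omega> \<partial>Q z) \<in> borel_measurable m" for \<alpha>
    using measurable_compose[OF measurable_Pair1'[of \<alpha> borel borel] joint] by simp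
  have "(\<integral>\<^sup>+\<omega>. F \<omega> \<partial>loop_measure m Q) =
      (\<integral>\<^sup>+z. (\<integral>\<^sup>+\<alpha>. (\<integral>\<^sup>+\<omega>. killing_weight \<alpha> \<omega> * F \<omega> \<partial>Q z) * indicator {0<..} \<alpha> \<partial>lborel) \<partial>m)"
    unfolding nn_integral_loop_measure[OF F] inner tail_def ..
  also have "\<dots> = (\<integral>\<^sup>+\<alpha>. (\<integral>\<^sup>+z. (\<integral>\<^sup>+\<omega>. killing_weight \<alpha> \<omega> * F \<omega> \<partial>Q z) * indicator {0<..} \<alpha> \<partial>m) \<partial>lborel)"
  proof (rule lm.Fubini')
    have "(\<lambda>p. (\<integral>\<^sup>+\<omega>. killing_weight (fst p) \<omega> * F \<omega> \<partial>Q (snd p)) * indicator {0<..} (fst p)) \<in> borel_measurable (borel \<Otimes>\<^sub>M borel)"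
      using joint by measurable
    then show "(\<lambda>(\<alpha>, z). (\<integral>\<^sup>+\<omega>. killing_weight \<alpha> \<omega> * F \<omega> \<partial>Q z) * indicator {0<..} \<alpha>) \<in> borel_measurable (lborel \<Otimes>\<^sub>M m)"
      unfolding case_prod_unfold by (simp cong: measurable_cong_sets sets_pair_measure_cong add: sets_m)
  qed
  also have "\<dots> = tail (\<lambda>\<alpha>. \<integral>\<^sup>+z. (\<integral>\<^sup>+\<omega>. killing_weight \<alpha> \<omega> * F \<omega> \<partial>Q z) \<partial>m) 0"
    unfolding tail_def by (intro nn_integral_cong nn_integral_multc sec)
  finally show ?thesis .
qed

end

section \<open>Cyclic products\<close>

text \<open>The positions \<open>{1..k}\<close> are arranged on a circle: \<open>cyc_next k\<close> is the successor, taking \<open>k\<close> to \<open>1\<close>, and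
\<open>cyc_shift k i\<close> below is the rotation that takes \<open>k\<close> to \<open>i\<close>. The shifts by one convert between
positions and residues modulo \<open>k\<close>.\<close>

definition cyc_next :: "nat \<Rightarrow> nat \<Rightarrow> nat" where
  "cyc_next k j = j mod k + 1"

definition cyc_shift :: "nat \<Rightarrow> nat \<Rightarrow> nat \<Rightarrow> nat" where
  "cyc_shift k i j = (i + (j - 1)) mod k + 1"

lemma cyc_next_in: "1 \<le> k \<Longrightarrow> cyc_next k j \<in> {1..k}"
  unfolding cyc_next_def using mod_less_divisor[of k j] by (auto simp: Suc_le_eq)

lemma cyc_next_less: "j < k \<Longrightarrow> cyc_next k j = Suc j"
  by (simp add: cyc_next_def)

lemma cyc_next_last: "cyc_next k k = 1"
  by (simp add: cyc_next_def)

lemma cyc_next_neq: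
  assumes "2 \<le> k" "j \<in> {1..k}"
  shows "cyc_next k j \<noteq> j"
  using assms by (cases "j = k") (auto simp: cyc_next_def)

lemma mod_eq_imp_eq:
  fixes a b k :: nat
  assumes "(i + a) mod k = (i + b) mod k" "a < k" "b < k"
  shows "a = b"
proof -
  have le: "a = b" if "(i + a) mod k = (i + b) mod k" "a < k" "b < k" "a \<le> b" for a b :: nat
  proof -
    have "k dvd (i + b) - (i + a)" using that by (subst mod_eq_dvd_iff_nat[symmetric]) auto
    then have "k dvd b - a" by simp
    then show ?thesis using that by (metis diff_is_0_eq' dvd_imp_le le_antisym less_imp_diff_less linorder_not_less zero_less_diff nat_dvd_not_less)
  qed
  show ?thesis using le[of a b] le[of b a] assms by (cases "a \<le> b") auto
qed

lemma bij_betw_cyc_shift: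
  assumes "1 \<le> k"
  shows "bij_betw (cyc_shift k i) {1..k} {1..k}"
proof -
  have inj: "inj_on (cyc_shift k i) {1..k}"
  proof (rule inj_onI)
    fix a b assume "a \<in> {1..k}" "b \<in> {1..k}" "cyc_shift k i a = cyc_shift k i b"
    then have "a - 1 = b - 1" unfolding cyc_shift_def by (intro mod_eq_imp_eq[of i "a - 1" k "b - 1"]) auto
    then show "a = b" using \<open>a \<in> {1..k}\<close> \<open>b \<in> {1..k}\<close> by auto
  qed
  moreover have "cyc_shift k i ` {1..k} \<subseteq> {1..k}"
    using assms mod_less_divisor[of k] by (auto simp: cyc_shift_def Suc_le_eq)
  ultimately show ?thesis
    using endo_inj_surj[of "{1..k}" "cyc_shift k i"] by (simp add: bij_betw_def)
qed

lemma cyc_shift_last: "1 \<le> k \<Longrightarrow> i \<in> {1..k} \<Longrightarrow> cyc_shift k i k = i"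
proof -
  assume "1 \<le> k" "i \<in> {1..k}"
  then have "(i + (k - 1)) mod k = (k + (i - 1)) mod k" by (simp add: add.commute)
  also have "\<dots> = i - 1" using \<open>i \<in> {1..k}\<close> by (subst mod_add_self1) auto
  finally show ?thesis using \<open>i \<in> {1..k}\<close> by (simp add: cyc_shift_def)
qed

lemma cyc_shift_next:
  assumes "1 \<le> k" "j \<in> {1..k}"
  shows "cyc_shift k i (cyc_next k j) = cyc_next k (cyc_shift k i j)"
proof -
  have "cyc_shift k i (cyc_next k j) = (i + j) mod k + 1" by (simp add: cyc_shift_def cyc_next_def mod_add_right_eq)
  also have "\<dots> = (i + (j - 1) + 1) mod k + 1" using assms by simp
  also have "\<dots> = cyc_next k (cyc_shift k i j)" unfolding cyc_shift_def cyc_next_def by (simp only: mod_add_left_eq)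
  finally show ?thesis .
qed

lemma nth_rotate_cyc_shift:
  assumes "length p = k" "j \<in> {1..k}"
  shows "rotate i p ! (j - 1) = p ! (cyc_shift k i j - 1)"
  using assms by (subst nth_rotate) (auto simp: cyc_shift_def)

text \<open>
Each circular permutation consists of the \<open>k\<close> rotations of any of its members, which are distinct since the
entries of a permutation are.\<close>

lemma sum_permutations_circular:
  fixes F :: "nat list \<Rightarrow> 'c::comm_monoid_add"
  assumes k: "1 \<le> k" and rep: "\<And>C. C \<in> circular_perms k \<Longrightarrow> rep C \<in> C"
  shows "(\<Sum>p\<in>permutations_of_set {1..k}. F p) = (\<Sum>C\<in>circular_perms k. \<Sum>i\<in>{1..k}. F (rotate i (rep C)))"
proof -
  let ?A = "permutations_of_set {1..k}"
  let ?r = "{(p, q). p \<in> ?A \<and> q \<in> ?A \<and> (\<exists>n. q = rotate n p)}"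
  have rot_A: "rotate n p \<in> ?A" if "p \<in> ?A" for p n
    using that by (simp add: permutations_of_set_def)
  have len: "length p = k" if "p \<in> ?A" for p using length_finite_permutations_of_set[OF that] by simp
  have eq: "equiv ?A ?r"
  proof (rule equivI)
    show "refl_on ?A ?r" by (rule refl_onI) (auto intro: exI[of _ 0])
    show "sym ?r"
    proof (rule symI)
      fix p q assume "(p, q) \<in> ?r"
      then obtain n where n: "p \<in> ?A" "q \<in> ?A" "q = rotate n p" by auto
      have "rotate (k * n - n) q = rotate (k * n - n + n) p" using n by (simp add: rotate_rotate)
      also have "k * n - n + n = k * n" using k by simp
      also have "rotate (k * n) p = p" using len[OF n(1)] by (metis mod_mult_self1_is_0 rotate_id)
      finally show "(q, p) \<in> ?r" using n by (auto intro: exI[of _ "k * n - n"])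
    qed
    show "trans ?r" by (rule transI) (auto simp: rotate_rotate)
  qed auto
  have fin: "finite ?A" by simp
  have "(\<Sum>p\<in>?A. F p) = (\<Sum>p\<in>\<Union>(?A // ?r). F p)" using Union_quotient[OF eq] by simp
  also have "\<dots> = (\<Sum>C\<in>?A // ?r. \<Sum>p\<in>C. F p)"
  proof (subst sum.Union_disjoint)
    show "\<forall>C\<in>?A // ?r. finite C" using finite_equiv_class[OF fin] equiv_type[OF eq] by blast
    show "\<forall>C\<in>?A // ?r. \<forall>D\<in>?A // ?r. C \<noteq> D \<longrightarrow> C \<inter> D = {}" using quotient_disj[OF eq] by blast
  qed simp
  also have "\<dots> = (\<Sum>C\<in>circular_perms k. \<Sum>i\<in>{1..k}. F (rotate i (rep C)))"
    unfolding circular_perms_def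
  proof (rule sum.cong[OF refl])
    fix C assume C: "C \<in> ?A // ?r"
    define p where "p = rep C"
    have p: "p \<in> C" using rep[of C] C unfolding circular_perms_def p_def by simp
    have pA: "p \<in> ?A" using in_quotient_imp_subset[OF eq C] p by auto
    have C_eq: "C = ?r `` {p}"
    proof -
      obtain q where q: "C = ?r `` {q}" using C by (rule quotientE)
      then have "(q, p) \<in> ?r" using p by simp
      then show ?thesis using equiv_class_eq[OF eq] q by simp
    qed
    have k_len: "length p = k" using len[OF pA] .
    have "C = (\<lambda>i. rotate i p) ` {1..k}"
    proof
      show "C \<subseteq> (\<lambda>i. rotate i p) ` {1..k}"
      proof
        fix q assume "q \<in> C"
        then obtain n where n: "q = rotate n p" using C_eq by auto
        show "q \<in> (\<lambda>i. rotate i p) ` {1..k}"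
        proof (cases "n mod k = 0")
          case True
          then have "q = p" using n k_len by (metis rotate_id)
          moreover have "rotate k p = p" using k_len by (metis mod_self rotate_id)
          ultimately show ?thesis using k by (intro image_eqI[of _ _ k]) auto
        next
          case False
          have "q = rotate (n mod k) p" using n k_len rotate_conv_mod[of n p] by simp
          moreover have "n mod k < k" using k by (intro mod_less_divisor) simp
          ultimately show ?thesis using False by (intro image_eqI[of _ _ "n mod k"]) auto
        qed
      qed
      show "(\<lambda>i. rotate i p) ` {1..k} \<subseteq> C" using C_eq pA rot_A by auto
    qed
    moreover have "inj_on (\<lambda>i. rotate i p) {1..k}"
    proof (rule inj_onI)
      fix i j assume ij: "i \<in> {1..k}" "j \<in> {1..k}" "rotate i p = rotate j p"
      have "p ! (i mod k) = p ! (j mod k)"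
        using ij(3) k nth_rotate[of 0 p i] nth_rotate[of 0 p j] k_len by simp
      moreover have "distinct p" using pA by (simp add: permutations_of_set_def)
      moreover have "i mod k < k" "j mod k < k" using k by (auto intro: mod_less_divisor)
      ultimately have "i mod k = j mod k" using nth_eq_iff_index_eq k_len by blast
      then have "(1 + (i - 1)) mod k = (1 + (j - 1)) mod k" using ij by simp
      then have "i - 1 = j - 1" by (rule mod_eq_imp_eq) (use ij in auto)
      then show "i = j" using ij by auto
    qed
    ultimately show "(\<Sum>p\<in>C. F p) = (\<Sum>i\<in>{1..k}. F (rotate i (rep C)))"
      unfolding p_def[symmetric] by (simp add: sum.reindex)
  qed
  finally show ?thesis .
qed

context process_with_potential_densities
begin

abbreviation Pm :: "nat set \<Rightarrow> (nat \<Rightarrow> 'a) measure" where "Pm I \<equiv> Pi\<^sub>M I (\<lambda>_. m)"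

sublocale product_m: product_sigma_finite "\<lambda>_ :: nat. m"
  by (simp add: product_sigma_finite_def m.sigma_finite_measure_axioms)

lemma component_Pm: "j \<in> I \<Longrightarrow> (\<lambda>w. w j) \<in> Pm I \<rightarrow>\<^sub>M borel"
  using measurable_component_singleton[of j I "\<lambda>_. m"] by (subst measurable_cong_sets[OF refl sets_m[symmetric]])

lemma chain_snoc:
  assumes g[measurable]: "(\<lambda>(x, y). g x y) \<in> borel_measurable (borel \<Otimes>\<^sub>M (borel :: 'a measure))"
    and f[measurable]: "\<And>j. f j \<in> borel_measurable borel"
  shows "chain m g f (p @ [j]) x z = (\<integral>\<^sup>+y. chain m g f p x y * (f j y * g y z) \<partial>m)"
proof (induction p arbitrary: x)
  case Nil
  then show ?case by simp
next
  case (Cons i p)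
  have "chain m g f ((i # p) @ [j]) x z =
      (\<integral>\<^sup>+y. g x y * (f i y * (\<integral>\<^sup>+y'. chain m g f p y y' * (f j y' * g y' z) \<partial>m)) \<partial>m)"
    by (simp add: Cons)
  also have "\<dots> = (\<integral>\<^sup>+y. (\<integral>\<^sup>+y'. g x y * f i y * (chain m g f p y y' * (f j y' * g y' z)) \<partial>m) \<partial>m)"
    by (intro nn_integral_cong) (simp add: mult.assoc nn_integral_cmult)
  also have "\<dots> = (\<integral>\<^sup>+y'. (\<integral>\<^sup>+y. g x y * f i y * (chain m g f p y y' * (f j y' * g y' z)) \<partial>m) \<partial>m)"
    by (rule pair_sigma_finite.Fubini'[OF pair_m]) measurable
  also have "\<dots> = (\<integral>\<^sup>+y'. (\<integral>\<^sup>+y. g x y * (f i y * chain m g f p y y') * (f j y' * g y' z) \<partial>m) \<partial>m)"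
    by (simp add: mult_ac)
  also have "\<dots> = (\<integral>\<^sup>+y'. chain m g f (i # p) x y' * (f j y' * g y' z) \<partial>m)"
    by (simp add: nn_integral_multc)
  finally show ?case .
qed

lemma nn_integral_Pm_Suc:
  assumes "F \<in> borel_measurable (Pm {1..Suc n})"
  shows "(\<integral>\<^sup>+w. F w \<partial>Pm {1..Suc n}) = (\<integral>\<^sup>+y. (\<integral>\<^sup>+w. F (w(Suc n := y)) \<partial>Pm {1..n}) \<partial>m)"
proof -
  have ins: "{1..Suc n} = insert (Suc n) {1..n}" by auto
  show ?thesis
    using assms unfolding ins by (intro product_m.product_nn_integral_insert_rev) auto
qed

text \<open>The coordinate \<open>w 0 := x\<close> supplies the starting point, so that every edge has the form
\<open>g (w (j - 1)) (w j)\<close>.\<close>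

lemma chain_eq_nn_integral_Pm:
  assumes g[measurable]: "(\<lambda>(x, y). g x y) \<in> borel_measurable (borel \<Otimes>\<^sub>M (borel :: 'a measure))"
    and f[measurable]: "\<And>j. f j \<in> borel_measurable borel"
  shows "chain m g f p x z = (\<integral>\<^sup>+w. (\<Prod>j\<in>{1..length p}. g ((w(0 := x)) (j - 1)) (w j) * f (p ! (j - 1)) (w j)) *
    g ((w(0 := x)) (length p)) z \<partial>Pm {1..length p})"
proof (induction p arbitrary: z rule: rev_induct)
  case Nil
  then show ?case by (simp add: PiM_empty nn_integral_count_space_finite)
next
  case (snoc i p)
  define n where "n = length p"
  define c where "c w j = (w(0 := x)) j" for w :: "nat \<Rightarrow> 'a" and j
  have c_meas: "(\<lambda>w. c w j) \<in> Pm {1..k} \<rightarrow>\<^sub>M borel" if "j \<le> k" for j k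
    using that component_Pm[of j "{1..k}"] unfolding c_def by (cases "j = 0") auto
  have c_upd: "c (w(Suc n := y)) j = c w j" if "j \<le> n" for w y j using that by (simp add: c_def)
  let ?P = "\<lambda>w. \<Prod>j\<in>{1..n}. g (c w (j - 1)) (w j) * f (p ! (j - 1)) (w j)"
  let ?F = "\<lambda>w. (\<Prod>j\<in>{1..Suc n}. g (c w (j - 1)) (w j) * f ((p @ [i]) ! (j - 1)) (w j)) * g (c w (Suc n)) z"
  have prod_meas: "(\<lambda>w. \<Prod>j\<in>{1..l}. g (c w (j - 1)) (w j) * f (q ! (j - 1)) (w j)) \<in> borel_measurable (Pm {1..l})" for l and q :: "'b list"
  proof (rule borel_measurable_prod_ennreal)
    fix j assume j: "j \<in> {1..l}"
    have [measurable]: "(\<lambda>w. c w (j - 1)) \<in> Pm {1..l} \<rightarrow>\<^sub>M borel"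
      by (rule c_meas) (use j in auto)
    have [measurable]: "(\<lambda>w. w j) \<in> Pm {1..l} \<rightarrow>\<^sub>M borel" by (rule component_Pm[OF j])
    show "(\<lambda>w. g (c w (j - 1)) (w j) * f (q ! (j - 1)) (w j)) \<in> borel_measurable (Pm {1..l})" by measurable
  qed
  have [measurable]: "?P \<in> borel_measurable (Pm {1..n})" by (rule prod_meas)
  have [measurable]: "(\<lambda>w. c w l) \<in> Pm {1..l} \<rightarrow>\<^sub>M borel" for l by (rule c_meas) simp
  have F_meas: "?F \<in> borel_measurable (Pm {1..Suc n})" using prod_meas[where l = "Suc n" and q = "p @ [i]"] by measurable
  have ins: "{1..Suc n} = insert (Suc n) {1..n}" by auto
  have upd: "?F (w(Suc n := y)) = (?P w * g (c w n) y) * (f i y * g y z)" for w y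
  proof -
    have F: "?F (w(Suc n := y)) = (\<Prod>j\<in>{1..n}. g (c (w(Suc n := y)) (j - 1)) ((w(Suc n := y)) j) * f ((p @ [i]) ! (j - 1)) ((w(Suc n := y)) j)) *
        (g (c (w(Suc n := y)) n) y * f ((p @ [i]) ! n) y) * g (c (w(Suc n := y)) (Suc n)) z"
      unfolding ins by (subst prod.insert) (simp_all add: mult_ac)
    have prod: "(\<Prod>j\<in>{1..n}. g (c (w(Suc n := y)) (j - 1)) ((w(Suc n := y)) j) * f ((p @ [i]) ! (j - 1)) ((w(Suc n := y)) j)) = ?P w"
    proof (rule prod.cong[OF refl])
      fix j assume j: "j \<in> {1..n}"
      then have "(w(Suc n := y)) j = w j" "(p @ [i]) ! (j - 1) = p ! (j - 1)"
        by (auto simp: nth_append n_def)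
      moreover have "c (w(Suc n := y)) (j - 1) = c w (j - 1)" by (rule c_upd) (use j in auto)
      ultimately show "g (c (w(Suc n := y)) (j - 1)) ((w(Suc n := y)) j) * f ((p @ [i]) ! (j - 1)) ((w(Suc n := y)) j) =
        g (c w (j - 1)) (w j) * f (p ! (j - 1)) (w j)" by (simp only:)
    qed
    have cn: "c (w(Suc n := y)) n = c w n" by (simp add: c_upd)
    have cSuc: "c (w(Suc n := y)) (Suc n) = y" by (simp add: c_def)
    have last: "(p @ [i]) ! n = i" by (simp add: n_def)
    show ?thesis unfolding F unfolding prod cn cSuc last by (simp only: mult_ac)
  qed
  have "(\<integral>\<^sup>+w. ?F w \<partial>Pm {1..Suc n}) = (\<integral>\<^sup>+y. (\<integral>\<^sup>+w. ?F (w(Suc n := y)) \<partial>Pm {1..n}) \<partial>m)"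
    by (rule nn_integral_Pm_Suc[OF F_meas])
  also have "\<dots> = (\<integral>\<^sup>+y. (\<integral>\<^sup>+w. ?P w * g (c w n) y \<partial>Pm {1..n}) * (f i y * g y z) \<partial>m)"
    unfolding upd by (intro nn_integral_cong nn_integral_multc) measurable
  also have "\<dots> = (\<integral>\<^sup>+y. chain m g f p x y * (f i y * g y z) \<partial>m)"
    unfolding snoc.IH c_def n_def ..
  also have "\<dots> = chain m g f (p @ [i]) x z" by (rule chain_snoc[OF g f, symmetric])
  finally show ?case unfolding c_def n_def by simp
qed

lemma chain_diagonal:
  assumes g: "(\<lambda>(x, y). g x y) \<in> borel_measurable (borel \<Otimes>\<^sub>M (borel :: 'a measure))"
    and f: "\<And>j. f j \<in> borel_measurable borel"
    and p: "length p = k" and k: "1 \<le> k"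
  shows "chain m g f p z z = (\<integral>\<^sup>+w. (\<Prod>j\<in>{1..k}. f (p ! (j - 1)) (w j)) *
    (\<Prod>j\<in>{1..<k}. g (w j) (w (Suc j))) * (g (w k) z * g z (w 1)) \<partial>Pm {1..k})"
proof -
  let ?A = "\<lambda>w. \<Prod>j\<in>{1..k}. f (p ! (j - 1)) (w j)"
  let ?B = "\<lambda>w. \<Prod>j\<in>{1..<k}. g (w j) (w (Suc j))"
  have "(\<Prod>j\<in>{1..k}. g ((w(0 := z)) (j - 1)) (w j) * f (p ! (j - 1)) (w j)) * g ((w(0 := z)) k) z =
      ?A w * ?B w * (g (w k) z * g z (w 1))" for w
  proof -
    have "(\<Prod>j\<in>{1..k}. g ((w(0 := z)) (j - 1)) (w j)) = g z (w 1) * (\<Prod>j\<in>{Suc 1..k}. g ((w(0 := z)) (j - 1)) (w j))"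
      using k by (subst prod.atLeast_Suc_atMost) auto
    also have "(\<Prod>j\<in>{Suc 1..k}. g ((w(0 := z)) (j - 1)) (w j)) = ?B w"
    proof -
      have "{Suc 1..k} = Suc ` {1..<k}" using k by (auto simp: image_iff)
      then have "(\<Prod>j\<in>{Suc 1..k}. g ((w(0 := z)) (j - 1)) (w j)) = (\<Prod>j\<in>{1..<k}. g ((w(0 := z)) (Suc j - 1)) (w (Suc j)))"
        by (simp only: prod.reindex[OF inj_Suc] comp_def)
      also have "\<dots> = ?B w" by (intro prod.cong) auto
      finally show ?thesis .
    qed
    finally show ?thesis using k by (simp add: prod.distrib mult_ac)
  qed
  then show ?thesis by (subst chain_eq_nn_integral_Pm[OF g f]) (simp only: p)
qed

text \<open>Integration over the root \<open>z\<close> joins the first and last edges of the chain into one edge, from \<open>w k\<close> to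
\<open>w 1\<close>, of the iterated kernel.\<close>

lemma nn_integral_chain_diagonal:
  assumes g[measurable]: "(\<lambda>(x, y). g x y) \<in> borel_measurable (borel \<Otimes>\<^sub>M (borel :: 'a measure))"
    and f[measurable]: "\<And>j. f j \<in> borel_measurable borel"
    and p: "length p = k" and k: "1 \<le> k"
  shows "(\<integral>\<^sup>+z. chain m g f p z z \<partial>m) = (\<integral>\<^sup>+w. (\<Prod>j\<in>{1..k}. f (p ! (j - 1)) (w j)) *
    ((\<integral>\<^sup>+z. g (w k) z * g z (w 1) \<partial>m) * (\<Prod>j\<in>{1..<k}. g (w j) (w (Suc j)))) \<partial>Pm {1..k})"
proof -
  have gg: "(\<lambda>z. g a z * g z b) \<in> borel_measurable borel" for a b by measurable
  interpret P: finite_product_sigma_finite "\<lambda>_. m" "{1..k}" by standard simp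
  have P_sf: "pair_sigma_finite m (Pm {1..k})"
    by (intro pair_sigma_finite.intro m.sigma_finite_measure_axioms P.sigma_finite_measure_axioms)
  let ?A = "\<lambda>w. \<Prod>j\<in>{1..k}. f (p ! (j - 1)) (w j)"
  let ?B = "\<lambda>w. \<Prod>j\<in>{1..<k}. g (w j) (w (Suc j))"
  have comp: "(\<lambda>w. w j) \<in> Pm {1..k} \<rightarrow>\<^sub>M borel" if "j \<in> {1..k}" for j using that by (rule component_Pm)
  have [measurable]: "?A \<in> borel_measurable (Pm {1..k})"
    by (intro borel_measurable_prod_ennreal measurable_compose[OF comp f]) auto
  have [measurable]: "?B \<in> borel_measurable (Pm {1..k})"
  proof (rule borel_measurable_prod_ennreal)
    fix j assume j: "j \<in> {1..<k}"
    have [measurable]: "(\<lambda>w. w j) \<in> Pm {1..k} \<rightarrow>\<^sub>M borel" "(\<lambda>w. w (Suc j)) \<in> Pm {1..k} \<rightarrow>\<^sub>M borel"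
      using j by (auto intro!: comp)
    show "(\<lambda>w. g (w j) (w (Suc j))) \<in> borel_measurable (Pm {1..k})" by measurable
  qed
  have [measurable]: "(\<lambda>w. w k) \<in> Pm {1..k} \<rightarrow>\<^sub>M borel" "(\<lambda>w. w 1) \<in> Pm {1..k} \<rightarrow>\<^sub>M borel"
    using k by (auto intro!: comp)
  have "(\<integral>\<^sup>+z. chain m g f p z z \<partial>m) = (\<integral>\<^sup>+z. (\<integral>\<^sup>+w. ?A w * ?B w * (g (w k) z * g z (w 1)) \<partial>Pm {1..k}) \<partial>m)"
    by (simp only: chain_diagonal[OF g f p k])
  also have "\<dots> = (\<integral>\<^sup>+w. (\<integral>\<^sup>+z. ?A w * ?B w * (g (w k) z * g z (w 1)) \<partial>m) \<partial>Pm {1..k})"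
    by (rule pair_sigma_finite.Fubini'[OF P_sf, symmetric]) measurable
  also have "\<dots> = (\<integral>\<^sup>+w. ?A w * ?B w * (\<integral>\<^sup>+z. g (w k) z * g z (w 1) \<partial>m) \<partial>Pm {1..k})"
  proof (rule nn_integral_cong)
    fix w
    show "(\<integral>\<^sup>+z. ?A w * ?B w * (g (w k) z * g z (w 1)) \<partial>m) = ?A w * ?B w * (\<integral>\<^sup>+z. g (w k) z * g z (w 1) \<partial>m)"
      by (rule nn_integral_cmult) (simp add: gg)
  qed
  finally show ?thesis by (simp add: mult_ac)
qed

text \<open>Identities such as \<open>u_eq_tail_v\<close> hold for almost every second argument when the first is fixed. By Fubini
they hold almost everywhere along an edge joining two different coordinates; all edges of a cycle of
length at least two are of this kind.\<close>

lemma AE_Pm_pair: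
  assumes I: "finite I" "i \<in> I" "j \<in> I" "i \<noteq> j"
    and P[measurable]: "Measurable.pred (borel \<Otimes>\<^sub>M borel) (\<lambda>q. P (fst q) (snd q))"
    and ae: "\<And>x. AE y in m. P x y"
  shows "AE w in Pm I. P (w i) (w j)"
proof -
  define N where "N x y = (if P x y then 0 else 1 :: ennreal)" for x y
  have N_pair: "(\<lambda>q. N (fst q) (snd q)) \<in> borel_measurable (borel \<Otimes>\<^sub>M borel)"
    unfolding N_def by measurable
  have N_Pm: "(\<lambda>w. N (w i) (w j)) \<in> borel_measurable (Pm I)"
    using measurable_compose[OF _ N_pair, of "\<lambda>w. (w i, w j)" "Pm I"] I component_Pm by simp
  have ins: "insert j (I - {j}) = I" using I by auto
  have "(\<integral>\<^sup>+w. N (w i) (w j) \<partial>Pm (insert j (I - {j}))) =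
      (\<integral>\<^sup>+w. (\<integral>\<^sup>+y. N ((w(j := y)) i) ((w(j := y)) j) \<partial>m) \<partial>Pm (I - {j}))"
    by (rule product_m.product_nn_integral_insert) (use I N_Pm in \<open>simp_all only: ins, simp_all\<close>)
  also have "\<dots> = (\<integral>\<^sup>+w. (\<integral>\<^sup>+y. 0 \<partial>m) \<partial>Pm (I - {j}))"
  proof (rule nn_integral_cong)
    fix w
    show "(\<integral>\<^sup>+y. N ((w(j := y)) i) ((w(j := y)) j) \<partial>m) = (\<integral>\<^sup>+y. 0 \<partial>m)"
      using ae[of "w i"] I(4) by (intro nn_integral_cong_AE) (auto elim!: eventually_mono simp: N_def)
  qed
  finally have "(\<integral>\<^sup>+w. N (w i) (w j) \<partial>Pm (insert j (I - {j}))) = 0" by simp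
  then have "(\<integral>\<^sup>+w. N (w i) (w j) \<partial>Pm I) = 0" unfolding ins .
  then have "AE w in Pm I. N (w i) (w j) = 0" using nn_integral_0_iff_AE[OF N_Pm] by simp
  then show ?thesis by eventually_elim (simp add: N_def split: if_splits)
qed

text \<open>It suffices to compare boxes, whose measure is a product that may be reordered. The lemma lets the variables of
a cycle be rotated.\<close>

lemma nn_integral_Pm_reindex:
  assumes I: "finite I" and \<sigma>: "bij_betw \<sigma> I I" and F: "F \<in> borel_measurable (Pm I)"
  shows "(\<integral>\<^sup>+w. F w \<partial>Pm I) = (\<integral>\<^sup>+w. F (\<lambda>j\<in>I. w (\<sigma> j)) \<partial>Pm I)"
proof -
  let ?s = "\<lambda>w. \<lambda>j\<in>I. w (\<sigma> j)"
  have \<sigma>_in: "\<sigma> j \<in> I" if "j \<in> I" for j using \<sigma> that by (auto simp: bij_betw_def)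
  have s[measurable]: "?s \<in> Pm I \<rightarrow>\<^sub>M Pm I"
    by (rule measurable_restrict) (rule measurable_component_singleton[OF \<sigma>_in])
  have "distr (Pm I) (Pm I) ?s = Pm I"
  proof (rule product_m.PiM_eqI[OF I])
    fix A :: "nat \<Rightarrow> 'a set" assume A: "\<And>i. i \<in> I \<Longrightarrow> A i \<in> sets m"
    let ?\<tau> = "inv_into I \<sigma>"
    have \<tau>: "?\<tau> i \<in> I" if "i \<in> I" for i using that \<sigma> by (metis bij_betw_def inv_into_into)
    have \<tau>\<sigma>: "?\<tau> (\<sigma> j) = j" if "j \<in> I" for j using that \<sigma> by (simp add: bij_betw_def)
    have \<sigma>\<tau>: "\<sigma> (?\<tau> i) = i" if "i \<in> I" for i using that \<sigma> by (simp add: bij_betw_def f_inv_into_f)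
    have "emeasure (distr (Pm I) (Pm I) ?s) (Pi\<^sub>E I A) = emeasure (Pm I) (?s -` Pi\<^sub>E I A \<inter> space (Pm I))"
      using I A by (intro emeasure_distr s sets_PiM_I_finite) auto
    also have "?s -` Pi\<^sub>E I A \<inter> space (Pm I) = Pi\<^sub>E I (\<lambda>i. A (?\<tau> i))"
    proof (rule set_eqI)
      fix w
      have "w \<in> ?s -` Pi\<^sub>E I A \<inter> space (Pm I) \<longleftrightarrow> (\<forall>j\<in>I. w (\<sigma> j) \<in> A j) \<and> w \<in> extensional I"
        by (auto simp: space_PiM PiE_iff)
      also have "\<dots> \<longleftrightarrow> (\<forall>i\<in>I. w i \<in> A (?\<tau> i)) \<and> w \<in> extensional I"
        using \<sigma>_in \<tau> \<tau>\<sigma> \<sigma>\<tau> by metis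
      also have "\<dots> \<longleftrightarrow> w \<in> Pi\<^sub>E I (\<lambda>i. A (?\<tau> i))" by (auto simp: PiE_iff)
      finally show "w \<in> ?s -` Pi\<^sub>E I A \<inter> space (Pm I) \<longleftrightarrow> w \<in> Pi\<^sub>E I (\<lambda>i. A (?\<tau> i))" .
    qed
    also have "emeasure (Pm I) (Pi\<^sub>E I (\<lambda>i. A (?\<tau> i))) = (\<Prod>i\<in>I. emeasure m (A (?\<tau> i)))"
      using I A \<tau> by (intro product_m.emeasure_PiM) auto
    also have "\<dots> = (\<Prod>i\<in>I. emeasure m (A i))"
      using prod.reindex_bij_betw[OF bij_betw_inv_into[OF \<sigma>]] .
    finally show "emeasure (distr (Pm I) (Pm I) ?s) (Pi\<^sub>E I A) = (\<Prod>i\<in>I. emeasure m (A i))" .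
  qed simp
  then have "(\<integral>\<^sup>+w. F w \<partial>Pm I) = (\<integral>\<^sup>+w. F w \<partial>distr (Pm I) (Pm I) ?s)" by simp
  also have "\<dots> = (\<integral>\<^sup>+w. F (?s w) \<partial>Pm I)" by (rule nn_integral_distr[OF s]) (use F in simp)
  finally show ?thesis .
qed

text \<open>A cycle whose edge leaving \<open>i\<close> is marked and carries \<open>v\<^sup>\<alpha>\<close>. The tails on the other edges are \<open>u\<^sup>\<alpha>\<close> by
\<open>u_eq_tail_v\<close>; as tails they are jointly measurable in \<open>\<alpha>\<close>.\<close>

definition rooted_cycle :: "(nat \<Rightarrow> 'a \<Rightarrow> ennreal) \<Rightarrow> nat \<Rightarrow> nat \<Rightarrow> nat list \<Rightarrow> real \<Rightarrow> ennreal" where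
  "rooted_cycle f k i p \<alpha> = (\<integral>\<^sup>+w. (\<Prod>j\<in>{1..k}. f (p ! (j - 1)) (w j)) *
    (v \<alpha> (w i) (w (cyc_next k i)) *
      (\<Prod>j\<in>{1..k} - {i}. tail (\<lambda>\<beta>. v \<beta> (w j) (w (cyc_next k j))) \<alpha>)) \<partial>Pm {1..k})"

lemma measurable_tail_v[measurable]:
  assumes [measurable]: "a \<in> borel_measurable N" "f \<in> N \<rightarrow>\<^sub>M borel" "g \<in> N \<rightarrow>\<^sub>M borel"
  shows "(\<lambda>x. tail (\<lambda>\<beta>. v \<beta> (f x) (g x)) (a x)) \<in> borel_measurable N"
  by (rule measurable_tail) measurable

lemma measurable_rooted_integrand:
  assumes k: "1 \<le> k" and i: "i \<in> {1..k}" and f[measurable]: "\<And>j. f j \<in> borel_measurable borel"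
    and a[measurable]: "a \<in> borel_measurable N" and W: "W \<in> N \<rightarrow>\<^sub>M Pm {1..k}"
  shows "(\<lambda>x. (\<Prod>j\<in>{1..k}. f (p ! (j - 1)) (W x j)) *
    (v (a x) (W x i) (W x (cyc_next k i)) *
      (\<Prod>j\<in>{1..k} - {i}. tail (\<lambda>\<beta>. v \<beta> (W x j) (W x (cyc_next k j))) (a x)))) \<in> borel_measurable N"
proof -
  have comp: "(\<lambda>x. W x j) \<in> N \<rightarrow>\<^sub>M borel" if "j \<in> {1..k}" for j
    using measurable_compose[OF W component_Pm[OF that]] .
  note [measurable] = comp[OF i] comp[OF cyc_next_in[OF k]]
  have [measurable]: "(\<lambda>x. \<Prod>j\<in>{1..k}. f (p ! (j - 1)) (W x j)) \<in> borel_measurable N"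
    by (intro borel_measurable_prod_ennreal measurable_compose[OF comp f])
  have [measurable]: "(\<lambda>x. \<Prod>j\<in>{1..k} - {i}. tail (\<lambda>\<beta>. v \<beta> (W x j) (W x (cyc_next k j))) (a x)) \<in> borel_measurable N"
    using a by (intro borel_measurable_prod_ennreal measurable_tail_v comp cyc_next_in[OF k]) auto
  show ?thesis by measurable
qed

lemma measurable_rooted_cycle:
  assumes k: "1 \<le> k" and i: "i \<in> {1..k}" and f: "\<And>j. f j \<in> borel_measurable borel"
  shows "rooted_cycle f k i p \<in> borel_measurable borel"
proof -
  interpret P: finite_product_sigma_finite "\<lambda>_. m" "{1..k}" by standard simp
  have "(\<lambda>\<alpha>. rooted_cycle f k i p \<alpha>) \<in> borel_measurable borel"
    unfolding rooted_cycle_def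
    by (rule P.borel_measurable_nn_integral)
      (unfold case_prod_unfold, rule measurable_rooted_integrand[OF k i f], measurable)
  then show ?thesis by simp
qed

text \<open>The edge through the root becomes the marked edge, which leaves the last position.\<close>

lemma nn_integral_chain_loop:
  assumes \<alpha>: "0 \<le> \<alpha>" and f: "\<And>j. f j \<in> borel_measurable borel"
    and p: "length p = k" and k: "2 \<le> k"
  shows "(\<integral>\<^sup>+z. chain m (u \<alpha>) f p z z \<partial>m) = rooted_cycle f k k p \<alpha>"
proof -
  have k1: "1 \<le> k" using k by simp
  note \<alpha>[measurable]
  have u_pair[measurable]: "(\<lambda>(x, y). u \<alpha> x y) \<in> borel_measurable (borel \<Otimes>\<^sub>M borel)" using \<alpha> by (rule u_measurable)
  have "AE w in Pm {1..k}. (\<integral>\<^sup>+z. u \<alpha> (w k) z * u \<alpha> z (w 1) \<partial>m) = v \<alpha> (w k) (w 1)"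
    using k by (intro AE_Pm_pair v_eq[OF \<alpha>]) auto
  moreover have "AE w in Pm {1..k}. \<forall>j\<in>{1..<k}. u \<alpha> (w j) (w (Suc j)) = tail (\<lambda>\<beta>. v \<beta> (w j) (w (Suc j))) \<alpha>"
  proof (rule AE_finite_allI)
    fix j assume "j \<in> {1..<k}"
    then show "AE w in Pm {1..k}. u \<alpha> (w j) (w (Suc j)) = tail (\<lambda>\<beta>. v \<beta> (w j) (w (Suc j))) \<alpha>"
      by (intro AE_Pm_pair u_eq_tail_v[OF \<alpha>]) auto
  qed simp
  moreover have "{1..k} - {k} = {1..<k}" by auto
  ultimately show ?thesis
    unfolding nn_integral_chain_diagonal[OF u_pair f p k1] rooted_cycle_def cyc_next_last
    by (intro nn_integral_cong_AE) (auto elim!: eventually_elim2 intro!: arg_cong2[where f = "(*)"] prod.cong simp: cyc_next_less)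
qed

text \<open>
Each edge carries \<open>u\<^sup>0 = \<integral> v\<^sup>\<alpha> d\<alpha>\<close>. In the product of these integrals the edge with the smallest \<open>\<alpha>\<close> is
the marked one, and the others retain the integrals over larger values.\<close>

lemma nn_integral_cycle:
  assumes f: "\<And>j. f j \<in> borel_measurable borel" and k: "2 \<le> k"
  shows "(\<integral>\<^sup>+w. (\<Prod>j\<in>{1..k}. f (p ! (j - 1)) (w j)) * (\<Prod>j\<in>{1..k}. u 0 (w j) (w (cyc_next k j))) \<partial>Pm {1..k}) =
    (\<Sum>i\<in>{1..k}. tail (rooted_cycle f k i p) 0)"
proof -
  have k1: "1 \<le> k" using k by simp
  interpret P: finite_product_sigma_finite "\<lambda>_. m" "{1..k}" by standard simp
  interpret PP: pair_sigma_finite lborel "Pm {1..k}"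
    by (intro pair_sigma_finite.intro P.sigma_finite_measure_axioms lborel.sigma_finite_measure_axioms)
  let ?A = "\<lambda>w. \<Prod>j\<in>{1..k}. f (p ! (j - 1)) (w j)"
  let ?e = "\<lambda>w j \<beta>. v \<beta> (w j) (w (cyc_next k j))"
  define H where "H i \<alpha> w = ?A w * (?e w i \<alpha> * (\<Prod>j\<in>{1..k} - {i}. tail (?e w j) \<alpha>))" for i \<alpha> w
  have H_meas: "(\<lambda>q. H i (fst q) (snd q)) \<in> borel_measurable (borel \<Otimes>\<^sub>M Pm {1..k})" if "i \<in> {1..k}" for i
    unfolding H_def by (rule measurable_rooted_integrand[OF k1 that f, where a = fst and W = snd]) simp_all
  have "AE w in Pm {1..k}. \<forall>j\<in>{1..k}. u 0 (w j) (w (cyc_next k j)) = tail (?e w j) 0"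
  proof (rule AE_finite_allI)
    fix j assume j: "j \<in> {1..k}"
    show "AE w in Pm {1..k}. u 0 (w j) (w (cyc_next k j)) = tail (?e w j) 0"
      using j cyc_next_in[OF k1] cyc_next_neq[OF k j] by (intro AE_Pm_pair u_eq_tail_v) auto
  qed simp
  then have "(\<integral>\<^sup>+w. ?A w * (\<Prod>j\<in>{1..k}. u 0 (w j) (w (cyc_next k j))) \<partial>Pm {1..k}) =
      (\<integral>\<^sup>+w. ?A w * (\<Prod>j\<in>{1..k}. tail (?e w j) 0) \<partial>Pm {1..k})"
    by (intro nn_integral_cong_AE) (auto elim!: eventually_mono)
  also have "\<dots> = (\<integral>\<^sup>+w. (\<Sum>i\<in>{1..k}. \<integral>\<^sup>+\<alpha>. H i \<alpha> w * indicator {0<..} \<alpha> \<partial>lborel) \<partial>Pm {1..k})"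
  proof (rule nn_integral_cong)
    fix w
    have "(\<Prod>j\<in>{1..k}. tail (?e w j) 0) = (\<Sum>i\<in>{1..k}. tail (\<lambda>\<alpha>. ?e w i \<alpha> * (\<Prod>j\<in>{1..k} - {i}. tail (?e w j) \<alpha>)) 0)"
      using k by (intro prod_tail) auto
    also have "?A w * \<dots> = (\<Sum>i\<in>{1..k}. tail (\<lambda>\<alpha>. H i \<alpha> w) 0)"
      unfolding sum_distrib_left H_def by (intro sum.cong refl tail_mult_left[symmetric]) measurable
    finally show "?A w * (\<Prod>j\<in>{1..k}. tail (?e w j) 0) = (\<Sum>i\<in>{1..k}. \<integral>\<^sup>+\<alpha>. H i \<alpha> w * indicator {0<..} \<alpha> \<partial>lborel)"
      unfolding tail_def .
  qed
  also have "\<dots> = (\<Sum>i\<in>{1..k}. \<integral>\<^sup>+w. (\<integral>\<^sup>+\<alpha>. H i \<alpha> w * indicator {0<..} \<alpha> \<partial>lborel) \<partial>Pm {1..k})"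
  proof (rule nn_integral_sum)
    fix i assume i: "i \<in> {1..k}"
    have "(\<lambda>w. tail (\<lambda>\<alpha>. H i \<alpha> w) 0) \<in> borel_measurable (Pm {1..k})"
    proof (rule measurable_tail)
      have "(\<lambda>q. H i (snd q) (fst q)) \<in> borel_measurable (Pm {1..k} \<Otimes>\<^sub>M borel)"
        using measurable_compose[OF measurable_Pair[OF measurable_snd measurable_fst] H_meas[OF i]] by simp
      then show "(\<lambda>(w, \<alpha>). H i \<alpha> w) \<in> borel_measurable (Pm {1..k} \<Otimes>\<^sub>M borel)"
        by (simp only: case_prod_unfold)
    qed simp
    then show "(\<lambda>w. \<integral>\<^sup>+\<alpha>. H i \<alpha> w * indicator {0<..} \<alpha> \<partial>lborel) \<in> borel_measurable (Pm {1..k})"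
      unfolding tail_def .
  qed
  also have "\<dots> = (\<Sum>i\<in>{1..k}. tail (rooted_cycle f k i p) 0)"
  proof (rule sum.cong[OF refl])
    fix i assume i: "i \<in> {1..k}"
    have rooted: "rooted_cycle f k i p = (\<lambda>\<alpha>. \<integral>\<^sup>+w. H i \<alpha> w \<partial>Pm {1..k})"
      by (rule ext) (simp only: rooted_cycle_def H_def)
    have sec: "(\<lambda>w. H i \<alpha> w) \<in> borel_measurable (Pm {1..k})" for \<alpha>
      using measurable_compose[OF measurable_Pair1'[of \<alpha> borel "Pm {1..k}"] H_meas[OF i]] by simp
    have "(\<integral>\<^sup>+w. (\<integral>\<^sup>+\<alpha>. H i \<alpha> w * indicator {0<..} \<alpha> \<partial>lborel) \<partial>Pm {1..k}) =
        (\<integral>\<^sup>+\<alpha>. (\<integral>\<^sup>+w. H i \<alpha> w * indicator {0<..} \<alpha> \<partial>Pm {1..k}) \<partial>lborel)"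
    proof (rule PP.Fubini')
      note [measurable] = H_meas[OF i]
      have "(\<lambda>q. H i (fst q) (snd q) * indicator {0<..} (fst q)) \<in> borel_measurable (borel \<Otimes>\<^sub>M Pm {1..k})"
        by measurable
      then show "(\<lambda>(\<alpha>, w). H i \<alpha> w * indicator {0<..} \<alpha>) \<in> borel_measurable (lborel \<Otimes>\<^sub>M Pm {1..k})"
        unfolding case_prod_unfold by (subst measurable_cong_sets[OF sets_pair_measure_cong[OF sets_lborel refl] refl])
    qed
    also have "\<dots> = tail (rooted_cycle f k i p) 0"
      unfolding rooted unfolding tail_def by (intro nn_integral_cong nn_integral_multc sec)
    finally show "(\<integral>\<^sup>+w. (\<integral>\<^sup>+\<alpha>. H i \<alpha> w * indicator {0<..} \<alpha> \<partial>lborel) \<partial>Pm {1..k}) = tail (rooted_cycle f k i p) 0" .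
  qed
  finally show ?thesis .
qed

text \<open>Renaming the integration variables along \<open>cyc_shift k i\<close> moves the mark from \<open>k\<close> to \<open>i\<close> and turns the
rotated permutation back into \<open>p\<close>.\<close>

lemma rooted_cycle_rotate:
  assumes f: "\<And>j. f j \<in> borel_measurable borel" and k: "1 \<le> k" and i: "i \<in> {1..k}" and p: "length p = k"
  shows "rooted_cycle f k k (rotate i p) \<alpha> = rooted_cycle f k i p \<alpha>"
proof -
  let ?I = "{1..k}" and ?s = "cyc_shift k i"
  have bij: "bij_betw ?s ?I ?I" using k by (rule bij_betw_cyc_shift)
  have kI: "k \<in> ?I" using k by simp
  have sk: "?s k = i" using k i by (rule cyc_shift_last)
  have bij': "bij_betw ?s (?I - {k}) (?I - {i})"
    using bij_betw_DiffI[OF bij, of "{k}" "{i}"] kI i sk by (auto simp: bij_betw_def)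
  let ?A = "\<lambda>q w. \<Prod>j\<in>?I. f (q ! (j - 1)) (w j)"
  let ?T = "\<lambda>w j. tail (\<lambda>\<beta>. v \<beta> (w j) (w (cyc_next k j))) \<alpha>"
  let ?w = "\<lambda>w. \<lambda>j\<in>?I. w (?s j)"
  have next_w: "?w w (cyc_next k j) = w (cyc_next k (?s j))" if "j \<in> ?I" for w :: "nat \<Rightarrow> 'a" and j
    using that cyc_next_in[OF k] cyc_shift_next[OF k that] by simp
  have "rooted_cycle f k k (rotate i p) \<alpha> =
      (\<integral>\<^sup>+w. ?A (rotate i p) (?w w) * (v \<alpha> (?w w k) (?w w (cyc_next k k)) * (\<Prod>j\<in>?I - {k}. ?T (?w w) j)) \<partial>Pm ?I)"
    unfolding rooted_cycle_def
    by (rule nn_integral_Pm_reindex[OF _ bij]) (use measurable_rooted_integrand[OF k kI f, of "\<lambda>_. \<alpha>" "Pm ?I" "\<lambda>w. w"] in auto)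
  also have "\<dots> = rooted_cycle f k i p \<alpha>"
    unfolding rooted_cycle_def
  proof (rule nn_integral_cong)
    fix w :: "nat \<Rightarrow> 'a"
    have "?A (rotate i p) (?w w) = (\<Prod>j\<in>?I. f (p ! (?s j - 1)) (w (?s j)))"
      by (intro prod.cong refl) (simp only: nth_rotate_cyc_shift[OF p] restrict_apply if_True)
    also have "\<dots> = ?A p w" by (rule prod.reindex_bij_betw[OF bij])
    finally have A: "?A (rotate i p) (?w w) = ?A p w" .
    have "(\<Prod>j\<in>?I - {k}. ?T (?w w) j) = (\<Prod>j\<in>?I - {k}. ?T w (?s j))"
    proof (rule prod.cong[OF refl])
      fix j assume "j \<in> ?I - {k}"
      then have j: "j \<in> ?I" by simp
      then have "?w w j = w (?s j)" by simp
      then show "?T (?w w) j = ?T w (?s j)" by (simp only: next_w[OF j])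
    qed
    also have "\<dots> = (\<Prod>j\<in>?I - {i}. ?T w j)" by (rule prod.reindex_bij_betw[OF bij'])
    finally have T: "(\<Prod>j\<in>?I - {k}. ?T (?w w) j) = (\<Prod>j\<in>?I - {i}. ?T w j)" .
    have "?w w k = w i" using kI sk by simp
    moreover have "?w w (cyc_next k k) = w (cyc_next k i)" using next_w[OF kI] sk by simp
    ultimately show "?A (rotate i p) (?w w) * (v \<alpha> (?w w k) (?w w (cyc_next k k)) * (\<Prod>j\<in>?I - {k}. ?T (?w w) j)) =
      ?A p w * (v \<alpha> (w i) (w (cyc_next k i)) * (\<Prod>j\<in>?I - {i}. ?T w j))"
      unfolding A T by simp
  qed
  finally show ?thesis .
qed

text \<open>Fixing the last variable \<open>y\<close> leaves a chain from \<open>y\<close> to \<open>y\<close>, for which uniform bounds are available.\<close>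

lemma nn_integral_cycle_eq_chain:
  assumes f[measurable]: "\<And>j. f j \<in> borel_measurable borel" and q: "length q = n" "1 \<le> n"
  shows "(\<integral>\<^sup>+w. (\<Prod>j\<in>{1..Suc n}. f ((q @ [i]) ! (j - 1)) (w j)) * (\<Prod>j\<in>{1..Suc n}. u 0 (w j) (w (cyc_next (Suc n) j))) \<partial>Pm {1..Suc n}) =
    (\<integral>\<^sup>+y. f i y * chain m (u 0) f q y y \<partial>m)"
proof -
  let ?k = "Suc n"
  have u_pair[measurable]: "(\<lambda>(x, y). u 0 x y) \<in> borel_measurable (borel \<Otimes>\<^sub>M borel)" by (rule u_measurable) simp
  let ?F = "\<lambda>w. (\<Prod>j\<in>{1..?k}. f ((q @ [i]) ! (j - 1)) (w j)) * (\<Prod>j\<in>{1..?k}. u 0 (w j) (w (cyc_next ?k j)))"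
  let ?G = "\<lambda>y w. (\<Prod>j\<in>{1..n}. f (q ! (j - 1)) (w j)) * (\<Prod>j\<in>{1..<n}. u 0 (w j) (w (Suc j))) * (u 0 (w n) y * u 0 y (w 1))"
  have comp: "(\<lambda>w. w j) \<in> Pm {1..k} \<rightarrow>\<^sub>M borel" if "j \<in> {1..k}" for j k using that by (rule component_Pm)
  have F_meas: "?F \<in> borel_measurable (Pm {1..?k})"
    by (intro borel_measurable_times_ennreal borel_measurable_prod_ennreal measurable_compose[OF comp f] u_meas comp cyc_next_in) auto
  have G_meas: "?G y \<in> borel_measurable (Pm {1..n})" for y
    using q by (intro borel_measurable_times_ennreal borel_measurable_prod_ennreal measurable_compose[OF comp f] u_meas comp) auto
  have ins: "{1..?k} = insert ?k {1..n}" by auto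
  have upd: "?F (w(?k := y)) = f i y * ?G y w" for w y
  proof -
    let ?w = "w(?k := y)"
    have "(\<Prod>j\<in>{1..?k}. f ((q @ [i]) ! (j - 1)) (?w j)) = f i y * (\<Prod>j\<in>{1..n}. f ((q @ [i]) ! (j - 1)) (?w j))"
      unfolding ins using q by (subst prod.insert) auto
    also have "(\<Prod>j\<in>{1..n}. f ((q @ [i]) ! (j - 1)) (?w j)) = (\<Prod>j\<in>{1..n}. f (q ! (j - 1)) (w j))"
      using q by (intro prod.cong) (auto simp: nth_append)
    finally have A: "(\<Prod>j\<in>{1..?k}. f ((q @ [i]) ! (j - 1)) (?w j)) = f i y * (\<Prod>j\<in>{1..n}. f (q ! (j - 1)) (w j))" .
    have ins': "{1..n} = insert n {1..<n}" using q by auto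
    have "(\<Prod>j\<in>{1..?k}. u 0 (?w j) (?w (cyc_next ?k j))) = u 0 y (w 1) * (\<Prod>j\<in>{1..n}. u 0 (?w j) (?w (cyc_next ?k j)))"
      unfolding ins using q by (subst prod.insert) (auto simp: cyc_next_def)
    also have "(\<Prod>j\<in>{1..n}. u 0 (?w j) (?w (cyc_next ?k j))) = u 0 (w n) y * (\<Prod>j\<in>{1..<n}. u 0 (?w j) (?w (cyc_next ?k j)))"
      unfolding ins' by (subst prod.insert) (auto simp: cyc_next_less)
    also have "(\<Prod>j\<in>{1..<n}. u 0 (?w j) (?w (cyc_next ?k j))) = (\<Prod>j\<in>{1..<n}. u 0 (w j) (w (Suc j)))"
      by (intro prod.cong) (auto simp: cyc_next_less)
    finally have B: "(\<Prod>j\<in>{1..?k}. u 0 (?w j) (?w (cyc_next ?k j))) =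
        u 0 y (w 1) * (u 0 (w n) y * (\<Prod>j\<in>{1..<n}. u 0 (w j) (w (Suc j))))" .
    show ?thesis unfolding A B by (simp only: mult_ac)
  qed
  have "(\<integral>\<^sup>+w. ?F w \<partial>Pm {1..?k}) = (\<integral>\<^sup>+y. (\<integral>\<^sup>+w. ?F (w(?k := y)) \<partial>Pm {1..n}) \<partial>m)"
    by (rule nn_integral_Pm_Suc[OF F_meas])
  also have "\<dots> = (\<integral>\<^sup>+y. f i y * (\<integral>\<^sup>+w. ?G y w \<partial>Pm {1..n}) \<partial>m)"
    unfolding upd by (intro nn_integral_cong nn_integral_cmult G_meas)
  also have "\<dots> = (\<integral>\<^sup>+y. f i y * chain m (u 0) f q y y \<partial>m)"
    by (simp only: chain_diagonal[OF u_pair f q])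
  finally show ?thesis .
qed

lemma nn_integral_cyclic_measure:
  assumes f: "\<And>j. f j \<in> borel_measurable borel" and k: "1 \<le> k"
  shows "(\<integral>\<^sup>+w. (\<Prod>j\<in>{1..k}. f (p ! (j - 1)) (w j)) \<partial>cyclic_measure m (u 0) k) =
    (\<integral>\<^sup>+w. (\<Prod>j\<in>{1..k}. f (p ! (j - 1)) (w j)) * (\<Prod>j\<in>{1..k}. u 0 (w j) (w (cyc_next k j))) \<partial>Pm {1..k})"
proof -
  have comp: "(\<lambda>w. w j) \<in> Pm {1..k} \<rightarrow>\<^sub>M borel" if "j \<in> {1..k}" for j using that by (rule component_Pm)
  have A: "(\<lambda>w. \<Prod>j\<in>{1..k}. f (p ! (j - 1)) (w j)) \<in> borel_measurable (Pm {1..k})"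
    by (intro borel_measurable_prod_ennreal measurable_compose[OF comp f])
  have B: "(\<lambda>w. \<Prod>j\<in>{1..k}. u 0 (w j) (w (cyc_next k j))) \<in> borel_measurable (Pm {1..k})"
    using k by (intro borel_measurable_prod_ennreal u_meas comp cyc_next_in) auto
  have dens: "(\<Prod>j\<in>{1..<k}. u 0 (w j) (w (Suc j))) * u 0 (w k) (w 1) = (\<Prod>j\<in>{1..k}. u 0 (w j) (w (cyc_next k j)))" for w
  proof -
    have "{1..k} = insert k {1..<k}" using k by auto
    then have "(\<Prod>j\<in>{1..k}. u 0 (w j) (w (cyc_next k j))) = u 0 (w k) (w 1) * (\<Prod>j\<in>{1..<k}. u 0 (w j) (w (cyc_next k j)))"
      by (simp add: cyc_next_last)
    also have "(\<Prod>j\<in>{1..<k}. u 0 (w j) (w (cyc_next k j))) = (\<Prod>j\<in>{1..<k}. u 0 (w j) (w (Suc j)))"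
      by (intro prod.cong) (auto simp: cyc_next_less)
    finally show ?thesis by (simp add: mult.commute)
  qed
  show ?thesis
    unfolding cyclic_measure_def dens by (subst nn_integral_density[OF B A]) (simp add: mult.commute)
qed

end

context loop_bridges
begin

text \<open>For fixed \<open>\<alpha>\<close> every permutation contributes a cycle marked at \<open>k\<close>. Grouping the permutations into
circular ones and moving the rotations into the mark, the marks of one cycle add up to the unmarked cycle
of potentials once \<open>\<alpha>\<close> is integrated out.\<close>

theorem nn_integral_loop_measure_occupations:
  assumes f[measurable]: "\<And>j. f j \<in> borel_measurable borel" and k: "2 \<le> k"
    and rep: "\<And>C. C \<in> circular_perms k \<Longrightarrow> rep C \<in> C"
  shows "(\<integral>\<^sup>+\<omega>. (\<Prod>j\<in>{1..k}. tail (\<lambda>s. ext0 (f j) (\<omega> s)) 0) \<partial>loop_measure m Q) =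
    (\<Sum>C\<in>circular_perms k. \<integral>\<^sup>+x. (\<Prod>j\<in>{1..k}. f (rep C ! (j - 1)) (x j)) \<partial>cyclic_measure m (u 0) k)"
proof -
  let ?A = "permutations_of_set {1..k}"
  have k1: "1 \<le> k" using k by simp
  have len: "length p = k" if "p \<in> ?A" for p using length_finite_permutations_of_set[OF that] by simp
  have rep_A: "rep C \<in> ?A" if C: "C \<in> circular_perms k" for C
    using rep[OF C] C unfolding circular_perms_def quotient_def by auto
  have "(\<integral>\<^sup>+\<omega>. (\<Prod>j\<in>{1..k}. tail (\<lambda>s. ext0 (f j) (\<omega> s)) 0) \<partial>loop_measure m Q) =
      tail (\<lambda>\<alpha>. \<integral>\<^sup>+z. (\<integral>\<^sup>+\<omega>. killing_weight \<alpha> \<omega> * (\<Prod>j\<in>{1..k}. tail (\<lambda>s. ext0 (f j) (\<omega> s)) 0) \<partial>Q z) \<partial>m) 0"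
    using measurable_occupation_fixed[OF f, of 0]
    by (intro nn_integral_loop_measure_tail borel_measurable_prod_ennreal) simp
  also have "\<dots> = tail (\<lambda>\<alpha>. \<Sum>p\<in>?A. rooted_cycle f k k p \<alpha>) 0"
  proof (rule tail_cong)
    fix \<alpha> :: real assume \<alpha>: "0 < \<alpha>"
    have u_pair[measurable]: "(\<lambda>(x, y). u \<alpha> x y) \<in> borel_measurable (borel \<Otimes>\<^sub>M borel)" using \<alpha> by (intro u_measurable) simp
    have "(\<integral>\<^sup>+z. (\<integral>\<^sup>+\<omega>. killing_weight \<alpha> \<omega> * (\<Prod>j\<in>{1..k}. tail (\<lambda>s. ext0 (f j) (\<omega> s)) 0) \<partial>Q z) \<partial>m) =
        (\<integral>\<^sup>+z. (\<Sum>p\<in>?A. chain m (u \<alpha>) f p z z) \<partial>m)"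
      using k by (subst occupation_Q[OF \<alpha> f]) auto
    also have "\<dots> = (\<Sum>p\<in>?A. \<integral>\<^sup>+z. chain m (u \<alpha>) f p z z \<partial>m)"
      by (rule nn_integral_sum) measurable
    also have "\<dots> = (\<Sum>p\<in>?A. rooted_cycle f k k p \<alpha>)"
      using \<alpha> k by (intro sum.cong refl nn_integral_chain_loop f len) auto
    finally show "(\<integral>\<^sup>+z. (\<integral>\<^sup>+\<omega>. killing_weight \<alpha> \<omega> * (\<Prod>j\<in>{1..k}. tail (\<lambda>s. ext0 (f j) (\<omega> s)) 0) \<partial>Q z) \<partial>m) = \<dots>" .
  qed
  also have "\<dots> = (\<Sum>p\<in>?A. tail (rooted_cycle f k k p) 0)"
    using k1 by (intro tail_sum measurable_rooted_cycle f) auto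
  also have "\<dots> = (\<Sum>C\<in>circular_perms k. \<Sum>i\<in>{1..k}. tail (rooted_cycle f k k (rotate i (rep C))) 0)"
    by (rule sum_permutations_circular[OF k1 rep])
  also have "\<dots> = (\<Sum>C\<in>circular_perms k. \<Sum>i\<in>{1..k}. tail (rooted_cycle f k i (rep C)) 0)"
    by (intro sum.cong refl tail_cong rooted_cycle_rotate f k1 len rep_A)
  also have "\<dots> = (\<Sum>C\<in>circular_perms k. \<integral>\<^sup>+x. (\<Prod>j\<in>{1..k}. f (rep C ! (j - 1)) (x j)) \<partial>cyclic_measure m (u 0) k)"
    by (intro sum.cong refl trans[OF nn_integral_cycle[OF f k, symmetric] nn_integral_cyclic_measure[OF f k1, symmetric]])
  finally show ?thesis .
qed

end

section \<open>Integrability and signed functions\<close>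

lemma ennreal_mult_le_sum_squares: "a * b \<le> a\<^sup>2 + (b :: ennreal)\<^sup>2"
proof (cases "a \<le> b")
  case True
  then have "a * b \<le> b * b" by (rule mult_right_mono) simp
  then show ?thesis by (simp add: power2_eq_square add_increasing)
next
  case False
  then have "a * b \<le> a * a" by (intro mult_left_mono) auto
  then show ?thesis by (simp add: power2_eq_square add_increasing2)
qed

lemma ennreal_le_1_plus_square: "a \<le> 1 + (a :: ennreal)\<^sup>2"
  using ennreal_mult_le_sum_squares[of 1 a] by simp

text \<open>Multilinearity of the product in the form in which factors are split into positive and negative
parts.\<close>

lemma prod_diff_one_factor:
  fixes a b c :: "'i \<Rightarrow> 'a::comm_ring_1"
  assumes "finite I" "i \<in> I" "\<And>j. j \<in> I \<Longrightarrow> j \<noteq> i \<Longrightarrow> a j = b j" "\<And>j. j \<in> I \<Longrightarrow> j \<noteq> i \<Longrightarrow> a j = c j"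
    and "a i = b i - c i"
  shows "(\<Prod>j\<in>I. a j) = (\<Prod>j\<in>I. b j) - (\<Prod>j\<in>I. c j)"
proof -
  have "(\<Prod>j\<in>I - {i}. a j) = (\<Prod>j\<in>I - {i}. b j)" "(\<Prod>j\<in>I - {i}. a j) = (\<Prod>j\<in>I - {i}. c j)"
    using assms(3,4) by (auto intro!: prod.cong)
  then show ?thesis
    using assms(1,2,5) by (simp add: prod.remove left_diff_distrib)
qed

lemma circular_rep_nth:
  assumes "C \<in> circular_perms k" "p \<in> C"
  shows "length p = k" and "\<And>j. j \<in> {1..k} \<Longrightarrow> p ! (j - 1) \<in> {1..k}"
    and "\<And>i. i \<in> {1..k} \<Longrightarrow> \<exists>j\<in>{1..k}. p ! (j - 1) = i \<and> (\<forall>l\<in>{1..k}. l \<noteq> j \<longrightarrow> p ! (l - 1) \<noteq> i)"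
proof -
  have p: "p \<in> permutations_of_set {1..k}"
    using assms unfolding circular_perms_def quotient_def by auto
  show len: "length p = k" using length_finite_permutations_of_set[OF p] by simp
  have set: "set p = {1..k}" and dist: "distinct p" using p by (auto simp: permutations_of_set_def)
  show "p ! (j - 1) \<in> {1..k}" if "j \<in> {1..k}" for j
    using that len set nth_mem[of "j - 1" p] by auto
  show "\<exists>j\<in>{1..k}. p ! (j - 1) = i \<and> (\<forall>l\<in>{1..k}. l \<noteq> j \<longrightarrow> p ! (l - 1) \<noteq> i)" if i: "i \<in> {1..k}" for i
  proof -
    have "i \<in> set p" using i set by simp
    then obtain n where n: "n < k" "p ! n = i" using len by (auto simp: in_set_conv_nth)
    show ?thesis
    proof (intro bexI[of _ "Suc n"] conjI ballI impI)
      fix l assume l: "l \<in> {1..k}" "l \<noteq> Suc n"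
      then have "l - 1 \<noteq> n" "l - 1 < k" by auto
      then show "p ! (l - 1) \<noteq> i" using n dist len nth_eq_iff_index_eq[of p "l - 1" n] by auto
    qed (use n in auto)
  qed
qed

lemma finite_circular_perms: "finite (circular_perms k)"
  unfolding circular_perms_def by (intro finite_quotient) auto

lemma circular_perms_nonempty: "C \<in> circular_perms k \<Longrightarrow> C \<noteq> {}"
proof -
  assume "C \<in> circular_perms k"
  then obtain p where "p \<in> permutations_of_set {1..k}"
    "C = {(p, q). p \<in> permutations_of_set {1..k} \<and> q \<in> permutations_of_set {1..k} \<and> (\<exists>n. q = rotate n p)} `` {p}"
    unfolding circular_perms_def by (rule quotientE)
  moreover have "p = rotate 0 p" by simp
  ultimately have "p \<in> C" by blast
  then show "C \<noteq> {}" by blast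
qed

context process_with_potential_densities
begin

text \<open>At the last point \<open>y\<close> of a chain two singular factors meet and are controlled by
\<open>u(x, y) u(y, z) \<le> u(x, y)\<^sup>2 + u(y, z)\<^sup>2\<close>. Each point before it contributes one further factor, with
\<open>u(x, y) \<le> 1 + u(x, y)\<^sup>2\<close>. All these squares are integrable over \<open>K\<close>, uniformly in the free end point.\<close>

lemma chain_bounded:
  assumes K: "compact K" and f[measurable]: "\<And>j. f j \<in> borel_measurable borel"
    and bound: "\<And>j y. f j y \<le> ennreal c * indicator K y" and p: "p \<noteq> []"
  shows "\<exists>D. D < \<infinity> \<and> (\<forall>x z. chain m (u 0) f p x z \<le> D)"
  using p
proof (induction p)
  case Nil
  then show ?case by simp
next
  case (Cons j p)
  have K_borel[measurable]: "K \<in> sets borel" using K by (intro borel_compact)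
  have K_m: "K \<in> sets m" by (simp add: sets_m)
  define M where "M = (SUP x. \<integral>\<^sup>+y\<in>K. (u 0 x y + u 0 y x)\<^sup>2 \<partial>m)"
  have M: "M < \<infinity>" unfolding M_def by (rule u_square_integrable[OF K])
  have le_M: "(\<integral>\<^sup>+y\<in>K. (u 0 x y)\<^sup>2 \<partial>m) \<le> M" "(\<integral>\<^sup>+y\<in>K. (u 0 y x)\<^sup>2 \<partial>m) \<le> M" for x
  proof -
    have "(\<integral>\<^sup>+y\<in>K. (u 0 x y + u 0 y x)\<^sup>2 \<partial>m) \<le> M" unfolding M_def by (rule SUP_upper) simp
    moreover have "(\<integral>\<^sup>+y\<in>K. (u 0 x y)\<^sup>2 \<partial>m) \<le> (\<integral>\<^sup>+y\<in>K. (u 0 x y + u 0 y x)\<^sup>2 \<partial>m)"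
      "(\<integral>\<^sup>+y\<in>K. (u 0 y x)\<^sup>2 \<partial>m) \<le> (\<integral>\<^sup>+y\<in>K. (u 0 x y + u 0 y x)\<^sup>2 \<partial>m)"
      by (intro nn_integral_mono mult_right_mono power_mono; simp)+
    ultimately show "(\<integral>\<^sup>+y\<in>K. (u 0 x y)\<^sup>2 \<partial>m) \<le> M" "(\<integral>\<^sup>+y\<in>K. (u 0 y x)\<^sup>2 \<partial>m) \<le> M"
      by (auto intro: order_trans)
  qed
  show ?case
  proof (cases "p = []")
    case True
    have "chain m (u 0) f (j # p) x z \<le> ennreal c * (M + M)" for x z
    proof -
      have "chain m (u 0) f (j # p) x z = (\<integral>\<^sup>+y. u 0 x y * (f j y * u 0 y z) \<partial>m)" using True by simp
      also have "\<dots> \<le> (\<integral>\<^sup>+y. ennreal c * ((u 0 x y)\<^sup>2 * indicator K y + (u 0 y z)\<^sup>2 * indicator K y) \<partial>m)"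
      proof (rule nn_integral_mono)
        fix y
        have "u 0 x y * (f j y * u 0 y z) \<le> u 0 x y * ((ennreal c * indicator K y) * u 0 y z)"
          by (intro mult_left_mono mult_right_mono bound) auto
        also have "\<dots> = (ennreal c * indicator K y) * (u 0 x y * u 0 y z)" by (simp only: mult_ac)
        also have "\<dots> \<le> (ennreal c * indicator K y) * ((u 0 x y)\<^sup>2 + (u 0 y z)\<^sup>2)"
          by (intro mult_left_mono ennreal_mult_le_sum_squares) auto
        also have "\<dots> = ennreal c * ((u 0 x y)\<^sup>2 * indicator K y + (u 0 y z)\<^sup>2 * indicator K y)"
          by (simp add: distrib_left mult_ac)
        finally show "u 0 x y * (f j y * u 0 y z) \<le> \<dots>" .
      qed
      also have "\<dots> = ennreal c * ((\<integral>\<^sup>+y\<in>K. (u 0 x y)\<^sup>2 \<partial>m) + (\<integral>\<^sup>+y\<in>K. (u 0 y z)\<^sup>2 \<partial>m))"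
        by (simp add: nn_integral_cmult nn_integral_add)
      also have "\<dots> \<le> ennreal c * (M + M)"
        by (intro mult_left_mono add_mono le_M) auto
      finally show ?thesis .
    qed
    moreover have "ennreal c * (M + M) < \<infinity>" using M by (simp add: ennreal_mult_less_top)
    ultimately show ?thesis by blast
  next
    case False
    then obtain D where D: "D < \<infinity>" "\<And>x z. chain m (u 0) f p x z \<le> D" using Cons.IH by blast
    have "chain m (u 0) f (j # p) x z \<le> ennreal c * D * (emeasure m K + M)" for x z
    proof -
      have "chain m (u 0) f (j # p) x z = (\<integral>\<^sup>+y. u 0 x y * (f j y * chain m (u 0) f p y z) \<partial>m)" by simp
      also have "\<dots> \<le> (\<integral>\<^sup>+y. ennreal c * D * (indicator K y + (u 0 x y)\<^sup>2 * indicator K y) \<partial>m)"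
      proof (rule nn_integral_mono)
        fix y
        have "u 0 x y * (f j y * chain m (u 0) f p y z) \<le> (1 + (u 0 x y)\<^sup>2) * ((ennreal c * indicator K y) * D)"
          by (intro mult_mono bound D ennreal_le_1_plus_square) auto
        also have "\<dots> = ennreal c * D * (indicator K y + (u 0 x y)\<^sup>2 * indicator K y)"
          by (simp add: distrib_left distrib_right mult_ac)
        finally show "u 0 x y * (f j y * chain m (u 0) f p y z) \<le> \<dots>" .
      qed
      also have "\<dots> = ennreal c * D * (emeasure m K + (\<integral>\<^sup>+y\<in>K. (u 0 x y)\<^sup>2 \<partial>m))"
        using K_m by (simp add: nn_integral_cmult nn_integral_add)
      also have "\<dots> \<le> ennreal c * D * (emeasure m K + M)"
        by (intro mult_left_mono add_mono le_M) auto
      finally show ?thesis .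
    qed
    moreover have "ennreal c * D * (emeasure m K + M) < \<infinity>"
      using M D m_compact[OF K] by (simp add: ennreal_mult_less_top)
    ultimately show ?thesis by blast
  qed
qed

text \<open>The last variable ranges over a set of finite measure and the chain closing up at it is bounded.\<close>

lemma cyclic_measure_finite:
  assumes K: "compact K" and f[measurable]: "\<And>j. f j \<in> borel_measurable borel"
    and bound: "\<And>j y. f j y \<le> ennreal c * indicator K y" and k: "2 \<le> k" and p: "length p = k"
  shows "(\<integral>\<^sup>+x. (\<Prod>j\<in>{1..k}. f (p ! (j - 1)) (x j)) \<partial>cyclic_measure m (u 0) k) < \<infinity>"
proof -
  obtain q i where q: "p = q @ [i]" using k p by (cases p rule: rev_cases) auto
  define n where "n = length q"
  have n: "k = Suc n" "length q = n" "1 \<le> n" using p k q by (auto simp: n_def)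
  have "q \<noteq> []" using n by auto
  then obtain D where D: "D < \<infinity>" "\<And>x z. chain m (u 0) f q x z \<le> D"
    using chain_bounded[where f = f and c = c, OF K f bound \<open>q \<noteq> []\<close>] by blast
  have K_m: "K \<in> sets m" using K by (simp add: sets_m borel_compact)
  have "(\<integral>\<^sup>+x. (\<Prod>j\<in>{1..k}. f (p ! (j - 1)) (x j)) \<partial>cyclic_measure m (u 0) k) = (\<integral>\<^sup>+y. f i y * chain m (u 0) f q y y \<partial>m)"
  proof -
    have "1 \<le> k" using k by simp
    then show ?thesis
      using nn_integral_cyclic_measure[OF f, where k = k and p = p] nn_integral_cycle_eq_chain[OF f n(2,3), where i = i]
      unfolding n(1) q by simp
  qed
  also have "\<dots> \<le> (\<integral>\<^sup>+y. (ennreal c * D) * indicator K y \<partial>m)"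
  proof (rule nn_integral_mono)
    fix y
    have "f i y * chain m (u 0) f q y y \<le> (ennreal c * indicator K y) * D" by (intro mult_mono bound D) auto
    then show "f i y * chain m (u 0) f q y y \<le> (ennreal c * D) * indicator K y" by (simp add: mult_ac)
  qed
  also have "\<dots> = ennreal c * D * emeasure m K" using K_m by (simp add: nn_integral_cmult_indicator)
  also have "\<dots> < \<infinity>" using D m_compact[OF K] by (simp add: ennreal_mult_less_top)
  finally show ?thesis .
qed

end

context loop_bridges
begin

abbreviation occ :: "('a \<Rightarrow> real) \<Rightarrow> (real \<Rightarrow> 'a option) \<Rightarrow> real" where
  "occ g \<omega> \<equiv> LINT t:{0..}|lborel. ext0 g (\<omega> t)"

lemma set_integrable_path:
  assumes g[measurable]: "g \<in> borel_measurable borel" and \<omega>: "\<omega> \<in> paths"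
    and fin: "tail (\<lambda>s. ext0 (\<lambda>y. ennreal \<bar>g y\<bar>) (\<omega> s)) 0 < \<infinity>"
  shows "set_integrable lborel {0..} (\<lambda>t. ext0 g (\<omega> t))"
    and "ennreal \<bar>occ g \<omega>\<bar> \<le> tail (\<lambda>s. ext0 (\<lambda>y. ennreal \<bar>g y\<bar>) (\<omega> s)) 0"
    and "(\<And>y. 0 \<le> g y) \<Longrightarrow> ennreal (occ g \<omega>) = tail (\<lambda>s. ext0 (\<lambda>y. ennreal \<bar>g y\<bar>) (\<omega> s)) 0"
proof -
  note [measurable] = measurable_path[OF locally_compact \<omega>]
  have "(\<lambda>t. indicator {0..} t *\<^sub>R ext0 g (\<omega> (max 0 t))) \<in> borel_measurable lborel" by measurable
  also have "(\<lambda>t. indicator {0..} t *\<^sub>R ext0 g (\<omega> (max 0 t))) = (\<lambda>t. indicator {0..} t *\<^sub>R ext0 g (\<omega> t))"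
    by (auto simp: indicator_def max_def)
  finally have meas: "(\<lambda>t. indicator {0..} t *\<^sub>R ext0 g (\<omega> t)) \<in> borel_measurable lborel" .
  have norm: "(\<integral>\<^sup>+t. ennreal (norm (indicator {0..} t *\<^sub>R ext0 g (\<omega> t))) \<partial>lborel) = tail (\<lambda>s. ext0 (\<lambda>y. ennreal \<bar>g y\<bar>) (\<omega> s)) 0"
    unfolding set_nn_integral_atLeast_tail[symmetric]
    by (intro nn_integral_cong) (auto simp: indicator_def ext0_eq)
  show int: "set_integrable lborel {0..} (\<lambda>t. ext0 g (\<omega> t))"
    unfolding set_integrable_def using meas fin norm by (intro integrableI_bounded) auto
  show "ennreal \<bar>occ g \<omega>\<bar> \<le> tail (\<lambda>s. ext0 (\<lambda>y. ennreal \<bar>g y\<bar>) (\<omega> s)) 0"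
    using integral_norm_bound_ennreal[OF int[unfolded set_integrable_def]] norm
    unfolding set_lebesgue_integral_def by simp
  show "ennreal (occ g \<omega>) = tail (\<lambda>s. ext0 (\<lambda>y. ennreal \<bar>g y\<bar>) (\<omega> s)) 0" if nonneg: "\<And>y. 0 \<le> g y"
  proof -
    have "(\<integral>\<^sup>+t. ennreal (indicator {0..} t *\<^sub>R ext0 g (\<omega> t)) \<partial>lborel) = ennreal (occ g \<omega>)"
      unfolding set_lebesgue_integral_def
      using int[unfolded set_integrable_def] nonneg by (intro nn_integral_eq_integral) (auto simp: ext0_eq)
    moreover have "(\<integral>\<^sup>+t. ennreal (indicator {0..} t *\<^sub>R ext0 g (\<omega> t)) \<partial>lborel) =
        (\<integral>\<^sup>+t. ennreal (norm (indicator {0..} t *\<^sub>R ext0 g (\<omega> t))) \<partial>lborel)"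
      using nonneg by (intro nn_integral_cong) (auto simp: ext0_eq)
    ultimately show ?thesis using norm by simp
  qed
qed

lemma measurable_occ:
  assumes g[measurable]: "g \<in> borel_measurable borel"
  shows "occ g \<in> borel_measurable \<Omega>"
proof -
  have "(\<lambda>q. (\<lambda>p. snd p (max 0 (fst p))) (snd q, fst q)) \<in> \<Omega> \<Otimes>\<^sub>M borel \<rightarrow>\<^sub>M cemetery_borel"
    by (rule measurable_compose[OF _ evaluation]) measurable
  then have [measurable]: "(\<lambda>q. fst q (max 0 (snd q))) \<in> \<Omega> \<Otimes>\<^sub>M lborel \<rightarrow>\<^sub>M cemetery_borel"
    by (subst measurable_cong_sets[OF sets_pair_measure_cong[OF refl sets_lborel] refl]) simp
  have "(\<lambda>\<omega>. \<integral>t. indicator {0..} t *\<^sub>R ext0 g (\<omega> (max 0 t)) \<partial>lborel) \<in> borel_measurable \<Omega>"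
    by (rule lborel.borel_measurable_lebesgue_integral) (unfold case_prod_unfold, measurable)
  also have "(\<lambda>\<omega>. \<integral>t. indicator {0..} t *\<^sub>R ext0 g (\<omega> (max 0 t)) \<partial>lborel) = occ g"
    unfolding set_lebesgue_integral_def
    by (intro ext Bochner_Integration.integral_cong) (auto simp: indicator_def)
  finally show ?thesis .
qed

text \<open>
The formula for \<open>k = 2\<close> and the nonnegative functions \<open>\<bar>g\<bar>, \<bar>g\<bar>\<close> shows that the absolute occupation time has a
finite second moment. The first moment would not do: the cycle for \<open>k = 1\<close> is \<open>u(x, x) = \<infinity>\<close>.\<close>

lemma AE_loop_measure_finite_occupation:
  assumes K: "compact K" and g[measurable]: "g \<in> borel_measurable borel"
    and bound: "\<And>y. \<bar>g y\<bar> \<le> c * indicator K y"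
  shows "AE \<omega> in loop_measure m Q. tail (\<lambda>s. ext0 (\<lambda>y. ennreal \<bar>g y\<bar>) (\<omega> s)) 0 < \<infinity>"
proof -
  let ?N = "\<lambda>\<omega>. tail (\<lambda>s. ext0 (\<lambda>y. ennreal \<bar>g y\<bar>) (\<omega> s)) 0"
  have N_meas: "?N \<in> borel_measurable (loop_measure m Q)"
    using measurable_occupation_fixed[of "\<lambda>y. ennreal \<bar>g y\<bar>" 0]
    by (subst measurable_cong_sets[OF sets_loop_measure refl]) simp
  define rep :: "nat list set \<Rightarrow> nat list" where "rep C = (SOME p. p \<in> C)" for C
  have rep: "rep C \<in> C" if "C \<in> circular_perms 2" for C
    using circular_perms_nonempty[OF that] unfolding rep_def by (simp add: some_in_eq)
  have le: "ennreal \<bar>g y\<bar> \<le> ennreal c * indicator K y" for y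
    using bound[of y] by (auto simp: indicator_def intro: ennreal_leI split: if_splits)
  have abs_meas: "(\<lambda>y. ennreal \<bar>g y\<bar>) \<in> borel_measurable borel" by measurable
  have two: "{1..2} = {1, 2 :: nat}" by auto
  have "(\<integral>\<^sup>+\<omega>. ?N \<omega> * ?N \<omega> \<partial>loop_measure m Q) = (\<integral>\<^sup>+\<omega>. (\<Prod>j\<in>{1..2 :: nat}. ?N \<omega>) \<partial>loop_measure m Q)"
    by (simp add: two power2_eq_square)
  also have "\<dots> = (\<Sum>C\<in>circular_perms 2. \<integral>\<^sup>+x. (\<Prod>j\<in>{1..2}. ennreal \<bar>g (x j)\<bar>) \<partial>cyclic_measure m (u 0) 2)"
    by (rule nn_integral_loop_measure_occupations[where f = "\<lambda>_ y. ennreal \<bar>g y\<bar>" and rep = rep, OF abs_meas order_refl rep])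
  also have "\<dots> < \<infinity>"
  proof -
    have "(\<integral>\<^sup>+x. (\<Prod>j\<in>{1..2}. ennreal \<bar>g (x j)\<bar>) \<partial>cyclic_measure m (u 0) 2) < \<infinity>"
      by (rule cyclic_measure_finite[OF K, where f = "\<lambda>_ y. ennreal \<bar>g y\<bar>" and c = c and p = "[0, 0 :: nat]"])
        (rule abs_meas, rule le, simp_all)
    then show ?thesis by (simp add: ennreal_mult_less_top of_nat_less_top)
  qed
  finally have "AE \<omega> in loop_measure m Q. ?N \<omega> * ?N \<omega> \<noteq> \<infinity>"
    using N_meas by (intro nn_integral_PInf_AE) auto
  then show ?thesis
    by eventually_elim (auto simp: ennreal_mult_eq_top_iff less_top)
qed

text \<open>The formula for the nonnegative functions \<open>\<bar>f j\<bar>\<close>, whose right-hand side is finite, dominates everything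
and thereby gives the integrability claims.\<close>

theorem loop_measure_occupations:
  assumes K: "compact K" and f[measurable]: "\<And>j. f j \<in> borel_measurable borel"
    and bound: "\<And>j y. \<bar>f j y\<bar> \<le> c * indicator K y" and k: "2 \<le> k"
    and rep: "\<forall>C\<in>circular_perms k. rep C \<in> C"
  shows AE_occ_integrable: "AE \<omega> in loop_measure m Q. \<forall>j\<in>{1..k}. set_integrable lborel {0..} (\<lambda>t. ext0 (f j) (\<omega> t))"
    and integrable_prod_occ: "integrable (loop_measure m Q) (\<lambda>\<omega>. \<Prod>j\<in>{1..k}. occ (f j) \<omega>)"
    and integrable_cyclic: "\<And>C. C \<in> circular_perms k \<Longrightarrow>
      integrable (cyclic_measure m (u 0) k) (\<lambda>x. \<Prod>j\<in>{1..k}. f (rep C ! (j - 1)) (x j))"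
    and nonneg_occ: "(\<And>j y. 0 \<le> f j y) \<Longrightarrow> (\<integral>\<omega>. (\<Prod>j\<in>{1..k}. occ (f j) \<omega>) \<partial>loop_measure m Q) =
      (\<Sum>C\<in>circular_perms k. \<integral>x. (\<Prod>j\<in>{1..k}. f (rep C ! (j - 1)) (x j)) \<partial>cyclic_measure m (u 0) k)"
proof -
  let ?N = "\<lambda>j \<omega>. tail (\<lambda>s. ext0 (\<lambda>y. ennreal \<bar>f j y\<bar>) (\<omega> s)) 0"
  let ?\<mu> = "loop_measure m Q" and ?\<nu> = "cyclic_measure m (u 0) k"
  have le: "ennreal \<bar>f j y\<bar> \<le> ennreal c * indicator K y" for j y
    using bound[of j y] by (auto simp: indicator_def intro: ennreal_leI split: if_splits)
  have fin_cyc: "(\<integral>\<^sup>+x. (\<Prod>j\<in>{1..k}. ennreal \<bar>f (rep C ! (j - 1)) (x j)\<bar>) \<partial>?\<nu>) < \<infinity>" if C: "C \<in> circular_perms k" for C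
    using cyclic_measure_finite[OF K, of "\<lambda>j y. ennreal \<bar>f j y\<bar>" c k "rep C"] le k
      circular_rep_nth(1)[OF C bspec[OF rep C]] by simp
  have main: "(\<integral>\<^sup>+\<omega>. (\<Prod>j\<in>{1..k}. ?N j \<omega>) \<partial>?\<mu>) =
      (\<Sum>C\<in>circular_perms k. \<integral>\<^sup>+x. (\<Prod>j\<in>{1..k}. ennreal \<bar>f (rep C ! (j - 1)) (x j)\<bar>) \<partial>?\<nu>)"
    by (rule nn_integral_loop_measure_occupations[where f = "\<lambda>j y. ennreal \<bar>f j y\<bar>" and rep = rep, OF _ k bspec[OF rep]]) measurable
  have AE_N: "AE \<omega> in ?\<mu>. \<forall>j\<in>{1..k}. ?N j \<omega> < \<infinity>"
    by (rule AE_finite_allI, simp) (rule AE_loop_measure_finite_occupation[OF K f bound])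
  have AE_paths: "AE \<omega> in ?\<mu>. \<omega> \<in> paths" using AE_space[of ?\<mu>] by simp
  show "AE \<omega> in ?\<mu>. \<forall>j\<in>{1..k}. set_integrable lborel {0..} (\<lambda>t. ext0 (f j) (\<omega> t))"
    using AE_N AE_paths by eventually_elim (auto intro: set_integrable_path)
  have occ_meas: "(\<lambda>\<omega>. \<Prod>j\<in>{1..k}. occ (f j) \<omega>) \<in> borel_measurable ?\<mu>"
    by (subst measurable_cong_sets[OF sets_loop_measure refl]) (intro borel_measurable_prod measurable_occ f)
  show int_\<mu>: "integrable ?\<mu> (\<lambda>\<omega>. \<Prod>j\<in>{1..k}. occ (f j) \<omega>)"
  proof (rule integrableI_bounded[OF occ_meas])
    have "(\<integral>\<^sup>+\<omega>. ennreal (norm (\<Prod>j\<in>{1..k}. occ (f j) \<omega>)) \<partial>?\<mu>) \<le> (\<integral>\<^sup>+\<omega>. (\<Prod>j\<in>{1..k}. ?N j \<omega>) \<partial>?\<mu>)"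
    proof (rule nn_integral_mono_AE)
      show "AE \<omega> in ?\<mu>. ennreal (norm (\<Prod>j\<in>{1..k}. occ (f j) \<omega>)) \<le> (\<Prod>j\<in>{1..k}. ?N j \<omega>)"
        using AE_N AE_paths
      proof eventually_elim
        case (elim \<omega>)
        have "ennreal (norm (\<Prod>j\<in>{1..k}. occ (f j) \<omega>)) = (\<Prod>j\<in>{1..k}. ennreal \<bar>occ (f j) \<omega>\<bar>)"
          by (simp add: abs_prod prod_ennreal)
        also have "\<dots> \<le> (\<Prod>j\<in>{1..k}. ?N j \<omega>)"
          by (rule prod_mono_ennreal) (use elim set_integrable_path(2)[OF f] in auto)
        finally show ?case .
      qed
    qed
    also have "\<dots> < \<infinity>" unfolding main using fin_cyc finite_circular_perms by simp
    finally show "(\<integral>\<^sup>+\<omega>. ennreal (norm (\<Prod>j\<in>{1..k}. occ (f j) \<omega>)) \<partial>?\<mu>) < \<infinity>" .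
  qed
  have sets_\<nu>: "sets ?\<nu> = sets (Pm {1..k})" by (simp add: cyclic_measure_def)
  show int_\<nu>: "integrable ?\<nu> (\<lambda>x. \<Prod>j\<in>{1..k}. f (rep C ! (j - 1)) (x j))" if C: "C \<in> circular_perms k" for C
  proof (rule integrableI_bounded)
    show "(\<lambda>x. \<Prod>j\<in>{1..k}. f (rep C ! (j - 1)) (x j)) \<in> borel_measurable ?\<nu>"
      by (subst measurable_cong_sets[OF sets_\<nu> refl]) (intro borel_measurable_prod measurable_compose[OF component_Pm f])
    show "(\<integral>\<^sup>+x. ennreal (norm (\<Prod>j\<in>{1..k}. f (rep C ! (j - 1)) (x j))) \<partial>?\<nu>) < \<infinity>"
      using fin_cyc[OF C] by (simp add: abs_prod prod_ennreal)
  qed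
  show "(\<integral>\<omega>. (\<Prod>j\<in>{1..k}. occ (f j) \<omega>) \<partial>?\<mu>) = (\<Sum>C\<in>circular_perms k. \<integral>x. (\<Prod>j\<in>{1..k}. f (rep C ! (j - 1)) (x j)) \<partial>?\<nu>)"
    if nonneg: "\<And>j y. 0 \<le> f j y"
  proof -
    have occ_nonneg: "0 \<le> occ (f j) \<omega>" for j \<omega>
      unfolding set_lebesgue_integral_def
      by (intro Bochner_Integration.integral_nonneg) (auto simp: ext0_eq nonneg)
    have "ennreal (\<integral>\<omega>. (\<Prod>j\<in>{1..k}. occ (f j) \<omega>) \<partial>?\<mu>) = (\<integral>\<^sup>+\<omega>. ennreal (\<Prod>j\<in>{1..k}. occ (f j) \<omega>) \<partial>?\<mu>)"
      using int_\<mu> occ_nonneg by (intro nn_integral_eq_integral[symmetric]) (auto intro: prod_nonneg)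
    also have "\<dots> = (\<integral>\<^sup>+\<omega>. (\<Prod>j\<in>{1..k}. ?N j \<omega>) \<partial>?\<mu>)"
    proof (rule nn_integral_cong_AE)
      show "AE \<omega> in ?\<mu>. ennreal (\<Prod>j\<in>{1..k}. occ (f j) \<omega>) = (\<Prod>j\<in>{1..k}. ?N j \<omega>)"
        using AE_N AE_paths
      proof eventually_elim
        case (elim \<omega>)
        have "ennreal (\<Prod>j\<in>{1..k}. occ (f j) \<omega>) = (\<Prod>j\<in>{1..k}. ennreal (occ (f j) \<omega>))"
          using occ_nonneg by (simp add: prod_ennreal)
        also have "\<dots> = (\<Prod>j\<in>{1..k}. ?N j \<omega>)"
          by (rule prod.cong[OF refl]) (use elim set_integrable_path(3)[OF f] nonneg in auto)
        finally show ?case .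
      qed
    qed
    also have "\<dots> = (\<Sum>C\<in>circular_perms k. ennreal (\<integral>x. (\<Prod>j\<in>{1..k}. f (rep C ! (j - 1)) (x j)) \<partial>?\<nu>))"
      unfolding main
    proof (rule sum.cong[OF refl])
      fix C assume C: "C \<in> circular_perms k"
      have "(\<integral>\<^sup>+x. (\<Prod>j\<in>{1..k}. ennreal \<bar>f (rep C ! (j - 1)) (x j)\<bar>) \<partial>?\<nu>) =
          (\<integral>\<^sup>+x. ennreal (\<Prod>j\<in>{1..k}. f (rep C ! (j - 1)) (x j)) \<partial>?\<nu>)"
        using nonneg by (simp add: prod_ennreal)
      also have "\<dots> = ennreal (\<integral>x. (\<Prod>j\<in>{1..k}. f (rep C ! (j - 1)) (x j)) \<partial>?\<nu>)"
        using int_\<nu>[OF C] nonneg by (intro nn_integral_eq_integral) (auto intro: prod_nonneg)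
      finally show "(\<integral>\<^sup>+x. (\<Prod>j\<in>{1..k}. ennreal \<bar>f (rep C ! (j - 1)) (x j)\<bar>) \<partial>?\<nu>) = \<dots>" .
    qed
    also have "\<dots> = ennreal (\<Sum>C\<in>circular_perms k. \<integral>x. (\<Prod>j\<in>{1..k}. f (rep C ! (j - 1)) (x j)) \<partial>?\<nu>)"
      using nonneg by (intro sum_ennreal) (auto intro!: Bochner_Integration.integral_nonneg prod_nonneg)
    finally show ?thesis
      using nonneg occ_nonneg
      by (subst (asm) ennreal_inj) (auto intro!: sum_nonneg Bochner_Integration.integral_nonneg prod_nonneg)
  qed
qed

text \<open>Both sides are multilinear in the \<open>f j\<close>, so that the factors may be replaced one after another
  by their positive and negative parts.\<close>

theorem integral_loop_measure_occupations:
  assumes K: "compact K" and f: "\<And>j. f j \<in> borel_measurable borel"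
    and bound: "\<And>j y. \<bar>f j y\<bar> \<le> c * indicator K y" and k: "2 \<le> k"
    and rep: "\<forall>C\<in>circular_perms k. rep C \<in> C"
    and J: "finite J" "J \<subseteq> {1..k}" and nonneg: "\<And>j y. j \<notin> J \<Longrightarrow> 0 \<le> f j y"
  shows "(\<integral>\<omega>. (\<Prod>j\<in>{1..k}. occ (f j) \<omega>) \<partial>loop_measure m Q) =
      (\<Sum>C\<in>circular_perms k. \<integral>x. (\<Prod>j\<in>{1..k}. f (rep C ! (j - 1)) (x j)) \<partial>cyclic_measure m (u 0) k)"
  using J f bound nonneg
proof (induction J arbitrary: f rule: finite_induct)
  case empty
  show ?case
    by (rule nonneg_occ[OF K empty.prems(2,3) k rep]) (use empty.prems(4) in auto)
next
  case (insert i J)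
  let ?\<mu> = "loop_measure m Q" and ?\<nu> = "cyclic_measure m (u 0) k"
  note f[measurable] = insert.prems(2) and bound = insert.prems(3)
  have i: "i \<in> {1..k}" using insert.prems by simp
  define a where "a = f(i := \<lambda>y. max 0 (f i y))"
  define b where "b = f(i := \<lambda>y. max 0 (- f i y))"
  have a_meas: "a j \<in> borel_measurable borel" and b_meas: "b j \<in> borel_measurable borel" for j
    unfolding a_def b_def by (cases "j = i"; simp)+
  have a_bound: "\<bar>a j y\<bar> \<le> c * indicator K y" and b_bound: "\<bar>b j y\<bar> \<le> c * indicator K y" for j y
    using bound[of j y] unfolding a_def b_def by (auto simp: max_def)
  note a = loop_measure_occupations[where f = a and rep = rep, OF K a_meas a_bound k rep]
    and b = loop_measure_occupations[where f = b and rep = rep, OF K b_meas b_bound k rep]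
  have IH_a: "(\<integral>\<omega>. (\<Prod>j\<in>{1..k}. occ (a j) \<omega>) \<partial>?\<mu>) = (\<Sum>C\<in>circular_perms k. \<integral>x. (\<Prod>j\<in>{1..k}. a (rep C ! (j - 1)) (x j)) \<partial>?\<nu>)"
    using insert.prems by (intro insert.IH a_meas a_bound) (auto simp: a_def)
  have IH_b: "(\<integral>\<omega>. (\<Prod>j\<in>{1..k}. occ (b j) \<omega>) \<partial>?\<mu>) = (\<Sum>C\<in>circular_perms k. \<integral>x. (\<Prod>j\<in>{1..k}. b (rep C ! (j - 1)) (x j)) \<partial>?\<nu>)"
    using insert.prems by (intro insert.IH b_meas b_bound) (auto simp: b_def)
  have f_occ_meas: "(\<lambda>\<omega>. \<Prod>j\<in>{1..k}. occ (f j) \<omega>) \<in> borel_measurable ?\<mu>"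
    by (subst measurable_cong_sets[OF sets_loop_measure refl]) (intro borel_measurable_prod measurable_occ f)
  have "AE \<omega> in ?\<mu>. (\<Prod>j\<in>{1..k}. occ (f j) \<omega>) = (\<Prod>j\<in>{1..k}. occ (a j) \<omega>) - (\<Prod>j\<in>{1..k}. occ (b j) \<omega>)"
    using a(1) b(1)
  proof eventually_elim
    case (elim \<omega>)
    have "occ (f i) \<omega> = (LINT t:{0..}|lborel. ext0 (a i) (\<omega> t) - ext0 (b i) (\<omega> t))"
      by (intro set_lebesgue_integral_cong) (auto simp: ext0_eq a_def b_def)
    also have "\<dots> = occ (a i) \<omega> - occ (b i) \<omega>" using elim i by (intro set_integral_diff) auto
    finally show ?case using i by (intro prod_diff_one_factor[of _ i]) (auto simp: a_def b_def)
  qed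
  then have "(\<integral>\<omega>. (\<Prod>j\<in>{1..k}. occ (f j) \<omega>) \<partial>?\<mu>) =
      (\<integral>\<omega>. (\<Prod>j\<in>{1..k}. occ (a j) \<omega>) - (\<Prod>j\<in>{1..k}. occ (b j) \<omega>) \<partial>?\<mu>)"
    using f_occ_meas a(2) b(2) by (intro integral_cong_AE) auto
  also have "\<dots> = (\<integral>\<omega>. (\<Prod>j\<in>{1..k}. occ (a j) \<omega>) \<partial>?\<mu>) - (\<integral>\<omega>. (\<Prod>j\<in>{1..k}. occ (b j) \<omega>) \<partial>?\<mu>)"
    by (rule Bochner_Integration.integral_diff[OF a(2) b(2)])
  also have "\<dots> = (\<Sum>C\<in>circular_perms k. \<integral>x. (\<Prod>j\<in>{1..k}. f (rep C ! (j - 1)) (x j)) \<partial>?\<nu>)"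
    unfolding IH_a IH_b sum_subtractf[symmetric]
  proof (rule sum.cong[OF refl])
    fix C assume C: "C \<in> circular_perms k"
    obtain l where l: "l \<in> {1..k}" "rep C ! (l - 1) = i" "\<And>j. j \<in> {1..k} \<Longrightarrow> j \<noteq> l \<Longrightarrow> rep C ! (j - 1) \<noteq> i"
      using circular_rep_nth(3)[OF C bspec[OF rep C] i] by blast
    have "(\<Prod>j\<in>{1..k}. f (rep C ! (j - 1)) (x j)) =
        (\<Prod>j\<in>{1..k}. a (rep C ! (j - 1)) (x j)) - (\<Prod>j\<in>{1..k}. b (rep C ! (j - 1)) (x j))" for x
      using l by (intro prod_diff_one_factor[of _ l]) (auto simp: a_def b_def)
    then show "(\<integral>x. (\<Prod>j\<in>{1..k}. a (rep C ! (j - 1)) (x j)) \<partial>?\<nu>) - (\<integral>x. (\<Prod>j\<in>{1..k}. b (rep C ! (j - 1)) (x j)) \<partial>?\<nu>) =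
        (\<integral>x. (\<Prod>j\<in>{1..k}. f (rep C ! (j - 1)) (x j)) \<partial>?\<nu>)"
      using Bochner_Integration.integral_diff[OF a(3)[OF C] b(3)[OF C]] by simp
  qed
  finally show ?case .
qed

end

theorem theorem1p1:
  fixes Pt :: "real \<Rightarrow> 'a::{t2_space,second_countable_topology} \<Rightarrow> 'a measure"
    and Px :: "'a \<Rightarrow> (real \<Rightarrow> 'a option) measure"
    and m :: "'a measure"
    and u :: "real \<Rightarrow> 'a \<Rightarrow> 'a \<Rightarrow> ennreal"
    and Q :: "'a \<Rightarrow> (real \<Rightarrow> 'a option) measure"
    and k :: nat
    and f :: "nat \<Rightarrow> 'a \<Rightarrow> real"
    and rep :: "nat list set \<Rightarrow> nat list"
  assumes "process_with_potential_densities Pt Px m u"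
    and "\<And>z. is_Qzz Pt (u 0) z (Q z)"
    and "k \<ge> 2"
    and "\<And>j. j \<in> {1..k} \<Longrightarrow> f j \<in> borel_measurable borel"
    and "\<And>j. j \<in> {1..k} \<Longrightarrow> bounded (range (f j))"
    and "\<And>j. j \<in> {1..k} \<Longrightarrow> compact (closure {x. f j x \<noteq> 0})"
    and "\<And>C. C \<in> circular_perms k \<Longrightarrow> rep C \<in> C"
  shows "(AE \<omega> in loop_measure m Q. \<forall>j\<in>{1..k}.
            set_integrable lborel {0..} (\<lambda>t. ext0 (f j) (\<omega> t))) \<and>
         integrable (loop_measure m Q)
           (\<lambda>\<omega>. \<Prod>j\<in>{1..k}. LINT t:{0..}|lborel. ext0 (f j) (\<omega> t)) \<and>
         (\<forall>C\<in>circular_perms k.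
            integrable (cyclic_measure m (u 0) k) (\<lambda>x. \<Prod>j\<in>{1..k}. f (rep C ! (j - 1)) (x j))) \<and>
         (\<integral>\<omega>. (\<Prod>j\<in>{1..k}. LINT t:{0..}|lborel. ext0 (f j) (\<omega> t)) \<partial>loop_measure m Q) =
         (\<Sum>C\<in>circular_perms k.
            \<integral>x. (\<Prod>j\<in>{1..k}. f (rep C ! (j - 1)) (x j)) \<partial>cyclic_measure m (u 0) k)"
proof -
  interpret loop_bridges Pt Px m u Q
    by (intro loop_bridges.intro loop_bridges_axioms.intro assms(1,2))
  have rep: "\<forall>C\<in>circular_perms k. rep C \<in> C" using assms(7) by blast
  \<comment> \<open>the hypotheses concern only \<open>f 1, \<dots>, f k\<close>; extending by \<open>0\<close> gives one family with common bound and support\<close>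
  define g where "g j = (if j \<in> {1..k} then f j else (\<lambda>_. 0))" for j
  define K where "K = (\<Union>j\<in>{1..k}. closure {x. f j x \<noteq> 0})"
  have K: "compact K" unfolding K_def using assms(6) by (intro compact_UN) auto
  have "\<forall>j\<in>{1..k}. \<exists>c. \<forall>y. \<bar>f j y\<bar> \<le> c"
    using assms(5) by (auto simp: bounded_iff)
  then obtain B where B: "\<And>j y. j \<in> {1..k} \<Longrightarrow> \<bar>f j y\<bar> \<le> B j" by metis
  define c where "c = (\<Sum>j\<in>{1..k}. \<bar>B j\<bar>)"
  have g_meas: "g j \<in> borel_measurable borel" for j using assms(4) by (simp add: g_def)
  have g_bound: "\<bar>g j y\<bar> \<le> c * indicator K y" for j y
  proof (cases "j \<in> {1..k} \<and> f j y \<noteq> 0")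
    case True
    then have "y \<in> closure {x. f j x \<noteq> 0}" using closure_subset[of "{x. f j x \<noteq> 0}"] by blast
    then have "y \<in> K" unfolding K_def using True by blast
    have "\<bar>f j y\<bar> \<le> B j" using B True by simp
    also have "\<dots> \<le> \<bar>B j\<bar>" by simp
    also have "\<dots> \<le> c" unfolding c_def using True by (intro member_le_sum) auto
    finally show ?thesis using \<open>y \<in> K\<close> True by (auto simp: g_def)
  next
    case False
    have "0 \<le> c" unfolding c_def by (intro sum_nonneg) simp
    then show ?thesis using False by (auto simp: g_def)
  qed
  have occ: "(\<Prod>j\<in>{1..k}. occ (g j) \<omega>) = (\<Prod>j\<in>{1..k}. occ (f j) \<omega>)" for \<omega>
    by (intro prod.cong) (auto simp: g_def)
  have cyc: "(\<Prod>j\<in>{1..k}. g (rep C ! (j - 1)) (x j)) = (\<Prod>j\<in>{1..k}. f (rep C ! (j - 1)) (x j))"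
    if C: "C \<in> circular_perms k" for C x
    using circular_rep_nth(2)[OF C bspec[OF rep C]] by (intro prod.cong) (auto simp: g_def)
  note all = loop_measure_occupations[where f = g and rep = rep, OF K g_meas g_bound assms(3) rep]
  have 1: "AE \<omega> in loop_measure m Q. \<forall>j\<in>{1..k}. set_integrable lborel {0..} (\<lambda>t. ext0 (f j) (\<omega> t))"
    using all(1) by eventually_elim (auto simp: g_def)
  have 2: "integrable (loop_measure m Q) (\<lambda>\<omega>. \<Prod>j\<in>{1..k}. occ (f j) \<omega>)"
    using all(2) by (simp only: occ)
  have 3: "\<forall>C\<in>circular_perms k.
      integrable (cyclic_measure m (u 0) k) (\<lambda>x. \<Prod>j\<in>{1..k}. f (rep C ! (j - 1)) (x j))"
  proof
    fix C assume C: "C \<in> circular_perms k"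
    show "integrable (cyclic_measure m (u 0) k) (\<lambda>x. \<Prod>j\<in>{1..k}. f (rep C ! (j - 1)) (x j))"
      using all(3)[OF C] by (simp only: cyc[OF C])
  qed
  have "(\<integral>\<omega>. (\<Prod>j\<in>{1..k}. occ (g j) \<omega>) \<partial>loop_measure m Q) =
      (\<Sum>C\<in>circular_perms k. \<integral>x. (\<Prod>j\<in>{1..k}. g (rep C ! (j - 1)) (x j)) \<partial>cyclic_measure m (u 0) k)"
    by (rule integral_loop_measure_occupations[where f = g and rep = rep and J = "{1..k}", OF K g_meas g_bound assms(3) rep finite_atLeastAtMost subset_refl])
      (simp only: g_def if_False order_refl)
  also have "\<dots> =
      (\<Sum>C\<in>circular_perms k. \<integral>x. (\<Prod>j\<in>{1..k}. f (rep C ! (j - 1)) (x j)) \<partial>cyclic_measure m (u 0) k)"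
    by (rule sum.cong[OF refl]) (simp only: cyc)
  finally show ?thesis using 1 2 3 by (intro conjI) (simp_all only: occ)
qed

end
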